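(* Let $n\ge 2$ be an integer and let $a>0$, $E\ge 1$, $\alpha\ge 0$ be real constants. Define $r:[0,\infty)\to\mathbb{R}$ by $r(s)=\sqrt{1/a+s^2}$ and $\phi_E:[0,\infty)\to\mathbb{R}$ by $$\phi_E(s)=\int_0^s\frac{t\,dt}{(1/a+t^2)\sqrt{E(1+at^2)^n e^{\alpha t^2}-1}}.$$ For $s\in[0,\infty)$ set $$l_s=\Big\{\big(x_1 r(s)e^{i\phi_E(s)},\ldots,x_n r(s)e^{i\phi_E(s)}\big)\;:\;x_1,\ldots,x_n\in\mathbb{R},\ \sum_{j=1}^n x_j^2=1\Big\}\subset\mathbb{C}^n,\qquad L=\bigcup_{s\in[0,\infty)}l_s .$$ Fix $s_0\in(0,\infty)$ and suppose that $f$ is the solution (with values in $(0,\infty)$) of the initial-value problem $$\frac{df}{dt}=-(n-1)\,\frac{E(1+af^2)^n-e^{-\alpha f^2}}{E\,f\,(1+af^2)^n},\qquad f(0)=s_0 .$$ Then $\{l_{f(t)}\}_t$ is a mean curvature flow in $L$. In addition, when $E=1$: $L$ is a Lagrangian self-expander, in the sense that $L$ is a Lagrangian submanifold of $\mathbb{C}^n$ whose mean curvature vector $H^L$ in $\mathbb{C}^n$ satisfies $H^L=\alpha F^\perp$; the domain of definition of $f$ can be extended to $[0,\infty)$; $\lim_{t\to\infty}f(t)=0$; and $l_0$ is a minimal hypersurface in $L$.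
   Context: $\mathbb{C}^n=\mathbb{R}^{2n}$ carries the Euclidean metric and its standard symplectic form, and submanifolds carry the induced metrics. At a point $p$ of $L$, $F^\perp$ denotes the orthogonal projection of the position vector $p$ to the normal space of $L$ in $\mathbb{C}^n$. $L$ is parametrized by $(x,s)\mapsto r(s)e^{i\phi_E(s)}x$, $x\in S^{n-1}\subset\mathbb{R}^n$, $s\in[0,\infty)$ (understood as an immersed submanifold). When $E=1$ the integrand defining $\phi_E$ extends smoothly to $t=0$ and $L$ has boundary $l_0$; statements at $l_0$ are understood up to the boundary. The mean curvature vector of a submanifold $M$ of a Riemannian manifold $N$ is $\sum_j(\nabla_{e_j}e_j)^\perp$, where $\nabla$ is the Levi-Civita connection of $N$, $\{e_j\}$ is a local orthonormal frame of $TM$ and $\perp$ is the orthogonal projection to the normal bundle of $M$ in $N$. $M$ is minimal in $N$ if its mean curvature vector vanishes identically. A family of submanifolds $\{M_t\}$ of $N$ is a mean curvature flow in $N$ if it evolves with velocity equal to the mean curvature vector of $M_t$ in $N$; here this means that the map $(x,t)\mapsto r(f(t))e^{i\phi_E(f(t))}x$, $x\in S^{n-1}$, has $t$-derivative equal to the mean curvature vector of $l_{f(t)}$ in $L$ at the image point. *)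

theory Defs
  imports "HOL-Analysis.Analysis"
begin

section \<open>Smooth maps and immersions\<close>

text \<open>
  A manifold (possibly with boundary) is given by a subset \<open>D\<close> of a Euclidean space \<open>'p\<close>, here
  a sphere or a sphere times a half-line. An immersed submanifold of the Euclidean space \<open>'v\<close> is
  given by such a \<open>D\<close> together with an immersion \<open>F\<close> of \<open>D\<close> into \<open>'v\<close>; it carries the metric
  induced by \<open>F\<close>.
\<close>

primrec Ck_on :: "nat \<Rightarrow> ('p::euclidean_space \<Rightarrow> 'v::real_normed_vector) \<Rightarrow> 'p set \<Rightarrow> bool" where
  "Ck_on 0 f U \<longleftrightarrow> continuous_on U f"
| "Ck_on (Suc k) f U \<longleftrightarrow>
     (\<forall>q\<in>U. f differentiable (at q)) \<and>
     (\<forall>v. Ck_on k (\<lambda>q. frechet_derivative f (at q) v) U)"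

text \<open>Smoothness on an arbitrary subset is meant up to the boundary: locally there is an extension
  to an open set of the surrounding Euclidean space all of whose derivatives exist.\<close>

definition smooth_on :: "'p::euclidean_space set \<Rightarrow> ('p \<Rightarrow> 'v::real_normed_vector) \<Rightarrow> bool" where
  "smooth_on D f \<longleftrightarrow>
     (\<forall>p\<in>D. \<exists>U g. open U \<and> p \<in> U \<and> (\<forall>k. Ck_on k g U) \<and> (\<forall>q\<in>U \<inter> D. g q = f q))"

text \<open>The span of the velocities of one-sided curves in \<open>D\<close> is the full tangent space also at
  boundary points.\<close>

definition tangent_space :: "'p::euclidean_space set \<Rightarrow> 'p \<Rightarrow> 'p set" where
  "tangent_space D q =
     span {v. \<exists>\<gamma>::real \<Rightarrow> 'p. \<gamma> 0 = q \<and> (\<forall>t\<ge>0. \<gamma> t \<in> D) \<and>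
                (\<gamma> has_vector_derivative v) (at 0 within {0..})}"

text \<open>The derivative of \<open>f\<close> at \<open>q\<close> within \<open>D\<close> need not be unique as a linear map on \<open>'p\<close>, but its
  restriction to \<open>tangent_space D q\<close> is; \<open>differential\<close> is only ever applied to tangent vectors.\<close>

abbreviation differential ::
    "'p::euclidean_space set \<Rightarrow> ('p \<Rightarrow> 'v::real_normed_vector) \<Rightarrow> 'p \<Rightarrow> 'p \<Rightarrow> 'v" where
  "differential D f q \<equiv> frechet_derivative f (at q within D)"

definition immersion :: "'p::euclidean_space set \<Rightarrow> ('p \<Rightarrow> 'v::euclidean_space) \<Rightarrow> bool" where
  "immersion D F \<longleftrightarrow>
     smooth_on D F \<and> (\<forall>q\<in>D. inj_on (differential D F q) (tangent_space D q))"

definition image_tangent ::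
    "'p::euclidean_space set \<Rightarrow> ('p \<Rightarrow> 'v::euclidean_space) \<Rightarrow> 'p \<Rightarrow> 'v set" where
  "image_tangent D F q = differential D F q ` tangent_space D q"

definition normal_part :: "'v::euclidean_space set \<Rightarrow> 'v \<Rightarrow> 'v" where
  "normal_part T v = (THE w. (\<forall>u\<in>T. w \<bullet> u = 0) \<and> v - w \<in> T)"

definition orthonormal_basis_of :: "'v::euclidean_space set \<Rightarrow> nat \<Rightarrow> (nat \<Rightarrow> 'v) \<Rightarrow> bool" where
  "orthonormal_basis_of T m b \<longleftrightarrow>
     (\<forall>i<m. \<forall>j<m. b i \<bullet> b j = (if i = j then 1 else 0)) \<and> span (b ` {..<m}) = T"


section \<open>Vector fields and the Levi-Civita connection of the induced metric\<close>

text \<open>Tangent vector fields of an immersed submanifold are represented by their images under the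
  differential of \<open>F\<close>, so that the induced metric is the inner product of \<open>'v\<close>.\<close>

definition tangent_field ::
    "'p::euclidean_space set \<Rightarrow> ('p \<Rightarrow> 'v::euclidean_space) \<Rightarrow> ('p \<Rightarrow> 'v) \<Rightarrow> bool" where
  "tangent_field U F X \<longleftrightarrow> smooth_on U X \<and> (\<forall>q\<in>U. X q \<in> image_tangent U F q)"

text \<open>The derivative \<open>X g\<close> of a function \<open>g\<close> on \<open>U\<close> in the direction of the tangent field \<open>X\<close>.\<close>

definition field_deriv ::
    "'p::euclidean_space set \<Rightarrow> ('p \<Rightarrow> 'v::euclidean_space) \<Rightarrow> ('p \<Rightarrow> 'v) \<Rightarrow>
     ('p \<Rightarrow> 'w::real_normed_vector) \<Rightarrow> 'p \<Rightarrow> 'w" where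
  "field_deriv U F X g q =
     differential U g q (inv_into (tangent_space U q) (differential U F q) (X q))"

text \<open>Affine connection (tangent values, function-linear in the first slot, additive and Leibniz in
  the second) that is metric and torsion-free. The last condition is
  \<open>\<nabla> X Y - \<nabla> Y X = [X, Y]\<close>, with the Lie bracket given by its action on functions.\<close>

definition levi_civita ::
    "'p::euclidean_space set \<Rightarrow> ('p \<Rightarrow> 'v::euclidean_space) \<Rightarrow>
     (('p \<Rightarrow> 'v) \<Rightarrow> ('p \<Rightarrow> 'v) \<Rightarrow> 'p \<Rightarrow> 'v) \<Rightarrow> bool" where
  "levi_civita U F nabla \<longleftrightarrow>
     (\<forall>X Y. tangent_field U F X \<and> tangent_field U F Y \<longrightarrow> tangent_field U F (nabla X Y)) \<and>
     (\<forall>X X' Y. tangent_field U F X \<and> tangent_field U F X' \<and> tangent_field U F Y \<longrightarrow>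
        (\<forall>q\<in>U. nabla (\<lambda>q. X q + X' q) Y q = nabla X Y q + nabla X' Y q)) \<and>
     (\<forall>(u::'p \<Rightarrow> real) X Y. smooth_on U u \<and> tangent_field U F X \<and> tangent_field U F Y \<longrightarrow>
        (\<forall>q\<in>U. nabla (\<lambda>q. u q *\<^sub>R X q) Y q = u q *\<^sub>R nabla X Y q)) \<and>
     (\<forall>X Y Y'. tangent_field U F X \<and> tangent_field U F Y \<and> tangent_field U F Y' \<longrightarrow>
        (\<forall>q\<in>U. nabla X (\<lambda>q. Y q + Y' q) q = nabla X Y q + nabla X Y' q)) \<and>
     (\<forall>(u::'p \<Rightarrow> real) X Y. smooth_on U u \<and> tangent_field U F X \<and> tangent_field U F Y \<longrightarrow>
        (\<forall>q\<in>U. nabla X (\<lambda>q. u q *\<^sub>R Y q) q =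
                field_deriv U F X u q *\<^sub>R Y q + u q *\<^sub>R nabla X Y q)) \<and>
     (\<forall>X Y Z. tangent_field U F X \<and> tangent_field U F Y \<and> tangent_field U F Z \<longrightarrow>
        (\<forall>q\<in>U. field_deriv U F X (\<lambda>q. Y q \<bullet> Z q) q =
                nabla X Y q \<bullet> Z q + Y q \<bullet> nabla X Z q)) \<and>
     (\<forall>(u::'p \<Rightarrow> real) X Y. smooth_on U u \<and> tangent_field U F X \<and> tangent_field U F Y \<longrightarrow>
        (\<forall>q\<in>U. field_deriv U F (\<lambda>q. nabla X Y q - nabla Y X q) u q =
                field_deriv U F X (field_deriv U F Y u) q -
                field_deriv U F Y (field_deriv U F X u) q))"


section \<open>Mean curvature\<close>

text \<open>
  \<open>H\<close> is the mean curvature vector at \<open>q\<close> of the immersed submanifold \<open>F : D \<rightarrow> 'v\<close> of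
  Euclidean space. The Levi-Civita connection of Euclidean space is the directional derivative; in
  directions tangent to the submanifold it can be computed along the immersion.
\<close>

definition has_mean_curvature ::
    "'p::euclidean_space set \<Rightarrow> ('p \<Rightarrow> 'v::euclidean_space) \<Rightarrow> 'p \<Rightarrow> 'v \<Rightarrow> bool" where
  "has_mean_curvature D F q H \<longleftrightarrow>
     (\<exists>U m e. openin (top_of_set D) U \<and> q \<in> U \<and> immersion U F \<and>
        (\<forall>i<m. tangent_field U F (e i)) \<and>
        (\<forall>y\<in>U. orthonormal_basis_of (image_tangent U F y) m (\<lambda>i. e i y)) \<and>
        H = (\<Sum>i<m. normal_part (image_tangent U F q) (field_deriv U F (e i) (e i) q)))"

text \<open>
  The same for a submanifold \<open>\<iota> : S \<rightarrow> D\<close> of the Riemannian manifold \<open>F : D \<rightarrow> 'v\<close>, at the point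
  \<open>x\<close> of \<open>S\<close>. The fields \<open>e i\<close> are tangent fields of the ambient manifold near \<open>\<iota> x\<close> whose
  restrictions to the submanifold form a local orthonormal frame of it. As \<open>nabla\<close> takes values
  tangent to the ambient manifold, \<open>normal_part\<close> is the projection to the normal bundle there.
\<close>

definition has_mean_curvature_in ::
    "'p::euclidean_space set \<Rightarrow> ('p \<Rightarrow> 'v::euclidean_space) \<Rightarrow>
     'q::euclidean_space set \<Rightarrow> ('q \<Rightarrow> 'p) \<Rightarrow> 'q \<Rightarrow> 'v \<Rightarrow> bool" where
  "has_mean_curvature_in D F S \<iota> x H \<longleftrightarrow>
     (\<exists>U nabla m e. openin (top_of_set D) U \<and> \<iota> x \<in> U \<and> immersion U F \<and> levi_civita U F nabla \<and>
        (\<forall>i<m. tangent_field U F (e i)) \<and>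
        (\<forall>y\<in>S. \<iota> y \<in> U \<longrightarrow>
           orthonormal_basis_of (image_tangent S (F \<circ> \<iota>) y) m (\<lambda>i. e i (\<iota> y))) \<and>
        H = (\<Sum>i<m. normal_part (image_tangent S (F \<circ> \<iota>) x) (nabla (e i) (e i) (\<iota> x))))"

definition immersed_in ::
    "'p::euclidean_space set \<Rightarrow> ('p \<Rightarrow> 'v::euclidean_space) \<Rightarrow>
     'q::euclidean_space set \<Rightarrow> ('q \<Rightarrow> 'p) \<Rightarrow> bool" where
  "immersed_in D F S \<iota> \<longleftrightarrow> \<iota> ` S \<subseteq> D \<and> smooth_on S \<iota> \<and> immersion S (F \<circ> \<iota>)"

definition mean_curvature_flow_in ::
    "'p::euclidean_space set \<Rightarrow> ('p \<Rightarrow> 'v::euclidean_space) \<Rightarrow>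
     'q::euclidean_space set \<Rightarrow> real set \<Rightarrow> (real \<Rightarrow> 'q \<Rightarrow> 'p) \<Rightarrow> bool" where
  "mean_curvature_flow_in D F S I \<iota> \<longleftrightarrow>
     (\<forall>t\<in>I. immersed_in D F S (\<iota> t) \<and>
        (\<forall>x\<in>S. \<exists>H. has_mean_curvature_in D F S (\<iota> t) x H \<and>
                   ((\<lambda>t. F (\<iota> t x)) has_vector_derivative H) (at t within I)))"

definition minimal_hypersurface_in ::
    "'p::euclidean_space set \<Rightarrow> ('p \<Rightarrow> 'v::euclidean_space) \<Rightarrow>
     'q::euclidean_space set \<Rightarrow> ('q \<Rightarrow> 'p) \<Rightarrow> bool" where
  "minimal_hypersurface_in D F S \<iota> \<longleftrightarrow>
     immersed_in D F S \<iota> \<and>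
     (\<forall>x\<in>S. dim (image_tangent D F (\<iota> x)) = dim (image_tangent S (F \<circ> \<iota>) x) + 1 \<and>
            has_mean_curvature_in D F S \<iota> x 0)"


section \<open>Lagrangian self-expanders\<close>

text \<open>The symplectic form \<open>\<Sum>j. dx\<^sub>j \<and> dy\<^sub>j\<close>, where \<open>z\<^sub>j = x\<^sub>j + i y\<^sub>j\<close>.\<close>

definition symplectic_form :: "complex ^ 'n \<Rightarrow> complex ^ 'n \<Rightarrow> real" where
  "symplectic_form z w = (\<Sum>j\<in>UNIV. Re (z $ j) * Im (w $ j) - Im (z $ j) * Re (w $ j))"

definition lagrangian :: "'p::euclidean_space set \<Rightarrow> ('p \<Rightarrow> complex ^ 'n) \<Rightarrow> bool" where
  "lagrangian D F \<longleftrightarrow>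
     immersion D F \<and>
     (\<forall>q\<in>D. dim (image_tangent D F q) = CARD('n) \<and>
            (\<forall>v\<in>image_tangent D F q. \<forall>w\<in>image_tangent D F q. symplectic_form v w = 0))"

definition lagrangian_self_expander ::
    "real \<Rightarrow> 'p::euclidean_space set \<Rightarrow> ('p \<Rightarrow> complex ^ 'n) \<Rightarrow> bool" where
  "lagrangian_self_expander \<alpha> D F \<longleftrightarrow>
     lagrangian D F \<and>
     (\<forall>q\<in>D. has_mean_curvature D F q (\<alpha> *\<^sub>R normal_part (image_tangent D F q) (F q)))"


section \<open>The submanifold \<open>L\<close>, its slices, and the initial-value problem\<close>

definition radius :: "real \<Rightarrow> real \<Rightarrow> real" where
  "radius a s = sqrt (1 / a + s\<^sup>2)"

text \<open>If \<open>E = 1\<close>, the integrand below evaluates to \<open>0\<close> at \<open>t = 0\<close> instead of its limit; this does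
  not affect the integral.\<close>

definition phase :: "nat \<Rightarrow> real \<Rightarrow> real \<Rightarrow> real \<Rightarrow> real \<Rightarrow> real" where
  "phase n a E \<alpha> s =
     integral {0..s}
       (\<lambda>t. t / ((1 / a + t\<^sup>2) * sqrt (E * (1 + a * t\<^sup>2) ^ n * exp (\<alpha> * t\<^sup>2) - 1)))"

definition L_dom :: "((real ^ 'n) \<times> real) set" where
  "L_dom = sphere 0 1 \<times> {0..}"

definition L_map :: "real \<Rightarrow> real \<Rightarrow> real \<Rightarrow> (real ^ 'n) \<times> real \<Rightarrow> complex ^ 'n" where
  "L_map a E \<alpha> = (\<lambda>(x, s). \<chi> j.
     complex_of_real (x $ j * radius a s) * exp (\<i> * complex_of_real (phase CARD('n) a E \<alpha> s)))"

definition slice :: "real \<Rightarrow> real ^ 'n \<Rightarrow> (real ^ 'n) \<times> real" where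
  "slice s x = (x, s)"

definition l_set :: "real \<Rightarrow> real \<Rightarrow> real \<Rightarrow> real \<Rightarrow> (complex ^ 'n) set" where
  "l_set a E \<alpha> s =
     {(\<chi> j. complex_of_real (x $ j * radius a s) *
              exp (\<i> * complex_of_real (phase CARD('n) a E \<alpha> s))) | x :: real ^ 'n.
        (\<Sum>j\<in>UNIV. (x $ j)\<^sup>2) = 1}"

definition L_set :: "real \<Rightarrow> real \<Rightarrow> real \<Rightarrow> (complex ^ 'n) set" where
  "L_set a E \<alpha> = (\<Union>s\<in>{0..}. l_set a E \<alpha> s)"

lemma l_set_eq_image: "l_set a E \<alpha> s = (L_map a E \<alpha> \<circ> slice s) ` sphere 0 1"
  by (auto simp: l_set_def L_map_def slice_def norm_vec_def L2_set_def image_iff)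

lemma L_set_eq_image: "L_set a E \<alpha> = L_map a E \<alpha> ` L_dom"
  by (force simp: L_set_def l_set_eq_image L_dom_def slice_def)

text \<open>\<open>f\<close> is a positive solution, on the interval \<open>I\<close> containing \<open>0\<close>, of the initial-value problem;
  derivatives at endpoints belonging to \<open>I\<close> are one-sided.\<close>

definition ivp_solution ::
    "nat \<Rightarrow> real \<Rightarrow> real \<Rightarrow> real \<Rightarrow> real \<Rightarrow> real set \<Rightarrow> (real \<Rightarrow> real) \<Rightarrow> bool" where
  "ivp_solution n a E \<alpha> s\<^sub>0 I f \<longleftrightarrow>
     is_interval I \<and> 0 \<in> I \<and> f 0 = s\<^sub>0 \<and>
     (\<forall>t\<in>I. 0 < f t \<and>
        (f has_real_derivative
           - (real n - 1) * ((E * (1 + a * (f t)\<^sup>2) ^ n - exp (- \<alpha> * (f t)\<^sup>2)) /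
                             (E * f t * (1 + a * (f t)\<^sup>2) ^ n))) (at t within I))"

end

theory Submission
  imports Defs
begin

text \<open>
  The immersion is \<open>F (x, s) = z s x\<close> with the plane curve \<open>z = r e\<^sup>i\<^sup>\<phi>\<close>, so each geometric quantity
  is a formula in \<open>z\<close>, \<open>z'\<close> and \<open>z''\<close>. The tangent space of \<open>L\<close> at \<open>(x, s)\<close> consists of the vectors
  \<open>z w\<close>, for \<open>w\<close> orthogonal to \<open>x\<close>, and of the multiples of \<open>z' x\<close>; the two parts are orthogonal,
  and the symplectic form vanishes on them because \<open>w\<close> and \<open>x\<close> are real and orthogonal. Of a vector
  \<open>c x\<close> with \<open>c\<close> complex, the projection normal to \<open>L\<close> retains the component of \<open>c\<close> orthogonal to \<open>z'\<close>,
  that is, \<open>Im (c / z')\<close>.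

  \<^item> Mean curvature flow. A unit circle direction of a slice has acceleration \<open>- (z / \<bar>z\<bar>\<^sup>2) x\<close>, whose
    part tangent to \<open>L\<close> is a multiple of \<open>z' x\<close>. The slice at \<open>s\<close> therefore has mean curvature vector
    \<open>- (n - 1) Re (z / z') / \<bar>z\<bar>\<^sup>2\<close> times \<open>\<partial>\<^sub>s F\<close> (\<open>slice_mean_curvature\<close>). With
    \<open>G = E (1 + a s\<^sup>2)\<^sup>n exp (\<alpha> s\<^sup>2)\<close> one finds \<open>\<bar>z'\<bar>\<^sup>2 = (s / r)\<^sup>2 G / (G - 1)\<close>, and the coefficient becomes
    the right-hand side of the differential equation (\<open>flow_speed\<close>). For \<open>E = 1\<close> the curve starts
    perpendicular to its position vector, so that \<open>Re (z / z') = 0\<close> and the slice at \<open>0\<close> is minimal.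

  \<^item> Self-expander. Adding the acceleration of the curve itself, \<open>H = \<alpha> F\<^sup>\<bottom>\<close> says that
    \<open>z'' / \<bar>z'\<bar>\<^sup>2 - ((n - 1) / \<bar>z\<bar>\<^sup>2 + \<alpha>) z\<close> is a real multiple of \<open>z'\<close> (\<open>expander_mean_curvature\<close>).
    Let \<open>u\<close> be the cotangent of the angle from \<open>z\<close> to \<open>z'\<close>. For \<open>E = 1\<close> the definition of the phase
    means \<open>1 + u\<^sup>2 = G\<close>, and the condition is the logarithmic derivative of this identity
    (\<open>cotangent_deriv\<close>, \<open>expander_equation\<close>).

  \<^item> Smoothness up to the boundary. For \<open>E = 1\<close> the integrand of the phase is singular in form
    at \<open>0\<close>, but \<open>G - 1\<close> is \<open>s\<^sup>2\<close> times a smooth positive function, and the phase continues smoothly to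
    negative \<open>s\<close>. All derivatives on \<open>S\<^sup>n\<^sup>-\<^sup>1 \<times> [0, \<infinity>)\<close> are computed from the extension of \<open>F\<close> to
    \<open>\<real>\<^sup>n \<times> J\<close> with \<open>J\<close> open (\<open>differential_of_extension\<close>).

  \<^item> The connection. Mean curvature in \<open>L\<close> refers to its Levi-Civita connection, which is shown to be
    the tangential part of the Euclidean derivative (\<open>levi_civita_connection\<close>). The tangential
    projection is \<open>dF\<close> composed with its pseudo-inverse, and the latter is rational in \<open>x\<close>, \<open>z\<close>, \<open>z'\<close>.
    Freedom from torsion comes down to the symmetry of second derivatives of \<open>F\<close> and of the test
    function, and to brackets of tangent fields being tangent.

  \<^item> Long-time behaviour. In terms of \<open>ln f\<close> the equation is separable, with a speed that is bounded on
    the whole line. Hence a global solution exists, it agrees with \<open>f\<close>, and \<open>ln f\<close> tends to \<open>- \<infinity>\<close>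
    (\<open>decaying_flow\<close>).
\<close>


section \<open>Smooth functions on open sets\<close>

lemma Ck_on_cong:
  assumes "open U" "\<And>q. q \<in> U \<Longrightarrow> f q = g q"
  shows "Ck_on k f U \<longleftrightarrow> Ck_on k g U"
  using assms(2)
proof (induction k arbitrary: f g)
  case 0
  then show ?case by (simp cong: continuous_on_cong)
next
  case (Suc k)
  have d: "f differentiable (at q) \<longleftrightarrow> g differentiable (at q)" if "q \<in> U" for q
    unfolding differentiable_def
    using Suc.prems has_derivative_transform_within_open[OF _ \<open>open U\<close> that, of f _ UNIV g]
      has_derivative_transform_within_open[OF _ \<open>open U\<close> that, of g _ UNIV f] by metis
  have e: "frechet_derivative f (at q) v = frechet_derivative g (at q) v"
    if "q \<in> U" "f differentiable (at q)" for q v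
    using frechet_derivative_transform_within_open[OF that(2) \<open>open U\<close> that(1), of g] Suc.prems
    by metis
  show ?case
  proof (cases "\<forall>q\<in>U. f differentiable (at q)")
    case True
    then have "Ck_on k (\<lambda>q. frechet_derivative f (at q) v) U \<longleftrightarrow>
        Ck_on k (\<lambda>q. frechet_derivative g (at q) v) U" for v
      by (intro Suc.IH) (use e in auto)
    with True d show ?thesis by simp
  qed (use d in auto)
qed

lemma Ck_on_Suc_iff:
  assumes "open U" "\<And>q. q \<in> U \<Longrightarrow> (f has_derivative f' q) (at q)"
  shows "Ck_on (Suc k) f U \<longleftrightarrow> (\<forall>v. Ck_on k (\<lambda>q. f' q v) U)"
proof -
  have "Ck_on k (\<lambda>q. frechet_derivative f (at q) v) U \<longleftrightarrow> Ck_on k (\<lambda>q. f' q v) U" for v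
    by (rule Ck_on_cong[OF assms(1)]) (use assms(2) frechet_derivative_at in metis)
  moreover have "\<forall>q\<in>U. f differentiable (at q)"
    using assms(2) differentiableI by blast
  ultimately show ?thesis by simp
qed

lemmas Ck_on_SucI = Ck_on_Suc_iff[THEN iffD2, rule_format]

lemma Ck_on_subset: "Ck_on k f U \<Longrightarrow> V \<subseteq> U \<Longrightarrow> Ck_on k f V"
  by (induction k arbitrary: f) (auto intro: continuous_on_subset)

lemma Ck_on_SucD: "Ck_on (Suc k) f U \<Longrightarrow> Ck_on k f U"
proof (induction k arbitrary: f)
  case 0
  then show ?case
    by (simp add: differentiable_imp_continuous_on differentiable_on_def
        differentiable_at_withinI)
next
  case (Suc k)
  then show ?case by (metis Ck_on.simps(2))
qed

lemma Ck_on_const: "open U \<Longrightarrow> Ck_on k (\<lambda>_. c) U"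
proof (induction k arbitrary: c)
  case (Suc k)
  then show ?case
    using Ck_on_Suc_iff[OF \<open>open U\<close>, of "\<lambda>_. c" "\<lambda>_ _. 0"] by simp
qed simp

lemma Ck_on_add:
  assumes "open U" "Ck_on k f U" "Ck_on k g U"
  shows "Ck_on k (\<lambda>q. f q + g q) U"
  using assms(2,3)
proof (induction k arbitrary: f g)
  case (Suc k)
  have "((\<lambda>q. f q + g q) has_derivative
      (\<lambda>v. frechet_derivative f (at q) v + frechet_derivative g (at q) v)) (at q)"
    if "q \<in> U" for q
    using Suc.prems that
    by (intro has_derivative_add) (simp_all add: frechet_derivative_works)
  from Ck_on_Suc_iff[OF \<open>open U\<close> this] show ?case
    using Suc by simp
qed (auto intro: continuous_intros)

lemma Ck_on_bilinear:
  assumes "bounded_bilinear B" "open U" "Ck_on k f U" "Ck_on k g U"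
  shows "Ck_on k (\<lambda>q. B (f q) (g q)) U"
  using assms(3,4)
proof (induction k arbitrary: f g)
  case 0
  then show ?case
    using bounded_bilinear.continuous_on[OF assms(1)] by auto
next
  case (Suc k)
  have "((\<lambda>q. B (f q) (g q)) has_derivative
      (\<lambda>v. B (f q) (frechet_derivative g (at q) v) + B (frechet_derivative f (at q) v) (g q)))
      (at q)"
    if "q \<in> U" for q
    using Suc.prems that
    by (intro bounded_bilinear.FDERIV[OF assms(1)]) (simp_all add: frechet_derivative_works)
  from Ck_on_Suc_iff[OF \<open>open U\<close> this] show ?case
    using Suc.prems Ck_on_SucD[OF Suc.prems(1)] Ck_on_SucD[OF Suc.prems(2)]
    by (simp add: Ck_on_add[OF \<open>open U\<close>] Suc.IH)
qed

lemma Ck_on_linear: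
  assumes "bounded_linear L" "open U" "Ck_on k f U"
  shows "Ck_on k (\<lambda>q. L (f q)) U"
  using assms(3)
proof (induction k arbitrary: f)
  case 0
  then show ?case
    using bounded_linear.continuous_on[OF assms(1)] by auto
next
  case (Suc k)
  have "((\<lambda>q. L (f q)) has_derivative (\<lambda>v. L (frechet_derivative f (at q) v))) (at q)"
    if "q \<in> U" for q
    using Suc.prems that
    by (intro bounded_linear.has_derivative[OF assms(1)]) (simp_all add: frechet_derivative_works)
  from Ck_on_Suc_iff[OF \<open>open U\<close> this] show ?case
    using Suc by simp
qed

lemma Ck_on_id:
  assumes "open U"
  shows "Ck_on k (\<lambda>q. q) U"
proof (cases k)
  case 0
  then show ?thesis by simp
next
  case (Suc j)
  have "Ck_on (Suc j) (\<lambda>q. q) U"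
    using Ck_on_const[OF assms] by (subst Ck_on_Suc_iff[OF assms has_derivative_ident]) auto
  with Suc show ?thesis by (simp only:)
qed

lemma Ck_on_sum:
  assumes "open U" "\<And>i. i \<in> A \<Longrightarrow> Ck_on k (f i) U"
  shows "Ck_on k (\<lambda>q. \<Sum>i\<in>A. f i q) U"
  using assms(2)
  by (induction A rule: infinite_finite_induct) (auto intro: Ck_on_const Ck_on_add assms(1))

text \<open>The derivative of \<open>f\<close> in the direction of a moving vector expands over a basis into products
  of \<open>C\<^sup>k\<close> functions. This is what makes both the chain rule and directional derivatives along
  vector fields preserve smoothness.\<close>

lemma Ck_on_linear_expand:
  fixes \<xi> :: "'a::euclidean_space \<Rightarrow> 'p::euclidean_space"
  assumes "open U" "\<And>q. q \<in> U \<Longrightarrow> linear (D q)"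
    and "\<And>b. Ck_on k (\<lambda>q. D q b) U" "Ck_on k \<xi> U"
  shows "Ck_on k (\<lambda>q. D q (\<xi> q)) U"
proof -
  have "D q (\<xi> q) = (\<Sum>b\<in>Basis. (\<xi> q \<bullet> b) *\<^sub>R D q b)" if "q \<in> U" for q
  proof -
    interpret linear "D q" by (rule assms(2)[OF that])
    have "D q (\<xi> q) = D q (\<Sum>b\<in>Basis. (\<xi> q \<bullet> b) *\<^sub>R b)"
      by (simp add: euclidean_representation)
    then show ?thesis by (simp add: sum scale)
  qed
  then have expand: "Ck_on k (\<lambda>q. D q (\<xi> q)) U \<longleftrightarrow>
      Ck_on k (\<lambda>q. \<Sum>b\<in>Basis. (\<xi> q \<bullet> b) *\<^sub>R D q b) U"
    by (rule Ck_on_cong[OF assms(1)])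
  show ?thesis
    unfolding expand
    by (intro Ck_on_sum Ck_on_bilinear[OF bounded_bilinear_scaleR]
        Ck_on_linear[OF bounded_linear_inner_left] assms)
qed

lemma Ck_on_compose:
  fixes f :: "'p::euclidean_space \<Rightarrow> 'q::euclidean_space"
  assumes "open U" "open V" "f ` U \<subseteq> V" "Ck_on k f U" "Ck_on k g V"
  shows "Ck_on k (\<lambda>q. g (f q)) U"
  using assms(4,5)
proof (induction k arbitrary: g)
  case 0
  then show ?case
    using continuous_on_compose2[of V g U f] assms(3) by auto
next
  case (Suc k)
  let ?D = "\<lambda>q. frechet_derivative g (at (f q))"
  have fD: "f differentiable (at q)" if "q \<in> U" for q
    using Suc.prems(1) that by (simp only: Ck_on.simps)
  have fv: "Ck_on k (\<lambda>q. frechet_derivative f (at q) v) U" for v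
    using Suc.prems(1) by (simp only: Ck_on.simps)
  have gD: "g differentiable (at (f q))" if "q \<in> U" for q
    using Suc.prems(2) assms(3) that by (simp only: Ck_on.simps) blast
  have gv: "Ck_on k (\<lambda>y. frechet_derivative g (at y) v) V" for v
    using Suc.prems(2) by (simp only: Ck_on.simps)
  have dg: "(g has_derivative ?D q) (at (f q))" if "q \<in> U" for q
    using gD[OF that] by (simp only: frechet_derivative_works)
  have "((\<lambda>q. g (f q)) has_derivative (\<lambda>v. ?D q (frechet_derivative f (at q) v))) (at q)"
    if "q \<in> U" for q
    by (rule has_derivative_compose[OF fD[OF that, unfolded frechet_derivative_works] dg[OF that]])
  note iff = Ck_on_Suc_iff[OF \<open>open U\<close> this]
  have "Ck_on k (\<lambda>q. ?D q (frechet_derivative f (at q) v)) U" for v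
  proof (rule Ck_on_linear_expand[OF \<open>open U\<close> _ _ fv])
    show "linear (?D q)" if "q \<in> U" for q
      using dg[OF that] by (rule has_derivative_linear)
    show "Ck_on k (\<lambda>q. ?D q b) U" for b
      by (rule Suc.IH[OF Ck_on_SucD[OF Suc.prems(1)] gv])
  qed
  then show ?case by (simp only: iff simp_thms)
qed

text \<open>Openness is part of the notion because derivatives are taken in the full space.\<close>

definition Cinf_on :: "'p::euclidean_space set \<Rightarrow> ('p \<Rightarrow> 'v::real_normed_vector) \<Rightarrow> bool" where
  "Cinf_on W f \<longleftrightarrow> open W \<and> (\<forall>k. Ck_on k f W)"

lemma Cinf_on_openD: "Cinf_on W f \<Longrightarrow> open W"
  by (simp add: Cinf_on_def)

lemma Cinf_on_cong:
  assumes "\<And>q. q \<in> W \<Longrightarrow> f q = g q"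
  shows "Cinf_on W f \<longleftrightarrow> Cinf_on W g"
  using Ck_on_cong[of W f g] assms by (auto simp: Cinf_on_def)

lemma Cinf_on_subset: "Cinf_on W f \<Longrightarrow> open V \<Longrightarrow> V \<subseteq> W \<Longrightarrow> Cinf_on V f"
  using Ck_on_subset[of _ f W V] by (simp add: Cinf_on_def)

lemma Cinf_on_deriv_intro:
  assumes "open W" "\<And>q. q \<in> W \<Longrightarrow> (f has_derivative f' q) (at q)" "\<And>v. Cinf_on W (\<lambda>q. f' q v)"
  shows "Cinf_on W f"
proof -
  have "Ck_on (Suc k) f W" for k
    using Ck_on_Suc_iff[OF assms(1,2)] assms(3) by (simp add: Cinf_on_def)
  then show ?thesis
    using Ck_on_SucD[of _ f W] assms(1) by (simp only: Cinf_on_def) blast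
qed

lemma Cinf_on_differentiable: "Cinf_on W f \<Longrightarrow> q \<in> W \<Longrightarrow> f differentiable (at q)"
  using Ck_on.simps(2)[of 0 f W] by (simp only: Cinf_on_def) blast

lemma Cinf_on_has_derivative:
  "Cinf_on W f \<Longrightarrow> q \<in> W \<Longrightarrow> (f has_derivative frechet_derivative f (at q)) (at q)"
  using Cinf_on_differentiable frechet_derivative_works by blast

lemma Cinf_on_frechet_derivative: "Cinf_on W f \<Longrightarrow> Cinf_on W (\<lambda>q. frechet_derivative f (at q) v)"
  using Ck_on.simps(2)[of _ f W] by (simp only: Cinf_on_def) blast

lemma Cinf_on_directional_derivative:
  assumes "Cinf_on W f" "Cinf_on W \<xi>"
  shows "Cinf_on W (\<lambda>q. frechet_derivative f (at q) (\<xi> q))"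
  unfolding Cinf_on_def
proof (intro conjI allI)
  show "open W"
    using assms(1) by (rule Cinf_on_openD)
  show "Ck_on k (\<lambda>q. frechet_derivative f (at q) (\<xi> q)) W" for k
  proof (rule Ck_on_linear_expand[OF \<open>open W\<close>])
    show "linear (frechet_derivative f (at q))" if "q \<in> W" for q
      by (rule has_derivative_linear[OF Cinf_on_has_derivative[OF assms(1) that]])
    show "Ck_on k (\<lambda>q. frechet_derivative f (at q) b) W" for b
      using Cinf_on_frechet_derivative[OF assms(1)] by (simp add: Cinf_on_def)
    show "Ck_on k \<xi> W"
      using assms(2) by (simp add: Cinf_on_def)
  qed
qed

lemma Cinf_on_continuous_on: "Cinf_on W f \<Longrightarrow> continuous_on W f"
  using Ck_on.simps(1)[of f W] by (simp only: Cinf_on_def)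

named_theorems Cinf_intros

lemma Cinf_on_const [Cinf_intros]: "open W \<Longrightarrow> Cinf_on W (\<lambda>_. c)"
  by (simp add: Cinf_on_def Ck_on_const)

lemma Cinf_on_id [Cinf_intros]: "open W \<Longrightarrow> Cinf_on W (\<lambda>q. q)"
  by (simp add: Cinf_on_def Ck_on_id)

lemma Cinf_on_add [Cinf_intros]:
  "Cinf_on W f \<Longrightarrow> Cinf_on W g \<Longrightarrow> Cinf_on W (\<lambda>q. f q + g q)"
  by (simp add: Cinf_on_def Ck_on_add)

lemma Cinf_on_sum [Cinf_intros]:
  "open W \<Longrightarrow> (\<And>i. i \<in> A \<Longrightarrow> Cinf_on W (f i)) \<Longrightarrow> Cinf_on W (\<lambda>q. \<Sum>i\<in>A. f i q)"
  by (simp add: Cinf_on_def Ck_on_sum)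

lemma Cinf_on_linear: "bounded_linear L \<Longrightarrow> Cinf_on W f \<Longrightarrow> Cinf_on W (\<lambda>q. L (f q))"
  by (simp add: Cinf_on_def Ck_on_linear)

lemma Cinf_on_bilinear:
  "bounded_bilinear B \<Longrightarrow> Cinf_on W f \<Longrightarrow> Cinf_on W g \<Longrightarrow> Cinf_on W (\<lambda>q. B (f q) (g q))"
  by (simp add: Cinf_on_def Ck_on_bilinear)

lemma Cinf_on_compose:
  fixes f :: "'p::euclidean_space \<Rightarrow> 'q::euclidean_space"
  shows "Cinf_on V g \<Longrightarrow> Cinf_on W f \<Longrightarrow> f ` W \<subseteq> V \<Longrightarrow> Cinf_on W (\<lambda>q. g (f q))"
  unfolding Cinf_on_def by (auto intro: Ck_on_compose)

lemmas Cinf_on_scaleR [Cinf_intros] = Cinf_on_bilinear[OF bounded_bilinear_scaleR]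
  and Cinf_on_mult [Cinf_intros] = Cinf_on_bilinear[OF bounded_bilinear_mult]
  and Cinf_on_inner [Cinf_intros] = Cinf_on_bilinear[OF bounded_bilinear_inner]
  and Cinf_on_fst [Cinf_intros] = Cinf_on_linear[OF bounded_linear_fst]
  and Cinf_on_snd [Cinf_intros] = Cinf_on_linear[OF bounded_linear_snd]
  and Cinf_on_minus [Cinf_intros] = Cinf_on_linear[OF bounded_linear_minus[OF bounded_linear_ident]]
  and Cinf_on_of_real [Cinf_intros] = Cinf_on_linear[OF bounded_linear_of_real]

lemma Cinf_on_diff [Cinf_intros]:
  "Cinf_on W f \<Longrightarrow> Cinf_on W g \<Longrightarrow> Cinf_on W (\<lambda>q. f q - g q)"
  using Cinf_on_add[of W f "\<lambda>q. - g q"] Cinf_on_minus[of W g] by simp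

lemma Cinf_on_Pair [Cinf_intros]:
  fixes f :: "_ \<Rightarrow> 'a::euclidean_space" and g :: "_ \<Rightarrow> 'b::euclidean_space"
  assumes "Cinf_on W f" "Cinf_on W g"
  shows "Cinf_on W (\<lambda>q. (f q, g q))"
proof -
  have "bounded_linear (\<lambda>x::'a. (x, 0::'b))" "bounded_linear (\<lambda>y::'b. (0::'a, y))"
    by (simp_all add: bounded_linear_Pair bounded_linear_ident bounded_linear_zero)
  from Cinf_on_add[OF Cinf_on_linear[OF this(1) assms(1)] Cinf_on_linear[OF this(2) assms(2)]]
  show ?thesis by simp
qed

lemma Cinf_on_power [Cinf_intros]:
  fixes f :: "_ \<Rightarrow> 'a::{real_normed_algebra_1}"
  shows "Cinf_on W f \<Longrightarrow> Cinf_on W (\<lambda>q. f q ^ m)"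
  by (induction m) (auto intro: Cinf_intros dest: Cinf_on_openD)

text \<open>The derivative of the inverse is expressed through the inverse itself, so being \<open>C\<^sup>k\<close> passes to the
  derivative and gives \<open>C\<^sup>k\<^sup>+\<^sup>1\<close>. The exponential and the square root are treated in the same way.\<close>

lemma Cinf_on_inverse_base:
  "Cinf_on {x. x \<noteq> 0} (inverse :: 'a::{real_normed_field,euclidean_space} \<Rightarrow> 'a)"
proof -
  have U: "open {x::'a. x \<noteq> 0}"
    by (simp add: open_Collect_neq)
  have "Ck_on k (inverse :: 'a \<Rightarrow> 'a) {x. x \<noteq> 0}" for k
  proof (induction k)
    case 0
    then show ?case by (auto intro: continuous_intros)
  next
    case (Suc k)
    have "Ck_on k (\<lambda>x::'a. - (inverse x * v * inverse x)) {x. x \<noteq> 0}" for v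
      using U Suc.IH
      by (intro Ck_on_linear[OF bounded_linear_minus[OF bounded_linear_ident]]
          Ck_on_bilinear[OF bounded_bilinear_mult] Ck_on_const) auto
    then show ?case
      by (intro Ck_on_SucI[OF U, of inverse "\<lambda>x v. - (inverse x * v * inverse x)"])
        (auto intro: has_derivative_inverse')
  qed
  with U show ?thesis by (simp add: Cinf_on_def)
qed

lemma Cinf_on_inverse [Cinf_intros]:
  fixes f :: "_ \<Rightarrow> 'a::{real_normed_field,euclidean_space}"
  shows "Cinf_on W f \<Longrightarrow> (\<And>q. q \<in> W \<Longrightarrow> f q \<noteq> 0) \<Longrightarrow> Cinf_on W (\<lambda>q. inverse (f q))"
  by (rule Cinf_on_compose[OF Cinf_on_inverse_base]) auto

lemma Cinf_on_divide [Cinf_intros]: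
  fixes f g :: "_ \<Rightarrow> 'a::{real_normed_field,euclidean_space}"
  shows "Cinf_on W f \<Longrightarrow> Cinf_on W g \<Longrightarrow> (\<And>q. q \<in> W \<Longrightarrow> g q \<noteq> 0) \<Longrightarrow> Cinf_on W (\<lambda>q. f q / g q)"
  unfolding divide_inverse by (intro Cinf_intros)

lemma Cinf_on_exp_base:
  "Cinf_on UNIV (exp :: 'a::{real_normed_field,euclidean_space} \<Rightarrow> 'a)"
proof -
  have "Ck_on k (exp :: 'a \<Rightarrow> 'a) UNIV" for k
  proof (induction k)
    case 0
    then show ?case by (auto intro: continuous_intros)
  next
    case (Suc k)
    then have "Ck_on k (\<lambda>x::'a. exp x * v) UNIV" for v
      by (intro Ck_on_bilinear[OF bounded_bilinear_mult] Ck_on_const) auto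
    moreover have "(exp has_derivative (\<lambda>v. exp x * v)) (at x)" for x :: 'a
      using DERIV_exp[of x] by (simp add: has_field_derivative_def)
    ultimately show ?case
      by (intro Ck_on_SucI[of UNIV exp "\<lambda>x v. exp x * v"]) auto
  qed
  then show ?thesis by (simp add: Cinf_on_def)
qed

lemma Cinf_on_exp [Cinf_intros]:
  fixes f :: "_ \<Rightarrow> 'a::{real_normed_field,euclidean_space}"
  shows "Cinf_on W f \<Longrightarrow> Cinf_on W (\<lambda>q. exp (f q))"
  by (rule Cinf_on_compose[OF Cinf_on_exp_base]) auto

lemma Cinf_on_sqrt_base: "Cinf_on {0<..} sqrt"
proof -
  have "Ck_on k sqrt {0<..}" for k
  proof (induction k)
    case 0
    then show ?case by (auto intro: continuous_intros)
  next
    case (Suc k)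
    have "Ck_on k (\<lambda>x. inverse (sqrt x)) {0<..}"
      using Cinf_on_inverse_base[where 'a = real] Suc
      by (intro Ck_on_compose[of "{0<..}" "{x. x \<noteq> 0}" sqrt k inverse])
        (auto simp: Cinf_on_def)
    then have "Ck_on k (\<lambda>x. inverse (sqrt x) * (v / 2)) {0<..}" for v :: real
      by (intro Ck_on_bilinear[OF bounded_bilinear_mult] Ck_on_const) auto
    moreover have "(sqrt has_derivative (\<lambda>v. inverse (sqrt x) * (v / 2))) (at x)"
      if "x \<in> {0<..}" for x
    proof -
      have "(sqrt has_real_derivative inverse (sqrt x) / 2) (at x)"
        using that by (intro DERIV_real_sqrt) simp
      then show ?thesis
        unfolding has_field_derivative_def by (rule has_derivative_eq_rhs) auto
    qed
    ultimately show ?case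
      by (intro Ck_on_SucI[of "{0<..}" sqrt "\<lambda>x v. inverse (sqrt x) * (v / 2)"]) auto
  qed
  then show ?thesis by (simp add: Cinf_on_def)
qed

lemma Cinf_on_sqrt [Cinf_intros]:
  "Cinf_on W f \<Longrightarrow> (\<And>q. q \<in> W \<Longrightarrow> f q > 0) \<Longrightarrow> Cinf_on W (\<lambda>q. sqrt (f q))"
  by (rule Cinf_on_compose[OF Cinf_on_sqrt_base]) (auto simp: image_subset_iff)

lemma Cinf_on_norm [Cinf_intros]:
  fixes f :: "_ \<Rightarrow> 'a::real_inner"
  assumes "Cinf_on W f" "\<And>q. q \<in> W \<Longrightarrow> f q \<noteq> 0"
  shows "Cinf_on W (\<lambda>q. norm (f q))"
  unfolding norm_eq_sqrt_inner using assms by (intro Cinf_intros) auto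

lemma Cinf_on_antiderivative:
  fixes f :: "real \<Rightarrow> 'v::real_normed_vector"
  assumes "Cinf_on W f'" "\<And>s. s \<in> W \<Longrightarrow> (f has_vector_derivative f' s) (at s)"
  shows "Cinf_on W f"
  using assms
  by (intro Cinf_on_deriv_intro[of W f "\<lambda>s v. v *\<^sub>R f' s"] Cinf_intros)
    (auto simp: has_vector_derivative_def dest: Cinf_on_openD)

lemma Cinf_on_vector_derivative:
  fixes f :: "real \<Rightarrow> 'v::real_normed_vector"
  assumes "Cinf_on W f" "\<And>s. s \<in> W \<Longrightarrow> (f has_vector_derivative f' s) (at s)"
  shows "Cinf_on W f'"
proof -
  have "frechet_derivative f (at s) 1 = f' s" if "s \<in> W" for s
    using assms(2)[OF that] frechet_derivative_at[of f "\<lambda>v. v *\<^sub>R f' s" s]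
    unfolding has_vector_derivative_def by (metis scaleR_one)
  then show ?thesis
    using Cinf_on_frechet_derivative[OF assms(1), of 1]
      Cinf_on_cong[of W "\<lambda>s. frechet_derivative f (at s) 1" f'] by simp
qed

text \<open>The termwise derivative is again an everywhere convergent power series.\<close>

lemma Cinf_on_powser:
  fixes c :: "nat \<Rightarrow> real"
  assumes "\<And>x. summable (\<lambda>n. c n * x ^ n)"
  shows "Cinf_on UNIV (\<lambda>x. \<Sum>n. c n * x ^ n)"
proof -
  have "Ck_on k (\<lambda>x. \<Sum>n. c n * x ^ n) UNIV" for k
    using assms
  proof (induction k arbitrary: c)
    case 0
    have "isCont (\<lambda>x. \<Sum>n. c n * x ^ n) x" for x
      using termdiffs_strong_converges_everywhere[OF 0] DERIV_isCont by blast
    then show ?case by (simp add: continuous_on_eq_continuous_at)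
  next
    case (Suc k)
    let ?d = "\<lambda>x. \<Sum>n. diffs c n * x ^ n"
    have "Ck_on k ?d UNIV"
      by (intro Suc.IH termdiff_converges_all Suc.prems)
    then have "Ck_on k (\<lambda>x. ?d x * v) UNIV" for v
      by (intro Ck_on_bilinear[OF bounded_bilinear_mult] Ck_on_const) auto
    moreover have "((\<lambda>x. \<Sum>n. c n * x ^ n) has_derivative (\<lambda>v. ?d x * v)) (at x)" for x
      using termdiffs_strong_converges_everywhere[OF Suc.prems]
      by (simp add: has_field_derivative_def)
    ultimately show ?case
      by (intro Ck_on_SucI[of UNIV _ "\<lambda>x v. ?d x * v"]) auto
  qed
  then show ?thesis by (simp add: Cinf_on_def)
qed


lemma frechet_derivative_eqI:
  "(f has_derivative f') (at q) \<Longrightarrow> frechet_derivative f (at q) v = f' v"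
  by (rule fun_cong[OF frechet_derivative_at[symmetric]])

text \<open>The second difference of \<open>u\<close> over a small parallelogram is symmetric in its two sides, and
  by the mean value theorem it is \<open>h\<^sup>2\<close> times a mixed second derivative nearby.\<close>

lemma second_difference_mean_value:
  fixes u :: "'p::euclidean_space \<Rightarrow> real"
  assumes W: "Cinf_on W u" "ball q \<delta> \<subseteq> W" and h: "h > 0" "h * (norm v + norm w) < \<delta>"
  shows "\<exists>p\<in>ball q \<delta>. u (q + h *\<^sub>R v + h *\<^sub>R w) - u (q + h *\<^sub>R v) - (u (q + h *\<^sub>R w) - u q) =
    h\<^sup>2 * frechet_derivative (\<lambda>p. frechet_derivative u (at p) v) (at p) w"
proof -
  let ?Dv = "\<lambda>p. frechet_derivative u (at p) v"
  have in_ball: "q + s *\<^sub>R v + t *\<^sub>R w \<in> ball q \<delta>" if "s \<in> {0..h}" "t \<in> {0..h}" for s t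
  proof -
    have "norm (s *\<^sub>R v + t *\<^sub>R w) \<le> s * norm v + t * norm w"
      using norm_triangle_ineq[of "s *\<^sub>R v" "t *\<^sub>R w"] that by simp
    also have "\<dots> \<le> h * norm v + h * norm w"
      using that by (intro add_mono mult_right_mono) auto
    also have "\<dots> < \<delta>"
      using h by (simp add: algebra_simps)
    finally have "norm (s *\<^sub>R v + t *\<^sub>R w) < \<delta>" .
    moreover have "dist (q + s *\<^sub>R v + t *\<^sub>R w) q = norm (s *\<^sub>R v + t *\<^sub>R w)"
      by (simp add: dist_norm)
    ultimately show ?thesis
      by (simp add: dist_commute)
  qed
  have inW: "q + s *\<^sub>R v + t *\<^sub>R w \<in> W" if "s \<in> {0..h}" "t \<in> {0..h}" for s t
    using in_ball[OF that] W by blast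
  have du: "((\<lambda>s. u (q + s *\<^sub>R v + t *\<^sub>R w)) has_derivative (\<lambda>r. r * ?Dv (q + s *\<^sub>R v + t *\<^sub>R w)))
      (at s within {0..h})" if "s \<in> {0..h}" "t \<in> {0..h}" for s t
  proof -
    note D = Cinf_on_has_derivative[OF W(1) inW[OF that]]
    have "((\<lambda>s. q + s *\<^sub>R v + t *\<^sub>R w) has_derivative (\<lambda>r. r *\<^sub>R v)) (at s within {0..h})"
      by (auto intro!: derivative_eq_intros)
    from has_derivative_compose[OF this D] show ?thesis
      by (simp add: linear_cmul[OF has_derivative_linear[OF D]])
  qed
  have dv: "((\<lambda>t. ?Dv (q + s *\<^sub>R v + t *\<^sub>R w)) has_derivative
      (\<lambda>r. r * frechet_derivative ?Dv (at (q + s *\<^sub>R v + t *\<^sub>R w)) w))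
      (at t within {0..h})" if "s \<in> {0..h}" "t \<in> {0..h}" for s t
  proof -
    note D = Cinf_on_has_derivative[OF Cinf_on_frechet_derivative[OF W(1), of v] inW[OF that]]
    have "((\<lambda>t. q + s *\<^sub>R v + t *\<^sub>R w) has_derivative (\<lambda>r. r *\<^sub>R w)) (at t within {0..h})"
      by (auto intro!: derivative_eq_intros)
    from has_derivative_compose[OF this D] show ?thesis
      by (simp add: linear_cmul[OF has_derivative_linear[OF D]])
  qed
  have "\<exists>s\<in>{0<..<h}. (u (q + h *\<^sub>R v + h *\<^sub>R w) - u (q + h *\<^sub>R v + 0 *\<^sub>R w)) -
      (u (q + 0 *\<^sub>R v + h *\<^sub>R w) - u (q + 0 *\<^sub>R v + 0 *\<^sub>R w)) =
      (h - 0) * ?Dv (q + s *\<^sub>R v + h *\<^sub>R w) - (h - 0) * ?Dv (q + s *\<^sub>R v + 0 *\<^sub>R w)"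
    using h(1) by (intro mvt_simple[where f = "\<lambda>s. u (q + s *\<^sub>R v + h *\<^sub>R w) - u (q + s *\<^sub>R v + 0 *\<^sub>R w)"]
        has_derivative_diff du) auto
  then obtain s where "s \<in> {0<..<h}" and s':
    "u (q + h *\<^sub>R v + h *\<^sub>R w) - u (q + h *\<^sub>R v) - (u (q + h *\<^sub>R w) - u q) =
      h * (?Dv (q + s *\<^sub>R v + h *\<^sub>R w) - ?Dv (q + s *\<^sub>R v + 0 *\<^sub>R w))"
    by (auto simp: algebra_simps)
  then have s: "s \<in> {0..h}" by simp
  have "\<exists>t\<in>{0<..<h}. ?Dv (q + s *\<^sub>R v + h *\<^sub>R w) - ?Dv (q + s *\<^sub>R v + 0 *\<^sub>R w) =
      (h - 0) * frechet_derivative ?Dv (at (q + s *\<^sub>R v + t *\<^sub>R w)) w"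
    using h(1) s by (intro mvt_simple[where f = "\<lambda>t. ?Dv (q + s *\<^sub>R v + t *\<^sub>R w)"] dv) auto
  then obtain t where "t \<in> {0<..<h}" and t':
    "?Dv (q + s *\<^sub>R v + h *\<^sub>R w) - ?Dv (q + s *\<^sub>R v + 0 *\<^sub>R w) =
      h * frechet_derivative ?Dv (at (q + s *\<^sub>R v + t *\<^sub>R w)) w"
    by auto
  then have t: "t \<in> {0..h}" by simp
  show ?thesis
    using in_ball[OF s t] s' t' by (auto simp: power2_eq_square)
qed

lemma second_derivative_symmetric_real:
  fixes u :: "'p::euclidean_space \<Rightarrow> real"
  assumes "Cinf_on W u" "q \<in> W"
  shows "frechet_derivative (\<lambda>p. frechet_derivative u (at p) v) (at q) w =
    frechet_derivative (\<lambda>p. frechet_derivative u (at p) w) (at q) v" (is "?A q = ?B q")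
proof (rule ccontr)
  assume neq: "?A q \<noteq> ?B q"
  define \<eta> where "\<eta> = \<bar>?A q - ?B q\<bar> / 2"
  have \<eta>: "\<eta> > 0" using neq by (simp add: \<eta>_def)
  have W: "open W" using assms(1) by (rule Cinf_on_openD)
  have cont: "continuous_on W ?A" "continuous_on W ?B"
    by (intro Cinf_on_continuous_on Cinf_on_frechet_derivative assms(1))+
  obtain d1 where d1: "d1 > 0" "\<And>p. dist p q < d1 \<Longrightarrow> dist (?A p) (?A q) < \<eta>"
    using cont(1) W assms(2) \<eta> unfolding continuous_on_eq_continuous_at[OF W] continuous_at_eps_delta
    by meson
  obtain d2 where d2: "d2 > 0" "\<And>p. dist p q < d2 \<Longrightarrow> dist (?B p) (?B q) < \<eta>"
    using cont(2) W assms(2) \<eta> unfolding continuous_on_eq_continuous_at[OF W] continuous_at_eps_delta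
    by meson
  obtain d3 where d3: "d3 > 0" "ball q d3 \<subseteq> W"
    using W assms(2) open_contains_ball by blast
  define \<delta> where "\<delta> = min d1 (min d2 d3)"
  have \<delta>: "\<delta> > 0" "ball q \<delta> \<subseteq> W"
    using d1 d2 d3 by (auto simp: \<delta>_def)
  define h where "h = \<delta> / (norm v + norm w + 1)"
  have pos: "norm v + norm w + 1 > 0"
    by (simp add: add_nonneg_pos)
  have h: "h > 0" "h * (norm v + norm w) < \<delta>" "h * (norm w + norm v) < \<delta>"
  proof -
    show "h > 0" using \<delta> pos by (simp add: h_def)
    have "h * (norm v + norm w + 1) = \<delta>"
      using pos by (simp add: h_def)
    then show "h * (norm v + norm w) < \<delta>" "h * (norm w + norm v) < \<delta>"
      using \<open>h > 0\<close> by (simp_all add: algebra_simps)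
  qed
  obtain p where p: "p \<in> ball q \<delta>"
    "u (q + h *\<^sub>R v + h *\<^sub>R w) - u (q + h *\<^sub>R v) - (u (q + h *\<^sub>R w) - u q) = h\<^sup>2 * ?A p"
    using second_difference_mean_value[OF assms(1) \<delta>(2) h(1,2)] by blast
  obtain p' where p': "p' \<in> ball q \<delta>"
    "u (q + h *\<^sub>R w + h *\<^sub>R v) - u (q + h *\<^sub>R w) - (u (q + h *\<^sub>R v) - u q) = h\<^sup>2 * ?B p'"
    using second_difference_mean_value[OF assms(1) \<delta>(2) h(1,3)] by blast
  have "h\<^sup>2 * ?A p = h\<^sup>2 * ?B p'"
    unfolding p(2)[symmetric] p'(2)[symmetric] by (simp add: algebra_simps)
  then have eq: "?A p = ?B p'"
    using h(1) by simp
  have "dist (?A p) (?A q) < \<eta>" "dist (?B p') (?B q) < \<eta>"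
    using p(1) p'(1) d1 d2 by (auto simp: \<delta>_def dist_commute)
  moreover have "dist (?A q) (?B q) \<le> dist (?A p) (?A q) + dist (?B p') (?B q)"
    unfolding eq[symmetric] by (rule dist_triangle3)
  ultimately have "dist (?A q) (?B q) < \<eta> + \<eta>"
    by linarith
  then show False
    by (simp add: \<eta>_def dist_real_def)
qed

lemma frechet_derivative_inner_const:
  fixes f :: "'p::euclidean_space \<Rightarrow> 'v::euclidean_space"
  assumes "f differentiable (at q)"
  shows "frechet_derivative (\<lambda>p. f p \<bullet> b) (at q) v = frechet_derivative f (at q) v \<bullet> b"
proof -
  have "((\<lambda>p. f p \<bullet> b) has_derivative (\<lambda>v. frechet_derivative f (at q) v \<bullet> b)) (at q)"
    using assms by (intro has_derivative_inner_left) (simp add: frechet_derivative_works)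
  then show ?thesis
    by (rule frechet_derivative_eqI)
qed

lemma second_derivative_symmetric:
  fixes f :: "'p::euclidean_space \<Rightarrow> 'v::euclidean_space"
  assumes f: "Cinf_on W f" and q: "q \<in> W"
  shows "frechet_derivative (\<lambda>p. frechet_derivative f (at p) v) (at q) w =
    frechet_derivative (\<lambda>p. frechet_derivative f (at p) w) (at q) v"
proof (rule euclidean_eqI)
  fix b :: 'v assume "b \<in> Basis"
  have W: "open W" using f by (rule Cinf_on_openD)
  have fb: "Cinf_on W (\<lambda>p. f p \<bullet> b)"
    by (intro Cinf_intros f W)
  have *: "frechet_derivative (\<lambda>p. frechet_derivative f (at p) v) (at q) w \<bullet> b =
      frechet_derivative (\<lambda>p. frechet_derivative (\<lambda>p. f p \<bullet> b) (at p) v) (at q) w" for v w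
  proof -
    have d: "(\<lambda>p. frechet_derivative f (at p) v) differentiable (at q)"
      by (intro Cinf_on_differentiable[OF Cinf_on_frechet_derivative[OF f] q])
    have "(\<lambda>p. frechet_derivative f (at p) v \<bullet> b) differentiable (at q)"
      by (intro Cinf_on_differentiable[OF _ q] Cinf_intros Cinf_on_frechet_derivative f W)
    then have "frechet_derivative (\<lambda>p. frechet_derivative f (at p) v \<bullet> b) (at q) =
        frechet_derivative (\<lambda>p. frechet_derivative (\<lambda>p. f p \<bullet> b) (at p) v) (at q)"
      using frechet_derivative_inner_const[OF Cinf_on_differentiable[OF f]] q
      by (intro frechet_derivative_transform_within_open[OF _ W]) auto
    then show ?thesis
      using frechet_derivative_inner_const[OF d] by metis
  qed
  show "frechet_derivative (\<lambda>p. frechet_derivative f (at p) v) (at q) w \<bullet> b =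
      frechet_derivative (\<lambda>p. frechet_derivative f (at p) w) (at q) v \<bullet> b"
    unfolding * by (rule second_derivative_symmetric_real[OF fb q])
qed

text \<open>The term of second order is symmetric in \<open>v\<close> and \<open>\<xi> q\<close>. It therefore cancels when two vector
  fields are interchanged, which leaves their Lie bracket.\<close>

lemma frechet_derivative_along_field:
  fixes f :: "'p::euclidean_space \<Rightarrow> 'v::euclidean_space"
  assumes f: "Cinf_on W f" and \<xi>: "Cinf_on W \<xi>" and q: "q \<in> W"
  shows "frechet_derivative (\<lambda>p. frechet_derivative f (at p) (\<xi> p)) (at q) v =
    frechet_derivative (\<lambda>p. frechet_derivative f (at p) v) (at q) (\<xi> q) +
    frechet_derivative f (at q) (frechet_derivative \<xi> (at q) v)"
proof -
  have W: "open W" using f by (rule Cinf_on_openD)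
  let ?D = "\<lambda>p. frechet_derivative f (at p)"
  let ?\<xi>' = "frechet_derivative \<xi> (at q)"
  have lin: "linear (?D p)" if "p \<in> W" for p
    by (rule has_derivative_linear[OF Cinf_on_has_derivative[OF f that]])
  have expand: "?D p y = (\<Sum>b\<in>Basis. (y \<bullet> b) *\<^sub>R ?D p b)" if "p \<in> W" for p y
  proof -
    interpret linear "?D p" by (rule lin[OF that])
    have "?D p y = ?D p (\<Sum>b\<in>Basis. (y \<bullet> b) *\<^sub>R b)"
      by (simp add: euclidean_representation)
    then show ?thesis by (simp add: sum scale)
  qed
  have d2: "((\<lambda>p. ?D p b) has_derivative frechet_derivative (\<lambda>p. ?D p b) (at q)) (at q)" for b
    by (rule Cinf_on_has_derivative[OF Cinf_on_frechet_derivative[OF f] q])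
  have d\<xi>: "(\<xi> has_derivative ?\<xi>') (at q)"
    by (rule Cinf_on_has_derivative[OF \<xi> q])
  let ?E = "\<lambda>v. \<Sum>b\<in>Basis. (\<xi> q \<bullet> b) *\<^sub>R frechet_derivative (\<lambda>p. ?D p b) (at q) v +
      (?\<xi>' v \<bullet> b) *\<^sub>R ?D q b"
  have "((\<lambda>p. \<Sum>b\<in>Basis. (\<xi> p \<bullet> b) *\<^sub>R ?D p b) has_derivative ?E) (at q)"
    by (intro has_derivative_sum has_derivative_scaleR has_derivative_inner_left d2 d\<xi>)
  then have "((\<lambda>p. ?D p (\<xi> p)) has_derivative ?E) (at q)"
    by (rule has_derivative_transform_within_open[OF _ W q]) (simp add: expand)
  then have "frechet_derivative (\<lambda>p. ?D p (\<xi> p)) (at q) v = ?E v"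
    by (rule frechet_derivative_eqI)
  also have "\<dots> = (\<Sum>b\<in>Basis. (\<xi> q \<bullet> b) *\<^sub>R frechet_derivative (\<lambda>p. ?D p v) (at q) b) +
      (\<Sum>b\<in>Basis. (?\<xi>' v \<bullet> b) *\<^sub>R ?D q b)"
    by (simp add: sum.distrib second_derivative_symmetric[OF f q, of _ v])
  also have "(\<Sum>b\<in>Basis. (\<xi> q \<bullet> b) *\<^sub>R frechet_derivative (\<lambda>p. ?D p v) (at q) b) =
      frechet_derivative (\<lambda>p. ?D p v) (at q) (\<xi> q)"
  proof -
    interpret linear "frechet_derivative (\<lambda>p. ?D p v) (at q)"
      by (rule has_derivative_linear[OF d2])
    have "frechet_derivative (\<lambda>p. ?D p v) (at q) (\<xi> q) =
        frechet_derivative (\<lambda>p. ?D p v) (at q) (\<Sum>b\<in>Basis. (\<xi> q \<bullet> b) *\<^sub>R b)"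
      by (simp add: euclidean_representation)
    then show ?thesis by (simp add: sum scale)
  qed
  finally show ?thesis
    using expand[OF q, of "?\<xi>' v"] by simp
qed


section \<open>Tangent spaces and differentials on subsets\<close>

lemma smooth_onE:
  assumes "smooth_on D f" "p \<in> D"
  obtains W g where "Cinf_on W g" "p \<in> W" "\<And>q. q \<in> W \<inter> D \<Longrightarrow> g q = f q"
  using assms unfolding smooth_on_def Cinf_on_def by meson

lemma smooth_onI:
  assumes "\<And>p. p \<in> D \<Longrightarrow> \<exists>W g. Cinf_on W g \<and> p \<in> W \<and> (\<forall>q\<in>W \<inter> D. g q = f q)"
  shows "smooth_on D f"
  using assms unfolding smooth_on_def Cinf_on_def by meson

lemma smooth_on_Cinf:
  assumes "Cinf_on W g" "D \<subseteq> W" "\<And>q. q \<in> D \<Longrightarrow> g q = f q"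
  shows "smooth_on D f"
  by (rule smooth_onI) (use assms in blast)

lemma subspace_tangent_space: "subspace (tangent_space D q)"
  unfolding tangent_space_def by (rule subspace_span)

text \<open>A curve need only stay in \<open>D\<close> for a short time: running through it ever more slowly, as
  \<open>d t / (1 + t)\<close>, keeps it in \<open>D\<close> for all times.\<close>

lemma velocity_in_tangent_space:
  assumes c: "(c has_vector_derivative v) (at 0 within {0..})" "c 0 = q"
    and d: "d > 0" "\<And>t. 0 \<le> t \<Longrightarrow> t \<le> d \<Longrightarrow> c t \<in> D"
  shows "v \<in> tangent_space D q"
proof -
  define \<tau> :: "real \<Rightarrow> real" where "\<tau> t = d * t / (1 + t)" for t
  have \<tau>: "\<tau> t \<in> {0..d}" if "t \<ge> 0" for t
  proof -
    have "t / (1 + t) \<le> 1" "0 \<le> t / (1 + t)"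
      using that by (auto simp: field_simps)
    then show ?thesis
      unfolding \<tau>_def using d(1) that mult_left_mono[of "t / (1 + t)" 1 d] by auto
  qed
  have d\<tau>: "(\<tau> has_vector_derivative d) (at 0 within {0..})"
    unfolding \<tau>_def has_real_derivative_iff_has_vector_derivative[symmetric]
    by (auto intro!: derivative_eq_intros)
  have "\<tau> ` {0..} \<subseteq> {0..}"
    using \<tau> by auto
  then have "(c has_vector_derivative v) (at (\<tau> 0) within \<tau> ` {0..})"
    using has_vector_derivative_within_subset[OF c(1)] by (simp add: \<tau>_def)
  from vector_diff_chain_within[OF d\<tau> this]
  have "((c \<circ> \<tau>) has_vector_derivative d *\<^sub>R v) (at 0 within {0..})" .
  moreover have "(c \<circ> \<tau>) 0 = q" "\<forall>t\<ge>0. (c \<circ> \<tau>) t \<in> D"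
    using c(2) d(2) \<tau> by (auto simp: \<tau>_def)
  ultimately have "d *\<^sub>R v \<in> tangent_space D q"
    unfolding tangent_space_def by (intro span_base) blast
  from subspace_scale[OF subspace_tangent_space this, of "1 / d"] show ?thesis
    using d by simp
qed

text \<open>A curve in \<open>D\<close> with velocity \<open>v\<close> turns both \<open>A v\<close> and \<open>B v\<close> into the derivative of the same function of
  one variable; linearity then covers the span of the velocities.\<close>

lemma has_derivative_unique_tangent:
  assumes A: "(g has_derivative A) (at q within D)" and B: "(g has_derivative B) (at q within D)"
    and v: "v \<in> tangent_space D q"
  shows "A v = B v"
proof -
  interpret A: linear A using A by (rule has_derivative_linear)
  interpret B: linear B using B by (rule has_derivative_linear)
  have "subspace {v. A v = B v}"
    by (auto simp: subspace_def A.add B.add A.zero B.zero A.scale B.scale)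
  moreover have "A v = B v"
    if "\<gamma> 0 = q" "\<forall>t\<ge>0. \<gamma> t \<in> D" "(\<gamma> has_vector_derivative v) (at 0 within {0..})"
    for \<gamma> :: "real \<Rightarrow> _" and v
  proof -
    have sub: "\<gamma> ` {0..} \<subseteq> D" using that by auto
    have *: "((\<lambda>t. g (\<gamma> t)) has_vector_derivative L v) (at 0 within {0..})"
      if L: "(g has_derivative L) (at q within D)" for L
    proof -
      have "((\<lambda>t. g (\<gamma> t)) has_derivative (\<lambda>t. L (t *\<^sub>R v))) (at 0 within {0..})"
        using that \<open>\<gamma> 0 = q\<close> \<open>(\<gamma> has_vector_derivative v) _\<close>[unfolded has_vector_derivative_def]
        by (intro has_derivative_in_compose[of \<gamma> "\<lambda>t. t *\<^sub>R v" 0 "{0..}" g L])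
          (auto intro: has_derivative_subset[OF _ sub])
      then show ?thesis
        using linear_cmul[OF has_derivative_linear[OF L]] by (simp add: has_vector_derivative_def)
    qed
    have "at (0::real) within {0..} \<noteq> bot"
      by (simp add: at_within_Ici_at_right)
    from vector_derivative_unique_within[OF this *[OF A] *[OF B]] show ?thesis .
  qed
  ultimately show ?thesis
    using span_induct[OF v[unfolded tangent_space_def], of "\<lambda>v. A v = B v"] by blast
qed

text \<open>The derivative within \<open>D\<close> is only some linear map among several, but on tangent vectors it can be
  computed from any smooth extension. Boundary points need no separate treatment after this.\<close>

lemma differential_of_extension:
  assumes h: "h differentiable (at q)" and W: "open W" "q \<in> W" and q: "q \<in> D"
    and eq: "\<And>p. p \<in> W \<inter> D \<Longrightarrow> h p = g p" and v: "v \<in> tangent_space D q"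
  shows "differential D g q v = frechet_derivative h (at q) v"
proof -
  obtain e where e: "e > 0" "ball q e \<subseteq> W"
    using W open_contains_ball by blast
  have "(h has_derivative frechet_derivative h (at q)) (at q within D)"
    using h by (simp add: frechet_derivative_works has_derivative_at_withinI)
  then have B: "(g has_derivative frechet_derivative h (at q)) (at q within D)"
  proof (rule has_derivative_transform_within[OF _ e(1) q])
    show "h x = g x" if "x \<in> D" "dist x q < e" for x
      using that e(2) by (intro eq) (auto simp: subset_eq dist_commute)
  qed
  then have "(g has_derivative differential D g q) (at q within D)"
    using differentiableI frechet_derivative_works by blast
  from has_derivative_unique_tangent[OF this B v] show ?thesis .
qed


section \<open>Orthonormal bases and normal projections\<close>

lemma normal_part_eqI:
  assumes "subspace T" "\<And>u. u \<in> T \<Longrightarrow> w \<bullet> u = 0" "v - w \<in> T"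
  shows "normal_part T v = w"
  unfolding normal_part_def
proof (rule the_equality)
  fix w' assume w': "(\<forall>u\<in>T. w' \<bullet> u = 0) \<and> v - w' \<in> T"
  have "(v - w) - (v - w') \<in> T"
    by (rule subspace_diff[OF assms(1,3) w'[THEN conjunct2]])
  then have "w' - w \<in> T" by (simp add: algebra_simps)
  then have "(w' - w) \<bullet> (w' - w) = 0"
    using assms w' by (subst inner_diff_left) simp
  then show "w' = w" by simp
qed (use assms in blast)

lemma orthonormal_basis_of_dim:
  assumes "orthonormal_basis_of T m b"
  shows "dim T = m"
proof -
  have inj: "inj_on b {..<m}"
    using assms unfolding orthonormal_basis_of_def inj_on_def
    by (metis lessThan_iff zero_neq_one)
  have "pairwise orthogonal (b ` {..<m})"
    using assms by (auto simp: orthonormal_basis_of_def pairwise_def orthogonal_def)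
  moreover have "0 \<notin> b ` {..<m}"
    using assms by (force simp: orthonormal_basis_of_def)
  ultimately have "independent (b ` {..<m})"
    by (rule pairwise_orthogonal_independent)
  then have "dim (b ` {..<m}) = m"
    by (simp add: dim_eq_card_independent card_image[OF inj])
  then show ?thesis
    using assms dim_span unfolding orthonormal_basis_of_def by metis
qed

text \<open>By the count of dimensions an orthonormal family of the right size spans.\<close>

lemma orthonormal_basis_ofI:
  assumes "subspace T" "dim T = m"
    and b: "\<And>i. i < m \<Longrightarrow> b i \<in> T"
    and ortho: "\<And>i j. i < m \<Longrightarrow> j < m \<Longrightarrow> b i \<bullet> b j = (if i = j then 1 else 0)"
  shows "orthonormal_basis_of T m b"
proof -
  have "orthonormal_basis_of (span (b ` {..<m})) m b"
    using ortho by (simp add: orthonormal_basis_of_def)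
  then have "dim (span (b ` {..<m})) = dim T"
    using assms(2) orthonormal_basis_of_dim by blast
  moreover have "span (b ` {..<m}) \<subseteq> T"
    using b assms(1) by (intro span_minimal) auto
  ultimately have "span (b ` {..<m}) = T"
    using assms(1) by (intro subspace_dim_equal subspace_span) simp_all
  with ortho show ?thesis
    by (simp add: orthonormal_basis_of_def)
qed

lemma obtain_orthonormal_basis:
  fixes T :: "'v::euclidean_space set"
  assumes "subspace T"
  obtains b where "orthonormal_basis_of T (dim T) b"
proof -
  obtain B where B: "B \<subseteq> T" "pairwise orthogonal B" "\<And>x. x \<in> B \<Longrightarrow> norm x = 1"
    "independent B" "card B = dim T" "span B = T"
    using orthonormal_basis_subspace[OF assms] by blast
  obtain b where b: "bij_betw b {..<dim T} B"
    using B independent_imp_finite[OF B(4)] ex_bij_betw_nat_finite[of B] atLeast0LessThan by metis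
  have "b i \<bullet> b j = (if i = j then 1 else 0)" if "i < dim T" "j < dim T" for i j
  proof -
    have m: "b i \<in> B" "b j \<in> B"
      using b that by (auto simp: bij_betw_def)
    show ?thesis
    proof (cases "i = j")
      case True
      then show ?thesis using B(3)[OF m(1)] by (simp add: norm_eq_1)
    next
      case False
      then have "b i \<noteq> b j"
        using b that by (auto simp: bij_betw_def inj_on_def)
      then show ?thesis
        using B(2) m False by (auto simp: pairwise_def orthogonal_def)
    qed
  qed
  moreover have "span (b ` {..<dim T}) = T"
    using b B(6) by (simp add: bij_betw_def)
  ultimately show ?thesis
    using that[of b] unfolding orthonormal_basis_of_def by blast
qed


section \<open>Spheres spun along a plane curve\<close>

definition cscale :: "complex \<Rightarrow> real ^ 'n \<Rightarrow> complex ^ 'n" where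
  "cscale c x = (\<chi> j. c * complex_of_real (x $ j))"

text \<open>Up to conjugating \<open>c\<close> this is the adjoint of \<open>cscale c\<close>; with \<open>inverse c\<close> it is a left
  inverse.\<close>

definition reproj :: "complex \<Rightarrow> complex ^ 'n \<Rightarrow> real ^ 'n" where
  "reproj c V = (\<chi> j. Re (c * V $ j))"

lemma bounded_bilinear_cscale: "bounded_bilinear (cscale :: complex \<Rightarrow> real ^ 'n \<Rightarrow> complex ^ 'n)"
  unfolding bilinear_conv_bounded_bilinear[symmetric] bilinear_def
  by (auto intro!: linearI simp: cscale_def vec_eq_iff algebra_simps
      scaleR_conv_of_real[where 'a = complex])

lemma bounded_bilinear_reproj: "bounded_bilinear (reproj :: complex \<Rightarrow> complex ^ 'n \<Rightarrow> real ^ 'n)"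
  unfolding bilinear_conv_bounded_bilinear[symmetric] bilinear_def
  by (auto intro!: linearI simp: reproj_def vec_eq_iff algebra_simps)

lemmas Cinf_on_cscale [Cinf_intros] = Cinf_on_bilinear[OF bounded_bilinear_cscale]
  and Cinf_on_reproj [Cinf_intros] = Cinf_on_bilinear[OF bounded_bilinear_reproj]

interpretation cscale: bounded_bilinear "cscale :: complex \<Rightarrow> real ^ 'n \<Rightarrow> complex ^ 'n"
  by (rule bounded_bilinear_cscale)

interpretation reproj: bounded_bilinear "reproj :: complex \<Rightarrow> complex ^ 'n \<Rightarrow> real ^ 'n"
  by (rule bounded_bilinear_reproj)

lemma reproj_cscale: "reproj c (cscale d w) = Re (c * d) *\<^sub>R w"
  by (simp add: reproj_def cscale_def vec_eq_iff algebra_simps)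

lemma inner_cscale_right: "V \<bullet> cscale c w = w \<bullet> reproj (cnj c) V"
  by (simp add: inner_vec_def reproj_def cscale_def inner_complex_def algebra_simps)

lemma inner_cscale_cscale: "cscale c w \<bullet> cscale d w' = Re (cnj c * d) * (w \<bullet> w')"
  by (simp add: inner_cscale_right reproj_cscale algebra_simps inner_commute)

text \<open>Since \<open>cnj c\<close> and \<open>inverse c\<close> differ by a positive factor, the adjoint and the left inverse of
  \<open>cscale c\<close> are proportional. Hence \<open>dF_inv\<close> below, written with inverses, yields orthogonal projections.\<close>

lemma reproj_cnj:
  assumes "c \<noteq> 0"
  shows "reproj (cnj c) V = (cmod c)\<^sup>2 *\<^sub>R reproj (inverse c) V"
proof -
  have "cnj c = (cmod c)\<^sup>2 *\<^sub>R inverse c"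
    using assms complex_norm_square[of c] by (simp add: scaleR_conv_of_real field_simps)
  then show ?thesis
    by (metis reproj.scaleR_left)
qed

lemma symplectic_form_cscale:
  "symplectic_form (cscale c w) (cscale d w') = Im (cnj c * d) * (w \<bullet> w')"
  by (simp add: symplectic_form_def cscale_def inner_vec_def sum_distrib_left algebra_simps
      sum_subtractf)

text \<open>A great circle, parametrized by central projection of the tangent line. In contrast to arc length
  this is a formula without a case distinction for \<open>w = 0\<close>.\<close>

definition great_circle :: "'a::real_inner \<Rightarrow> 'a \<Rightarrow> real \<Rightarrow> 'a" where
  "great_circle x w t = (1 / sqrt (1 + t\<^sup>2 * (w \<bullet> w))) *\<^sub>R (x + t *\<^sub>R w)"

lemma great_circle:
  assumes "norm x = 1"
  shows "x \<bullet> w = 0 \<Longrightarrow> norm (great_circle x w t) = 1" and "great_circle x w 0 = x"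
    and "(great_circle x w has_vector_derivative w) (at 0)"
proof -
  show "norm (great_circle x w t) = 1" if "x \<bullet> w = 0"
  proof -
    have "1 + t\<^sup>2 * (w \<bullet> w) > 0"
      by (simp add: add_pos_nonneg)
    moreover have "norm (x + t *\<^sub>R w) = sqrt (1 + t\<^sup>2 * (w \<bullet> w))"
      using that assms by (simp add: norm_eq_sqrt_inner inner_add_left inner_add_right
          inner_commute power2_eq_square algebra_simps)
    ultimately show ?thesis
      by (simp add: great_circle_def)
  qed
  show "great_circle x w 0 = x"
    by (simp add: great_circle_def)
  have "((\<lambda>t. 1 / sqrt (1 + t\<^sup>2 * (w \<bullet> w))) has_real_derivative 0) (at 0)"
    by (auto intro!: derivative_eq_intros)
  then have d1: "((\<lambda>t. 1 / sqrt (1 + t\<^sup>2 * (w \<bullet> w))) has_vector_derivative 0) (at 0)"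
    by (simp add: has_real_derivative_iff_has_vector_derivative)
  have d2: "((\<lambda>t. x + t *\<^sub>R w) has_vector_derivative w) (at 0)"
    by (auto intro!: derivative_eq_intros simp: has_vector_derivative_def)
  from bounded_bilinear.has_vector_derivative[OF bounded_bilinear_scaleR d1 d2]
  show "(great_circle x w has_vector_derivative w) (at 0)"
    by (simp add: great_circle_def[abs_def])
qed

lemma sphere_velocity_orthogonal:
  fixes \<gamma> :: "real \<Rightarrow> 'a::real_inner"
  assumes \<gamma>: "\<And>t. t \<ge> 0 \<Longrightarrow> norm (\<gamma> t) = 1" "(\<gamma> has_vector_derivative v) (at 0 within {0..})"
  shows "\<gamma> 0 \<bullet> v = 0"
proof -
  from bounded_bilinear.has_vector_derivative[OF bounded_bilinear_inner \<gamma>(2) \<gamma>(2)]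
  have "((\<lambda>t. \<gamma> t \<bullet> \<gamma> t) has_vector_derivative 2 * (\<gamma> 0 \<bullet> v)) (at 0 within {0..})"
    by (simp add: inner_commute)
  then have "((\<lambda>t. 1) has_vector_derivative 2 * (\<gamma> 0 \<bullet> v)) (at (0::real) within {0..})"
    by (rule has_vector_derivative_transform[rotated 2]) (use \<gamma>(1) in \<open>auto simp: norm_eq_1\<close>)
  then have "2 * (\<gamma> 0 \<bullet> v) = 0"
    by (intro vector_derivative_unique_within[OF _ _ has_vector_derivative_const])
      (simp_all add: at_within_Ici_at_right)
  then show ?thesis by simp
qed

text \<open>The immersion \<open>(x, s) \<mapsto> z s x\<close> of \<open>S\<^sup>n\<^sup>-\<^sup>1 \<times> (J \<inter> [0, \<infinity>))\<close>. The same formula extends it to the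
  open set \<open>\<real>\<^sup>n \<times> J\<close>, so that all differentials can be computed there.\<close>

locale spun_curve =
  fixes J :: "real set" and z z' :: "real \<Rightarrow> complex"
    and F :: "(real ^ 'n) \<times> real \<Rightarrow> complex ^ 'n"
  assumes z_smooth: "Cinf_on J z"
    and z_deriv: "\<And>s. s \<in> J \<Longrightarrow> (z has_vector_derivative z' s) (at s)"
    and z_nz: "\<And>s. s \<in> J \<Longrightarrow> z s \<noteq> 0"
    and z'_nz: "\<And>s. s \<in> J \<Longrightarrow> z' s \<noteq> 0"
    and F_eq: "\<And>x s. norm x = 1 \<Longrightarrow> s \<in> J \<Longrightarrow> 0 \<le> s \<Longrightarrow> F (x, s) = cscale (z s) x"
begin

definition dom_ext :: "((real ^ 'n) \<times> real) set" where
  "dom_ext = UNIV \<times> J"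

definition F_ext :: "(real ^ 'n) \<times> real \<Rightarrow> complex ^ 'n" where
  "F_ext q = cscale (z (snd q)) (fst q)"

definition dF :: "(real ^ 'n) \<times> real \<Rightarrow> (real ^ 'n) \<times> real \<Rightarrow> complex ^ 'n" where
  "dF q v = cscale (z (snd q)) (fst v) + snd v *\<^sub>R cscale (z' (snd q)) (fst q)"

definition tang :: "(real ^ 'n) \<times> real \<Rightarrow> ((real ^ 'n) \<times> real) set" where
  "tang q = {v. fst q \<bullet> fst v = 0}"

text \<open>The Moore-Penrose inverse of the differential on the tangent space. It is rational in \<open>x\<close>,
  \<open>z\<close> and \<open>z'\<close>, so it depends smoothly on \<open>q\<close>.\<close>

definition dF_inv :: "(real ^ 'n) \<times> real \<Rightarrow> complex ^ 'n \<Rightarrow> (real ^ 'n) \<times> real" where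
  "dF_inv q V =
    (reproj (inverse (z (snd q))) V - (fst q \<bullet> reproj (inverse (z (snd q))) V) *\<^sub>R fst q,
     fst q \<bullet> reproj (inverse (z' (snd q))) V)"

definition proj :: "(real ^ 'n) \<times> real \<Rightarrow> complex ^ 'n \<Rightarrow> complex ^ 'n" where
  "proj q V = dF q (dF_inv q V)"

text \<open>Orthonormal frames on the sphere exist only locally, and \<open>z'\<close> may vanish outside of \<open>J\<close>; hence the
  need to work on pieces of \<open>L\<close>.\<close>

definition patch :: "((real ^ 'n) \<times> real) set \<Rightarrow> bool" where
  "patch D \<longleftrightarrow> openin (top_of_set L_dom) D \<and> D \<subseteq> dom_ext"

lemma J_open: "open J"
  using z_smooth by (rule Cinf_on_openD)

lemma open_dom_ext: "open dom_ext"
  unfolding dom_ext_def by (intro open_Times J_open open_UNIV)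

lemma z'_smooth: "Cinf_on J z'"
  by (rule Cinf_on_vector_derivative[OF z_smooth z_deriv])

lemma patchD:
  assumes "patch D" "q \<in> D"
  shows "q \<in> dom_ext" "q \<in> L_dom" "norm (fst q) = 1" "fst q \<bullet> fst q = 1" "snd q \<in> J" "snd q \<ge> 0"
  using assms openin_imp_subset unfolding patch_def L_dom_def dom_ext_def
  by (force simp: norm_eq_1)+

lemma Cinf_on_z:
  assumes "open W" "W \<subseteq> dom_ext"
  shows "Cinf_on W (\<lambda>q. z (snd q))" "Cinf_on W (\<lambda>q. z' (snd q))"
  using assms by (auto intro!: Cinf_on_compose[OF z_smooth] Cinf_on_compose[OF z'_smooth]
      Cinf_on_snd Cinf_on_id simp: dom_ext_def)

lemma F_ext_has_derivative:
  assumes "q \<in> dom_ext"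
  shows "(F_ext has_derivative dF q) (at q)"
proof -
  have "(z has_derivative (\<lambda>r. r *\<^sub>R z' (snd q))) (at (snd q))"
    using z_deriv[of "snd q"] assms by (auto simp: dom_ext_def has_vector_derivative_def)
  from has_derivative_compose[OF has_derivative_snd[OF has_derivative_ident] this]
  have "((\<lambda>q. z (snd q)) has_derivative (\<lambda>v. snd v *\<^sub>R z' (snd q))) (at q)" .
  from cscale.FDERIV[OF this has_derivative_fst[OF has_derivative_ident]]
  show ?thesis
    unfolding F_ext_def dF_def by (simp add: cscale.scaleR_left)
qed

lemma F_ext_smooth: "Cinf_on dom_ext F_ext"
  unfolding F_ext_def by (intro Cinf_intros Cinf_on_z open_dom_ext subset_refl)

lemma F_ext_eq: "patch D \<Longrightarrow> q \<in> D \<Longrightarrow> F_ext q = F q"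
  using patchD[of D q] F_eq[of "fst q" "snd q"] by (simp add: F_ext_def)

lemma frechet_derivative_F_ext: "q \<in> dom_ext \<Longrightarrow> frechet_derivative F_ext (at q) v = dF q v"
  by (rule frechet_derivative_eqI[OF F_ext_has_derivative])

lemma linear_dF: "linear (dF q)"
  by (rule linearI)
    (simp_all add: dF_def cscale.add_right cscale.scaleR_right scaleR_add_left scaleR_add_right)

lemma linear_dF_inv: "linear (dF_inv q)"
  by (rule linearI)
    (simp_all add: dF_inv_def reproj.add_right reproj.scaleR_right inner_add_right algebra_simps)

lemma linear_proj: "linear (proj q)"
  using linear_compose[OF linear_dF_inv linear_dF, of q q] by (simp add: proj_def[abs_def] o_def)

lemma Cinf_on_dF_inv:
  assumes "Cinf_on W V" "W \<subseteq> dom_ext"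
  shows "Cinf_on W (\<lambda>q. dF_inv q (V q))"
proof -
  have W: "open W" using assms(1) by (rule Cinf_on_openD)
  have "z (snd q) \<noteq> 0" "z' (snd q) \<noteq> 0" if "q \<in> W" for q
    using assms(2) that z_nz z'_nz by (auto simp: dom_ext_def)
  then show ?thesis
    unfolding dF_inv_def by (intro Cinf_intros Cinf_on_z assms W) auto
qed

lemma Cinf_on_dF:
  assumes "Cinf_on W v" "W \<subseteq> dom_ext"
  shows "Cinf_on W (\<lambda>q. dF q (v q))"
proof -
  have W: "open W" using assms(1) by (rule Cinf_on_openD)
  show ?thesis
    unfolding dF_def by (intro Cinf_intros Cinf_on_z assms W)
qed

lemma Cinf_on_proj: "Cinf_on W V \<Longrightarrow> W \<subseteq> dom_ext \<Longrightarrow> Cinf_on W (\<lambda>q. proj q (V q))"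
  unfolding proj_def by (intro Cinf_on_dF Cinf_on_dF_inv)

lemma subspace_tang: "subspace (tang q)"
  by (auto simp: subspace_def tang_def inner_add_right)

lemma dF_inv_in_tang: "norm (fst q) = 1 \<Longrightarrow> dF_inv q V \<in> tang q"
  by (simp add: tang_def dF_inv_def inner_diff_right norm_eq_1)

lemma dF_inv_dF:
  assumes "q \<in> dom_ext" "norm (fst q) = 1" "v \<in> tang q"
  shows "dF_inv q (dF q v) = v"
proof -
  have nz: "z (snd q) \<noteq> 0" "z' (snd q) \<noteq> 0" and x: "fst q \<bullet> fst q = 1" "fst q \<bullet> fst v = 0"
    using assms z_nz z'_nz by (auto simp: dom_ext_def norm_eq_1 tang_def)
  have "reproj (inverse (z (snd q))) (dF q v) =
      fst v + (snd v * Re (inverse (z (snd q)) * z' (snd q))) *\<^sub>R fst q"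
    using nz by (simp only: dF_def reproj.add_right reproj.scaleR_right reproj_cscale
        left_inverse one_complex.sel scaleR_one scaleR_scaleR) simp
  then obtain c where c: "reproj (inverse (z (snd q))) (dF q v) = fst v + c *\<^sub>R fst q"
    by blast
  have "reproj (inverse (z' (snd q))) (dF q v) =
      Re (inverse (z' (snd q)) * z (snd q)) *\<^sub>R fst v + snd v *\<^sub>R fst q"
    using nz by (simp only: dF_def reproj.add_right reproj.scaleR_right reproj_cscale
        left_inverse one_complex.sel scaleR_one scaleR_scaleR) simp
  then obtain d where d: "reproj (inverse (z' (snd q))) (dF q v) = d *\<^sub>R fst v + snd v *\<^sub>R fst q"
    by blast
  show ?thesis
    unfolding dF_inv_def c d by (simp add: x inner_add_right prod_eq_iff)
qed

lemma proj_dF: "q \<in> dom_ext \<Longrightarrow> norm (fst q) = 1 \<Longrightarrow> v \<in> tang q \<Longrightarrow> proj q (dF q v) = dF q v"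
  by (simp add: proj_def dF_inv_dF)

lemma dF_inv_proj:
  "q \<in> dom_ext \<Longrightarrow> norm (fst q) = 1 \<Longrightarrow> dF_inv q (proj q V) = dF_inv q V"
  by (simp add: proj_def dF_inv_dF dF_inv_in_tang)

lemma inner_dF:
  assumes q: "q \<in> dom_ext" and v: "v \<in> tang q"
  shows "V \<bullet> dF q v = (cmod (z (snd q)))\<^sup>2 * (fst (dF_inv q V) \<bullet> fst v) +
    (cmod (z' (snd q)))\<^sup>2 * (snd (dF_inv q V) * snd v)"
proof -
  have nz: "z (snd q) \<noteq> 0" "z' (snd q) \<noteq> 0"
    using q z_nz z'_nz by (auto simp: dom_ext_def)
  have "fst q \<bullet> fst v = 0"
    using v by (simp add: tang_def)
  then show ?thesis
    by (simp add: dF_def dF_inv_def inner_add_right inner_diff_left inner_cscale_right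
        reproj_cnj[OF nz(1)] reproj_cnj[OF nz(2)] inner_commute[of "fst v"])
qed

text \<open>The two kinds of tangent vectors \<open>z w\<close> (for \<open>w\<close> tangent to the sphere) and \<open>z' x\<close> are
  orthogonal whatever the angle between \<open>z\<close> and \<open>z'\<close>; this is why \<open>proj\<close> is simply the sum of the
  two projections.\<close>

lemma proj_orthogonal:
  assumes q: "q \<in> dom_ext" "norm (fst q) = 1" and v: "v \<in> tang q"
  shows "(V - proj q V) \<bullet> dF q v = 0"
  unfolding inner_dF[OF q(1) v] linear_diff[OF linear_dF_inv] dF_inv_proj[OF q] by simp

text \<open>At the boundary \<open>s = 0\<close> curves in \<open>D\<close> have velocities with nonnegative second component. The other
  tangent vectors are negatives of such velocities.\<close>

lemma tangent_space_patch:
  assumes D: "patch D" and q: "q \<in> D"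
  shows "tangent_space D q = tang q"
proof
  obtain W where W: "open W" "D = L_dom \<inter> W"
    using D unfolding patch_def openin_open by blast
  note qD = patchD[OF D q]
  show "tangent_space D q \<subseteq> tang q"
    unfolding tangent_space_def
  proof (rule span_minimal[OF _ subspace_tang], safe)
    fix v \<gamma> assume \<gamma>: "q = \<gamma> 0" "\<forall>t\<ge>0. \<gamma> t \<in> D" "(\<gamma> has_vector_derivative v) (at 0 within {0::real..})"
    have "((\<lambda>t. fst (\<gamma> t)) has_vector_derivative fst v) (at 0 within {0..})"
      by (rule bounded_linear.has_vector_derivative[OF bounded_linear_fst \<gamma>(3)])
    then have "fst (\<gamma> 0) \<bullet> fst v = 0"
      by (rule sphere_velocity_orthogonal[rotated]) (use \<gamma> patchD(3)[OF D] in auto)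
    then show "v \<in> tang (\<gamma> 0)"
      by (simp add: tang_def \<gamma>(1))
  qed
  have forward: "v \<in> tangent_space D q" if v: "v \<in> tang q" "snd v \<ge> 0" for v
  proof -
    define c where "c t = (great_circle (fst q) (fst v) t, snd q + t * snd v)" for t
    note circle = great_circle[OF qD(3), of "fst v"]
    have "((\<lambda>t. snd q + t * snd v) has_vector_derivative snd v) (at 0)"
      by (auto intro!: derivative_eq_intros simp: has_vector_derivative_def)
    from has_vector_derivative_Pair[OF circle(3) this]
    have dc: "(c has_vector_derivative v) (at 0)"
      by (simp add: c_def[abs_def])
    have c0: "c 0 = q"
      using circle(2) by (simp add: c_def)
    have "isCont c 0"
      using dc by (rule has_vector_derivative_continuous)
    then obtain d where d: "d > 0" "\<And>t. dist t 0 < d \<Longrightarrow> c t \<in> W"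
      using W q c0 unfolding continuous_at_open eventually_nhds_metric
      by (metis Int_iff continuous_at_open dist_commute dist_norm mem_ball open_contains_ball subsetD)
    have "c t \<in> L_dom" if "t \<ge> 0" for t
      using circle(1) v qD(6) that by (simp add: c_def L_dom_def tang_def)
    then have "c t \<in> D" if "0 \<le> t" "t \<le> d / 2" for t
      using that d W(2) by (simp add: dist_real_def)
    then show ?thesis
      using d(1) c0 has_vector_derivative_at_within[OF dc]
      by (intro velocity_in_tangent_space[where c = c and d = "d / 2"]) auto
  qed
  show "tang q \<subseteq> tangent_space D q"
  proof
    fix v assume v: "v \<in> tang q"
    show "v \<in> tangent_space D q"
    proof (cases "snd v \<ge> 0")
      case True
      then show ?thesis using forward v by blast
    next
      case False
      then have "- v \<in> tangent_space D q"
        using v subspace_neg[OF subspace_tang] by (intro forward) auto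
      then show ?thesis
        using subspace_neg[OF subspace_tangent_space] by fastforce
    qed
  qed
qed

lemma differential_F:
  assumes "patch D" "q \<in> D" "v \<in> tang q"
  shows "differential D F q v = dF q v"
proof -
  have "differential D F q v = frechet_derivative F_ext (at q) v"
    using assms patchD[OF assms(1,2)] F_ext_eq[OF assms(1)] tangent_space_patch[OF assms(1,2)]
    by (intro differential_of_extension[OF Cinf_on_differentiable[OF F_ext_smooth] open_dom_ext]) auto
  then show ?thesis
    using frechet_derivative_F_ext patchD(1)[OF assms(1,2)] by simp
qed

lemma image_tangent_patch:
  assumes "patch D" "q \<in> D"
  shows "image_tangent D F q = dF q ` tang q"
  unfolding image_tangent_def tangent_space_patch[OF assms]
  using differential_F[OF assms] by (rule image_cong[OF refl])

lemma immersion_patch: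
  assumes D: "patch D"
  shows "immersion D F"
  unfolding immersion_def
proof (intro conjI ballI)
  show "smooth_on D F"
    using D F_ext_eq[OF D] by (intro smooth_on_Cinf[OF F_ext_smooth]) (auto simp: patch_def)
  fix q assume q: "q \<in> D"
  show "inj_on (differential D F q) (tangent_space D q)"
    unfolding tangent_space_patch[OF D q]
    using differential_F[OF D q] dF_inv_dF[OF patchD(1,3)[OF D q]]
    by (intro inj_on_inverseI[where g = "dF_inv q"]) simp
qed

lemma inv_differential:
  assumes "patch D" "q \<in> D" "V \<in> image_tangent D F q"
  shows "inv_into (tangent_space D q) (differential D F q) V = dF_inv q V"
proof -
  obtain v where v: "v \<in> tang q" "V = dF q v"
    using assms image_tangent_patch by auto
  have "inv_into (tangent_space D q) (differential D F q) (differential D F q v) = v"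
    using immersion_patch[OF assms(1)] assms(2) v(1) tangent_space_patch[OF assms(1,2)]
    by (intro inv_into_f_f) (auto simp: immersion_def)
  then show ?thesis
    using v differential_F[OF assms(1,2)] dF_inv_dF[OF patchD(1,3)[OF assms(1,2)]] by simp
qed

lemma subspace_image_tangent: "patch D \<Longrightarrow> q \<in> D \<Longrightarrow> subspace (image_tangent D F q)"
  by (simp add: image_tangent_patch linear_subspace_image linear_dF subspace_tang)

lemma proj_in_image_tangent: "patch D \<Longrightarrow> q \<in> D \<Longrightarrow> proj q V \<in> image_tangent D F q"
  using patchD(3) by (simp add: image_tangent_patch proj_def dF_inv_in_tang)

lemma proj_image_tangent:
  "patch D \<Longrightarrow> q \<in> D \<Longrightarrow> V \<in> image_tangent D F q \<Longrightarrow> proj q V = V"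
  using patchD(1,3)[of D q] by (auto simp: image_tangent_patch proj_dF)

lemma proj_image_tangent_orthogonal:
  "patch D \<Longrightarrow> q \<in> D \<Longrightarrow> u \<in> image_tangent D F q \<Longrightarrow> (V - proj q V) \<bullet> u = 0"
  using patchD(1,3)[of D q] by (auto simp: image_tangent_patch proj_orthogonal)

lemma normal_part_patch:
  "patch D \<Longrightarrow> q \<in> D \<Longrightarrow> normal_part (image_tangent D F q) V = V - proj q V"
  by (intro normal_part_eqI) (simp_all add: subspace_image_tangent proj_image_tangent_orthogonal
      proj_in_image_tangent)

lemma inner_proj_left:
  assumes "patch D" "q \<in> D" "u \<in> image_tangent D F q"
  shows "proj q V \<bullet> u = V \<bullet> u"
  using proj_image_tangent_orthogonal[OF assms, of V] by (simp add: inner_diff_left)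

end


section \<open>The Levi-Civita connection\<close>

lemma linear_frechet_derivative_Cinf:
  "Cinf_on W f \<Longrightarrow> q \<in> W \<Longrightarrow> linear (frechet_derivative f (at q))"
  by (rule has_derivative_linear[OF Cinf_on_has_derivative])

context spun_curve
begin

definition extends_near ::
    "((real ^ 'n) \<times> real) set \<Rightarrow> (real ^ 'n) \<times> real \<Rightarrow> ((real ^ 'n) \<times> real \<Rightarrow> 'v) \<Rightarrow>
     ((real ^ 'n) \<times> real \<Rightarrow> 'v::real_normed_vector) \<Rightarrow> ((real ^ 'n) \<times> real) set \<Rightarrow> bool" where
  "extends_near D q g h W \<longleftrightarrow>
     Cinf_on W h \<and> q \<in> W \<and> W \<subseteq> dom_ext \<and> (\<forall>p\<in>W \<inter> D. h p = g p)"

lemma extends_nearD: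
  assumes "extends_near D q g h W"
  shows "Cinf_on W h" "q \<in> W" "W \<subseteq> dom_ext" "\<And>p. p \<in> W \<Longrightarrow> p \<in> D \<Longrightarrow> h p = g p" "open W"
  using assms Cinf_on_openD by (auto simp: extends_near_def)

lemma extends_near_Int:
  assumes "extends_near D q g h W" "extends_near D q g' h' W'"
  shows "extends_near D q g h (W \<inter> W')" "extends_near D q g' h' (W \<inter> W')"
proof -
  have "open (W \<inter> W')"
    using extends_nearD(5)[OF assms(1)] extends_nearD(5)[OF assms(2)] by (rule open_Int)
  then show "extends_near D q g h (W \<inter> W')" "extends_near D q g' h' (W \<inter> W')"
    using assms Cinf_on_subset[of W h "W \<inter> W'"] Cinf_on_subset[of W' h' "W \<inter> W'"]
    by (auto simp: extends_near_def)
qed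

lemma smooth_on_extends_near:
  assumes "patch D" "smooth_on D g" "q \<in> D"
  obtains h W where "extends_near D q g h W"
proof -
  obtain W h where W: "Cinf_on W h" "q \<in> W" "\<And>p. p \<in> W \<inter> D \<Longrightarrow> h p = g p"
    using smooth_onE[OF assms(2,3)] by metis
  have "Cinf_on (W \<inter> dom_ext) h"
    by (rule Cinf_on_subset[OF W(1)]) (auto intro: open_Int Cinf_on_openD[OF W(1)] open_dom_ext)
  then have "extends_near D q g h (W \<inter> dom_ext)"
    using W patchD(1)[OF assms(1,3)] by (auto simp: extends_near_def)
  then show ?thesis by (rule that)
qed

lemma extends_near_smooth_on:
  assumes "\<And>q. q \<in> D \<Longrightarrow> \<exists>h W. extends_near D q g h W"
  shows "smooth_on D g"
  by (rule smooth_onI) (use assms in \<open>unfold extends_near_def, blast\<close>)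

lemma extends_near_at:
  "extends_near D q g h W \<Longrightarrow> p \<in> W \<Longrightarrow> extends_near D p g h W"
  by (simp add: extends_near_def)

lemma differential_extends_near:
  assumes "patch D" "q \<in> D" "extends_near D q g h W" "v \<in> tang q"
  shows "differential D g q v = frechet_derivative h (at q) v"
  using assms(2,4) extends_nearD[OF assms(3)] tangent_space_patch[OF assms(1,2)]
  by (intro differential_of_extension[where W = W] Cinf_on_differentiable[of W]) simp_all

lemma field_deriv_extends_near:
  assumes "patch D" "q \<in> D" "extends_near D q g h W" "X q \<in> image_tangent D F q"
  shows "field_deriv D F X g q = frechet_derivative h (at q) (dF_inv q (X q))"
  unfolding field_deriv_def inv_differential[OF assms(1,2,4)]
  using assms dF_inv_in_tang[OF patchD(3)[OF assms(1,2)]] by (intro differential_extends_near)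

lemma extends_near_field_deriv:
  assumes "patch D" "extends_near D q X X' W" "extends_near D q g h W"
    and "\<And>p. p \<in> D \<Longrightarrow> X p \<in> image_tangent D F p"
  shows "extends_near D q (field_deriv D F X g)
    (\<lambda>p. frechet_derivative h (at p) (dF_inv p (X' p))) W"
  unfolding extends_near_def
proof (intro conjI ballI)
  note X = extends_nearD[OF assms(2)] and g = extends_nearD[OF assms(3)]
  show "Cinf_on W (\<lambda>p. frechet_derivative h (at p) (dF_inv p (X' p)))"
    by (intro Cinf_on_directional_derivative g Cinf_on_dF_inv X)
  show "frechet_derivative h (at p) (dF_inv p (X' p)) = field_deriv D F X g p"
    if "p \<in> W \<inter> D" for p
    using that field_deriv_extends_near[where X = X, OF assms(1) _ extends_near_at[OF assms(3)] assms(4)]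
      X(4)[of p] by simp
qed (use extends_nearD[OF assms(2)] in auto)

text \<open>The connection of the induced metric is the tangential part of the derivative in the
  surrounding Euclidean space.\<close>

definition connection ::
    "((real ^ 'n) \<times> real) set \<Rightarrow> ((real ^ 'n) \<times> real \<Rightarrow> complex ^ 'n) \<Rightarrow>
     ((real ^ 'n) \<times> real \<Rightarrow> complex ^ 'n) \<Rightarrow> (real ^ 'n) \<times> real \<Rightarrow> complex ^ 'n" where
  "connection D X Y q = proj q (field_deriv D F X Y q)"

lemma tangent_field_in: "tangent_field D F X \<Longrightarrow> q \<in> D \<Longrightarrow> X q \<in> image_tangent D F q"
  by (simp add: tangent_field_def)

lemma tangent_field_smooth: "tangent_field D F X \<Longrightarrow> smooth_on D X"
  by (simp add: tangent_field_def)

lemma tangent_field_connection: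
  assumes D: "patch D" and X: "tangent_field D F X" and Y: "tangent_field D F Y"
  shows "tangent_field D F (connection D X Y)"
  unfolding tangent_field_def
proof (intro conjI ballI extends_near_smooth_on)
  fix q assume q: "q \<in> D"
  obtain X' W1 where "extends_near D q X X' W1"
    using smooth_on_extends_near[OF D tangent_field_smooth[OF X] q] .
  moreover obtain Y' W2 where "extends_near D q Y Y' W2"
    using smooth_on_extends_near[OF D tangent_field_smooth[OF Y] q] .
  ultimately have "extends_near D q (field_deriv D F X Y)
      (\<lambda>p. frechet_derivative Y' (at p) (dF_inv p (X' p))) (W1 \<inter> W2)"
    by (intro extends_near_field_deriv[OF D extends_near_Int tangent_field_in[OF X]])
  note E = extends_nearD[OF this]
  have "extends_near D q (connection D X Y)
      (\<lambda>p. proj p (frechet_derivative Y' (at p) (dF_inv p (X' p)))) (W1 \<inter> W2)"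
    unfolding extends_near_def connection_def
    using E Cinf_on_proj[OF E(1,3)] by auto
  then show "\<exists>h W. extends_near D q (connection D X Y) h W" by blast
  show "connection D X Y q \<in> image_tangent D F q"
    unfolding connection_def by (rule proj_in_image_tangent[OF D q])
qed

lemma connection_left:
  assumes D: "patch D" and q: "q \<in> D" and Y: "smooth_on D Y"
    and X: "X q \<in> image_tangent D F q" "X' q \<in> image_tangent D F q"
  shows "connection D (\<lambda>q. X q + X' q) Y q = connection D X Y q + connection D X' Y q"
    "connection D (\<lambda>q. u q *\<^sub>R X q) Y q = u q *\<^sub>R connection D X Y q"
proof -
  obtain Y' W where Y': "extends_near D q Y Y' W"
    using smooth_on_extends_near[OF D Y q] .
  note lin = linear_frechet_derivative_Cinf[OF extends_nearD(1,2)[OF Y']]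
  note sub = subspace_image_tangent[OF D q]
  show "connection D (\<lambda>q. X q + X' q) Y q = connection D X Y q + connection D X' Y q"
    "connection D (\<lambda>q. u q *\<^sub>R X q) Y q = u q *\<^sub>R connection D X Y q"
    using X subspace_add[OF sub X] subspace_scale[OF sub X(1)]
    by (simp_all add: connection_def field_deriv_extends_near[OF D q Y'] linear_add[OF lin]
        linear_add[OF linear_dF_inv] linear_add[OF linear_proj] linear_cmul[OF lin]
        linear_cmul[OF linear_dF_inv] linear_cmul[OF linear_proj])
qed

text \<open>Metric compatibility holds because tangential projection does not change inner products with
  tangent fields; the Leibniz rule because it fixes tangent fields.\<close>

lemma connection_right:
  assumes D: "patch D" and q: "q \<in> D" and X: "X q \<in> image_tangent D F q"
    and Y: "tangent_field D F Y" "tangent_field D F Y'" and u: "smooth_on D u"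
  shows "connection D X (\<lambda>q. Y q + Y' q) q = connection D X Y q + connection D X Y' q"
    "connection D X (\<lambda>q. u q *\<^sub>R Y q) q =
      field_deriv D F X u q *\<^sub>R Y q + u q *\<^sub>R connection D X Y q"
    "field_deriv D F X (\<lambda>q. Y q \<bullet> Y' q) q =
      connection D X Y q \<bullet> Y' q + Y q \<bullet> connection D X Y' q"
proof -
  obtain h W1 where "extends_near D q Y h W1"
    using smooth_on_extends_near[OF D tangent_field_smooth[OF Y(1)] q] .
  moreover obtain h' W2 where "extends_near D q Y' h' W2"
    using smooth_on_extends_near[OF D tangent_field_smooth[OF Y(2)] q] .
  moreover obtain k W3 where "extends_near D q u k W3"
    using smooth_on_extends_near[OF D u q] .
  ultimately obtain W where h: "extends_near D q Y h W" and h': "extends_near D q Y' h' W"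
    and k: "extends_near D q u k W"
    using extends_near_Int by meson
  note H = extends_nearD[OF h] and H' = extends_nearD[OF h'] and K = extends_nearD[OF k]
  note d = Cinf_on_has_derivative[OF H(1,2)] and d' = Cinf_on_has_derivative[OF H'(1,2)]
    and dk = Cinf_on_has_derivative[OF K(1,2)]
  have e_add: "extends_near D q (\<lambda>q. Y q + Y' q) (\<lambda>q. h q + h' q) W"
    using H H' by (auto simp: extends_near_def intro: Cinf_intros)
  have e_scale: "extends_near D q (\<lambda>q. u q *\<^sub>R Y q) (\<lambda>q. k q *\<^sub>R h q) W"
    using H K by (auto simp: extends_near_def intro: Cinf_intros)
  have e_inner: "extends_near D q (\<lambda>q. Y q \<bullet> Y' q) (\<lambda>q. h q \<bullet> h' q) W"
    using H H' by (auto simp: extends_near_def intro: Cinf_intros)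
  note fd = field_deriv_extends_near[where X = X, OF D q _ X]
  show "connection D X (\<lambda>q. Y q + Y' q) q = connection D X Y q + connection D X Y' q"
    by (simp add: connection_def fd[OF e_add] fd[OF h] fd[OF h'] linear_add[OF linear_proj]
        frechet_derivative_eqI[OF has_derivative_add[OF d d']])
  have Yq: "proj q (Y q) = Y q"
    by (rule proj_image_tangent[OF D q tangent_field_in[OF Y(1) q]])
  show "connection D X (\<lambda>q. u q *\<^sub>R Y q) q =
      field_deriv D F X u q *\<^sub>R Y q + u q *\<^sub>R connection D X Y q"
    by (simp add: connection_def fd[OF e_scale] fd[OF h] fd[OF k] linear_add[OF linear_proj]
        linear_cmul[OF linear_proj] frechet_derivative_eqI[OF has_derivative_scaleR[OF dk d]]
        H(4)[OF H(2) q] K(4)[OF H(2) q] Yq)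
  have "proj q V \<bullet> Y' q = V \<bullet> Y' q" "Y q \<bullet> proj q V = Y q \<bullet> V" for V
    using inner_proj_left[OF D q tangent_field_in[OF Y(1) q]]
      inner_proj_left[OF D q tangent_field_in[OF Y(2) q]] by (simp_all add: inner_commute)
  then show "field_deriv D F X (\<lambda>q. Y q \<bullet> Y' q) q =
      connection D X Y q \<bullet> Y' q + Y q \<bullet> connection D X Y' q"
    by (simp add: connection_def fd[OF e_inner] fd[OF h] fd[OF h']
        frechet_derivative_eqI[OF has_derivative_inner[OF d d']] H(4)[OF H(2) q] H'(4)[OF H(2) q])
qed

text \<open>Vector fields tangent to the hypersurface \<open>S\<^sup>n\<^sup>-\<^sup>1 \<times> J\<close> have tangent Lie bracket, because
  \<open>x \<bullet> \<eta> = 0\<close> may be differentiated along \<open>\<xi>\<close> and the second fundamental form of the sphere is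
  symmetric.\<close>

lemma bracket_in_tang:
  assumes D: "patch D" and q: "q \<in> D" "q \<in> W" "W \<subseteq> dom_ext"
    and \<xi>: "Cinf_on W \<xi>" "\<And>p. p \<in> W \<inter> D \<Longrightarrow> \<xi> p \<in> tang p"
    and \<eta>: "Cinf_on W \<eta>" "\<And>p. p \<in> W \<inter> D \<Longrightarrow> \<eta> p \<in> tang p"
  shows "frechet_derivative \<eta> (at q) (\<xi> q) - frechet_derivative \<xi> (at q) (\<eta> q) \<in> tang q"
proof -
  have *: "fst q \<bullet> fst (frechet_derivative \<eta> (at q) v) = - (fst v \<bullet> fst (\<eta> q))"
    if \<eta>: "Cinf_on W \<eta>" "\<And>p. p \<in> W \<inter> D \<Longrightarrow> \<eta> p \<in> tang p" and v: "v \<in> tang q" for \<eta> v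
  proof -
    have W: "open W" using \<eta>(1) by (rule Cinf_on_openD)
    have e1: "extends_near D q (\<lambda>_. 0) (\<lambda>p. fst p \<bullet> fst (\<eta> p)) W"
      using \<eta> q W by (auto simp: extends_near_def tang_def intro!: Cinf_intros)
    have e2: "extends_near D q (\<lambda>_. 0) (\<lambda>_. 0 :: real) W"
      using q W by (auto simp: extends_near_def intro!: Cinf_intros)
    have "frechet_derivative (\<lambda>p. fst p \<bullet> fst (\<eta> p)) (at q) v = 0"
      using differential_extends_near[OF D q(1) e1 v] differential_extends_near[OF D q(1) e2 v]
      by simp
    moreover have "((\<lambda>p. fst p \<bullet> fst (\<eta> p)) has_derivative
        (\<lambda>v. fst q \<bullet> fst (frechet_derivative \<eta> (at q) v) + fst v \<bullet> fst (\<eta> q))) (at q)"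
      by (intro has_derivative_inner has_derivative_fst has_derivative_ident
          Cinf_on_has_derivative[OF \<eta>(1) q(2)])
    from frechet_derivative_eqI[OF this, of v] calculation show ?thesis
      by simp
  qed
  show ?thesis
    using *[OF \<eta>, of "\<xi> q"] *[OF \<xi>, of "\<eta> q"] \<xi>(2) \<eta>(2) q
    by (simp add: tang_def inner_diff_right inner_commute)
qed

text \<open>Writing \<open>X = dF \<xi>\<close> and \<open>Y = dF \<eta>\<close>, both sides are the derivative of \<open>u\<close> along the bracket
  \<open>Z = D\<eta> \<xi> - D\<xi> \<eta>\<close>: on the left the second derivatives of \<open>F\<close> cancel, on the right those of \<open>u\<close>.\<close>

lemma connection_torsion_free:
  fixes u :: "(real ^ 'n) \<times> real \<Rightarrow> real"
  assumes D: "patch D" and q: "q \<in> D" and u: "smooth_on D u"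
    and X: "tangent_field D F X" and Y: "tangent_field D F Y"
  shows "field_deriv D F (\<lambda>q. connection D X Y q - connection D Y X q) u q =
    field_deriv D F X (field_deriv D F Y u) q - field_deriv D F Y (field_deriv D F X u) q"
proof -
  obtain h W1 where "extends_near D q X h W1"
    using smooth_on_extends_near[OF D tangent_field_smooth[OF X] q] .
  moreover obtain h' W2 where "extends_near D q Y h' W2"
    using smooth_on_extends_near[OF D tangent_field_smooth[OF Y] q] .
  moreover obtain k W3 where "extends_near D q u k W3"
    using smooth_on_extends_near[OF D u q] .
  ultimately obtain W where h: "extends_near D q X h W" and h': "extends_near D q Y h' W"
    and k: "extends_near D q u k W"
    using extends_near_Int by meson
  note H = extends_nearD[OF h] and H' = extends_nearD[OF h'] and K = extends_nearD[OF k]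
  define \<xi> where "\<xi> p = dF_inv p (h p)" for p
  define \<eta> where "\<eta> p = dF_inv p (h' p)" for p
  have \<xi>: "Cinf_on W \<xi>" and \<eta>: "Cinf_on W \<eta>"
    unfolding \<xi>_def[abs_def] \<eta>_def[abs_def] by (intro Cinf_on_dF_inv H H')+
  have \<xi>T: "\<xi> p \<in> tang p" and \<eta>T: "\<eta> p \<in> tang p" if "p \<in> D" for p
    using dF_inv_in_tang[OF patchD(3)[OF D that]] by (simp_all add: \<xi>_def \<eta>_def)
  have \<xi>q: "dF_inv q (X q) = \<xi> q" and \<eta>q: "dF_inv q (Y q) = \<eta> q"
    using H(2,4) H'(2,4) q by (simp_all add: \<xi>_def \<eta>_def)
  let ?d = "\<lambda>g. frechet_derivative g (at q)"
  define Z where "Z = ?d \<eta> (\<xi> q) - ?d \<xi> (\<eta> q)"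
  have Z: "Z \<in> tang q"
    unfolding Z_def using \<xi> \<eta> \<xi>T \<eta>T H(2,3) q by (intro bracket_in_tang[OF D]) auto
  have G: "Cinf_on W F_ext"
    by (rule Cinf_on_subset[OF F_ext_smooth H(5,3)])
  \<comment> \<open>Differentiate \<open>X = dF \<xi>\<close> rather than \<open>X\<close>: then the second derivatives of \<open>F\<close> cancel.\<close>
  have repr: "?d g v = ?d (\<lambda>p. frechet_derivative F_ext (at p) v) (\<zeta> q) + dF q (?d \<zeta> v)"
    if Xg: "tangent_field D F A" "extends_near D q A g W" and \<zeta>: "\<zeta> = (\<lambda>p. dF_inv p (g p))"
      and v: "v \<in> tang q" for A g \<zeta> v
  proof -
    note g = extends_nearD[OF Xg(2)]
    have s\<zeta>: "Cinf_on W \<zeta>"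
      unfolding \<zeta> by (intro Cinf_on_dF_inv g)
    have "dF p (\<zeta> p) = A p" if "p \<in> W \<inter> D" for p
      using that proj_image_tangent[OF D _ tangent_field_in[OF Xg(1)]] g(4)
      by (simp add: \<zeta> proj_def)
    then have "extends_near D q A (\<lambda>p. frechet_derivative F_ext (at p) (\<zeta> p)) W"
      using g(2,3) Cinf_on_directional_derivative[OF G s\<zeta>]
      by (auto simp: extends_near_def frechet_derivative_F_ext subset_eq)
    from differential_extends_near[OF D q this v] differential_extends_near[OF D q Xg(2) v]
    have "?d g v = ?d (\<lambda>p. frechet_derivative F_ext (at p) (\<zeta> p)) v" by simp
    also have "\<dots> = ?d (\<lambda>p. frechet_derivative F_ext (at p) v) (\<zeta> q) +
        ?d F_ext (?d \<zeta> v)"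
      by (rule frechet_derivative_along_field[OF G s\<zeta> g(2)])
    finally show ?thesis
      using frechet_derivative_F_ext g(2,3) by (simp add: subset_eq)
  qed
  have fdY: "field_deriv D F X Y q = ?d h' (\<xi> q)" and fdX: "field_deriv D F Y X q = ?d h (\<eta> q)"
    using field_deriv_extends_near[where X = X, OF D q h' tangent_field_in[OF X q]]
      field_deriv_extends_near[where X = Y, OF D q h tangent_field_in[OF Y q]] by (simp_all add: \<xi>q \<eta>q)
  have "?d h' (\<xi> q) - ?d h (\<eta> q) = dF q (?d \<eta> (\<xi> q)) - dF q (?d \<xi> (\<eta> q))"
    using repr[OF Y h' _ \<xi>T[OF q], of \<eta>] repr[OF X h _ \<eta>T[OF q], of \<xi>]
      second_derivative_symmetric[OF G H(2), of "\<xi> q" "\<eta> q"]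
    by (simp add: \<xi>_def[abs_def] \<eta>_def[abs_def])
  also have "\<dots> = dF q Z"
    unfolding Z_def by (simp add: linear_diff[OF linear_dF])
  finally have bracket: "connection D X Y q - connection D Y X q = dF q Z"
    unfolding connection_def fdX fdY linear_diff[OF linear_proj, symmetric]
    using proj_dF[OF patchD(1,3)[OF D q] Z] by simp
  have "dF q Z \<in> image_tangent D F q"
    using Z image_tangent_patch[OF D q] by simp
  then have lhs: "field_deriv D F (\<lambda>q. connection D X Y q - connection D Y X q) u q = ?d k Z"
    using field_deriv_extends_near[OF D q k, of "\<lambda>q. connection D X Y q - connection D Y X q"]
      dF_inv_dF[OF patchD(1,3)[OF D q] Z] by (simp add: bracket)
  have "field_deriv D F X (field_deriv D F Y u) q =
      ?d (\<lambda>p. frechet_derivative k (at p) (\<eta> p)) (\<xi> q)"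
    using field_deriv_extends_near[where X = X, OF D q
        extends_near_field_deriv[OF D h' k tangent_field_in[OF Y]] tangent_field_in[OF X q]]
    by (simp add: \<xi>q \<eta>_def)
  also have "\<dots> = ?d (\<lambda>p. frechet_derivative k (at p) (\<xi> q)) (\<eta> q) + ?d k (?d \<eta> (\<xi> q))"
    by (rule frechet_derivative_along_field[OF K(1) \<eta> H(2)])
  finally have XY: "field_deriv D F X (field_deriv D F Y u) q =
      ?d (\<lambda>p. frechet_derivative k (at p) (\<xi> q)) (\<eta> q) + ?d k (?d \<eta> (\<xi> q))" .
  have "field_deriv D F Y (field_deriv D F X u) q =
      ?d (\<lambda>p. frechet_derivative k (at p) (\<xi> p)) (\<eta> q)"
    using field_deriv_extends_near[where X = Y, OF D q
        extends_near_field_deriv[OF D h k tangent_field_in[OF X]] tangent_field_in[OF Y q]]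
    by (simp add: \<eta>q \<xi>_def)
  also have "\<dots> = ?d (\<lambda>p. frechet_derivative k (at p) (\<eta> q)) (\<xi> q) + ?d k (?d \<xi> (\<eta> q))"
    by (rule frechet_derivative_along_field[OF K(1) \<xi> H(2)])
  finally have YX: "field_deriv D F Y (field_deriv D F X u) q =
      ?d (\<lambda>p. frechet_derivative k (at p) (\<eta> q)) (\<xi> q) + ?d k (?d \<xi> (\<eta> q))" .
  show ?thesis
    unfolding lhs XY YX Z_def
    using second_derivative_symmetric[OF K(1,2), of "\<xi> q" "\<eta> q"]
      linear_diff[OF linear_frechet_derivative_Cinf[OF K(1,2)]] by simp
qed

lemma levi_civita_connection:
  assumes D: "patch D"
  shows "levi_civita D F (connection D)"
  unfolding levi_civita_def
proof (intro conjI allI impI ballI; (elim conjE)?)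
  fix X Y assume "tangent_field D F X" "tangent_field D F Y"
  then show "tangent_field D F (connection D X Y)"
    by (rule tangent_field_connection[OF D])
next
  fix X X' Y q assume "tangent_field D F X" "tangent_field D F X'" "tangent_field D F Y" "q \<in> D"
  then show "connection D (\<lambda>q. X q + X' q) Y q = connection D X Y q + connection D X' Y q"
    by (intro connection_left[OF D]) (auto intro: tangent_field_in tangent_field_smooth)
next
  fix u X Y q assume "tangent_field D F X" "tangent_field D F Y" "q \<in> D"
  then show "connection D (\<lambda>q. u q *\<^sub>R X q) Y q = u q *\<^sub>R connection D X Y q"
    by (intro connection_left[OF D, where X' = X]) (auto intro: tangent_field_in tangent_field_smooth)
next
  fix X Y Y' q assume "tangent_field D F X" "tangent_field D F Y" "tangent_field D F Y'" "q \<in> D"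
  moreover have "smooth_on D (\<lambda>_. 0 :: real)"
    by (rule smooth_on_Cinf[of UNIV "\<lambda>_. 0"]) (auto intro: Cinf_intros)
  ultimately show "connection D X (\<lambda>q. Y q + Y' q) q = connection D X Y q + connection D X Y' q"
    by (intro connection_right[OF D]) (auto intro: tangent_field_in)
next
  fix u :: "(real ^ 'n) \<times> real \<Rightarrow> real" and X Y q
  assume "smooth_on D u" "tangent_field D F X" "tangent_field D F Y" "q \<in> D"
  then show "connection D X (\<lambda>q. u q *\<^sub>R Y q) q =
      field_deriv D F X u q *\<^sub>R Y q + u q *\<^sub>R connection D X Y q"
    by (intro connection_right[OF D, where Y' = Y]) (auto intro: tangent_field_in)
next
  fix X Y Z q assume "tangent_field D F X" "tangent_field D F Y" "tangent_field D F Z" "q \<in> D"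
  moreover have "smooth_on D (\<lambda>_. 0 :: real)"
    by (rule smooth_on_Cinf[of UNIV "\<lambda>_. 0"]) (auto intro: Cinf_intros)
  ultimately show "field_deriv D F X (\<lambda>q. Y q \<bullet> Z q) q =
      connection D X Y q \<bullet> Z q + Y q \<bullet> connection D X Z q"
    by (intro connection_right[OF D]) (auto intro: tangent_field_in)
next
  fix u :: "(real ^ 'n) \<times> real \<Rightarrow> real" and X Y q
  assume "smooth_on D u" "tangent_field D F X" "tangent_field D F Y" "q \<in> D"
  then show "field_deriv D F (\<lambda>q. connection D X Y q - connection D Y X q) u q =
      field_deriv D F X (field_deriv D F Y u) q - field_deriv D F Y (field_deriv D F X u) q"
    by (intro connection_torsion_free[OF D])
qed

end


section \<open>The slices\<close>

lemma tangent_space_sphere: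
  fixes x :: "'a::euclidean_space"
  assumes "norm x = 1"
  shows "tangent_space (sphere 0 1) x = {w. x \<bullet> w = 0}"
proof
  show "tangent_space (sphere 0 1) x \<subseteq> {w. x \<bullet> w = 0}"
    unfolding tangent_space_def
  proof (rule span_minimal[OF _ subspace_hyperplane], safe)
    fix v and \<gamma> :: "real \<Rightarrow> 'a"
    assume "\<forall>t\<ge>0. \<gamma> t \<in> sphere 0 1" "(\<gamma> has_vector_derivative v) (at 0 within {0::real..})"
    then show "\<gamma> 0 \<bullet> v = 0"
      by (intro sphere_velocity_orthogonal) auto
  qed
  show "{w. x \<bullet> w = 0} \<subseteq> tangent_space (sphere 0 1) x"
  proof safe
    fix w assume "x \<bullet> w = 0"
    then show "w \<in> tangent_space (sphere 0 1) x"
      using great_circle[OF assms, of w] has_vector_derivative_at_within[OF great_circle(3)[OF assms, of w]]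
      by (intro velocity_in_tangent_space[where c = "great_circle x w" and d = 1]) auto
  qed
qed

context
  fixes c :: complex and G :: "real ^ 'n \<Rightarrow> complex ^ 'n"
  assumes c: "c \<noteq> 0" and G: "\<And>x. norm x = 1 \<Longrightarrow> G x = cscale c x"
begin

lemma differential_scaled_sphere:
  assumes "norm x = 1" "x \<bullet> w = 0"
  shows "differential (sphere 0 1) G x w = cscale c w"
proof -
  have d: "(cscale c has_derivative cscale c) (at x)"
    by (rule bounded_linear_imp_has_derivative[OF cscale.bounded_linear_right])
  have "differential (sphere 0 1) G x w = frechet_derivative (cscale c) (at x) w"
    using assms G by (intro differential_of_extension[of _ _ UNIV] differentiableI[OF d])
      (auto simp: tangent_space_sphere)
  then show ?thesis
    using frechet_derivative_eqI[OF d] by simp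
qed

lemma image_tangent_scaled_sphere:
  assumes "norm x = 1"
  shows "image_tangent (sphere 0 1) G x = cscale c ` {w. x \<bullet> w = 0}"
  using assms differential_scaled_sphere
  by (auto simp: image_tangent_def tangent_space_sphere image_iff)

lemma inj_cscale: "inj (cscale c :: real ^ 'n \<Rightarrow> _)"
proof (rule inj_on_inverseI)
  show "reproj (inverse c) (cscale c w) = w" for w :: "real ^ 'n"
    unfolding reproj_cscale left_inverse[OF c] by simp
qed

lemma immersion_scaled_sphere: "immersion (sphere 0 1) G"
  unfolding immersion_def
proof (intro conjI ballI)
  show "smooth_on (sphere 0 1) G"
    using G by (intro smooth_on_Cinf[of UNIV "cscale c"] Cinf_on_linear[OF cscale.bounded_linear_right]
        Cinf_on_id) auto
  fix x :: "real ^ 'n" assume x: "x \<in> sphere 0 1"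
  show "inj_on (differential (sphere 0 1) G x) (tangent_space (sphere 0 1) x)"
    using x inj_on_subset[OF inj_cscale subset_UNIV] differential_scaled_sphere[of x]
    by (auto simp: tangent_space_sphere inj_on_def)
qed

lemma dim_image_tangent_scaled_sphere:
  assumes "norm x = 1"
  shows "dim (image_tangent (sphere 0 1) G x) = CARD('n) - 1"
proof -
  have "linear (cscale c :: real ^ 'n \<Rightarrow> _)"
    by (rule bounded_linear.linear[OF cscale.bounded_linear_right])
  then have "dim (cscale c ` {w. x \<bullet> w = 0}) = dim {w. x \<bullet> w = 0}"
    by (rule dim_image_eq) (rule inj_on_subset[OF inj_cscale subset_UNIV])
  also have "\<dots> = CARD('n) - 1"
    using assms by (subst dim_hyperplane) auto
  finally show ?thesis
    using image_tangent_scaled_sphere[OF assms] by simp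
qed

lemma subspace_image_tangent_scaled_sphere:
  assumes "norm x = 1"
  shows "subspace (image_tangent (sphere 0 1) G x)"
  unfolding image_tangent_scaled_sphere[OF assms]
  by (rule linear_subspace_image[OF bounded_linear.linear[OF cscale.bounded_linear_right]
        subspace_hyperplane])

end


section \<open>An adapted orthonormal frame\<close>

text \<open>The rotation in the plane of \<open>x\<^sub>0\<close> and \<open>x\<close> that takes \<open>x\<^sub>0\<close> to \<open>x\<close>, applied to a vector \<open>v\<close> that is
  tangent to the sphere at \<open>x\<^sub>0\<close>. It is parallel transport along the great circle, and it is smooth in
  \<open>x\<close> away from \<open>- x\<^sub>0\<close>.\<close>

definition transport :: "'a::real_inner \<Rightarrow> 'a \<Rightarrow> 'a \<Rightarrow> 'a" where
  "transport x\<^sub>0 v x = v - ((x \<bullet> v) / (1 + x \<bullet> x\<^sub>0)) *\<^sub>R (x\<^sub>0 + x)"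

lemma transport_orthogonal:
  assumes "norm x = 1" "x \<bullet> x\<^sub>0 > -1"
  shows "x \<bullet> transport x\<^sub>0 v x = 0"
proof -
  have eq: "x \<bullet> x\<^sub>0 + x \<bullet> x = 1 + x \<bullet> x\<^sub>0" and nz: "1 + x \<bullet> x\<^sub>0 \<noteq> 0"
    using assms by (simp_all add: norm_eq_1)
  show ?thesis
    unfolding transport_def inner_diff_right inner_add_right inner_scaleR_right eq
    using nz by simp
qed

lemma transport_isometry:
  assumes x: "norm x = 1" "norm x\<^sub>0 = 1" "x \<bullet> x\<^sub>0 > -1" and v: "x\<^sub>0 \<bullet> v = 0" "x\<^sub>0 \<bullet> w = 0"
  shows "transport x\<^sub>0 v x \<bullet> transport x\<^sub>0 w x = v \<bullet> w"
proof -
  define k where "k = 1 + x \<bullet> x\<^sub>0"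
  have k: "k \<noteq> 0" "x \<bullet> x\<^sub>0 = k - 1"
    using x(3) by (simp_all add: k_def)
  have v': "v \<bullet> x\<^sub>0 = 0" "w \<bullet> x\<^sub>0 = 0" "v \<bullet> x = x \<bullet> v" "w \<bullet> x = x \<bullet> w" "x\<^sub>0 \<bullet> x = k - 1"
    "x\<^sub>0 \<bullet> x\<^sub>0 = 1" "x \<bullet> x = 1"
    using v k(2) x by (simp_all add: inner_commute norm_eq_1)
  show ?thesis
    unfolding transport_def k_def[symmetric]
    using k(1) by (simp add: inner_diff_left inner_diff_right inner_add_left inner_add_right v v' k(2)
        field_simps)
qed

lemma frechet_derivative_along_line:
  assumes "g differentiable (at q)" "((\<lambda>t. g (q + t *\<^sub>R v)) has_vector_derivative d) (at 0)"
  shows "frechet_derivative g (at q) v = d"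
proof -
  have D: "(g has_derivative frechet_derivative g (at q)) (at (q + 0 *\<^sub>R v))"
    using assms(1) by (simp add: frechet_derivative_works)
  have "((\<lambda>t. q + t *\<^sub>R v) has_derivative (\<lambda>t. t *\<^sub>R v)) (at 0)"
    by (auto intro!: derivative_eq_intros)
  from has_derivative_compose[OF this D]
  have "((\<lambda>t. g (q + t *\<^sub>R v)) has_vector_derivative frechet_derivative g (at q) v) (at 0)"
    using linear_cmul[OF has_derivative_linear[OF D]] by (simp add: has_vector_derivative_def)
  from vector_derivative_unique_at[OF this assms(2)] show ?thesis .
qed

locale spun_curve_frame = spun_curve J z z' F
  for J z z' and F :: "(real ^ 'n) \<times> real \<Rightarrow> complex ^ 'n" +
  fixes x\<^sub>0 :: "real ^ 'n" and s\<^sub>0 :: real and m :: nat and b :: "nat \<Rightarrow> real ^ 'n"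
  assumes x0: "norm x\<^sub>0 = 1" and s0: "s\<^sub>0 \<in> J" "s\<^sub>0 \<ge> 0"
    and card: "CARD('n) = Suc m" and b: "orthonormal_basis_of {w. x\<^sub>0 \<bullet> w = 0} m b"
begin

abbreviation q\<^sub>0 :: "(real ^ 'n) \<times> real" where "q\<^sub>0 \<equiv> (x\<^sub>0, s\<^sub>0)"

definition frame_ext :: "((real ^ 'n) \<times> real) set" where
  "frame_ext = {q. fst q \<bullet> x\<^sub>0 > -1} \<inter> dom_ext"

definition frame_dom :: "((real ^ 'n) \<times> real) set" where
  "frame_dom = L_dom \<inter> frame_ext"

text \<open>The frame in the coordinates \<open>(x, s)\<close>: the indices below \<open>m\<close> give the directions of the slice, the
  index \<open>m\<close> gives the direction of the curve.\<close>

definition frame_dir :: "nat \<Rightarrow> (real ^ 'n) \<times> real \<Rightarrow> (real ^ 'n) \<times> real" where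
  "frame_dir i q =
    (if i < m then (inverse (cmod (z (snd q))) *\<^sub>R transport x\<^sub>0 (b i) (fst q), 0)
     else (0, inverse (cmod (z' (snd q)))))"

definition frame :: "nat \<Rightarrow> (real ^ 'n) \<times> real \<Rightarrow> complex ^ 'n" where
  "frame i q = dF q (frame_dir i q)"

lemma b_orthonormal: "i < m \<Longrightarrow> j < m \<Longrightarrow> b i \<bullet> b j = (if i = j then 1 else 0)"
  using b by (simp add: orthonormal_basis_of_def)

lemma b_orthogonal: "i < m \<Longrightarrow> x\<^sub>0 \<bullet> b i = 0"
  using b span_superset[of "b ` {..<m}"] unfolding orthonormal_basis_of_def by blast

lemma open_frame_ext: "open frame_ext"
  unfolding frame_ext_def
  by (intro open_Int open_dom_ext open_Collect_less continuous_intros)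

lemma patch_frame_dom: "patch frame_dom"
  unfolding patch_def frame_dom_def
  using open_frame_ext by (auto simp: openin_open frame_ext_def)

lemma q0_in: "q\<^sub>0 \<in> frame_dom"
  using x0 s0 by (simp add: frame_dom_def frame_ext_def dom_ext_def L_dom_def norm_eq_1)

lemma frame_domD: "q \<in> frame_dom \<Longrightarrow> fst q \<bullet> x\<^sub>0 > -1"
  by (simp add: frame_dom_def frame_ext_def)

lemma frame_smooth: "Cinf_on frame_ext (frame i)"
proof -
  have sub: "frame_ext \<subseteq> dom_ext"
    by (simp add: frame_ext_def)
  have nz: "z (snd q) \<noteq> 0" "z' (snd q) \<noteq> 0" if "q \<in> frame_ext" for q
    using that z_nz z'_nz by (auto simp: frame_ext_def dom_ext_def)
  have pos: "1 + fst q \<bullet> x\<^sub>0 \<noteq> 0" if "q \<in> frame_ext" for q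
    using that by (auto simp: frame_ext_def)
  have "Cinf_on frame_ext (frame_dir i)"
    unfolding frame_dir_def[abs_def] transport_def
    by (cases "i < m"; simp only: if_True if_False)
      (intro Cinf_intros Cinf_on_z open_frame_ext sub; use nz pos in simp)+
  then show ?thesis
    unfolding frame_def[abs_def] by (intro Cinf_on_dF sub)
qed

lemma frame_dir_in_tang:
  assumes "q \<in> frame_dom"
  shows "frame_dir i q \<in> tang q"
  using transport_orthogonal[OF patchD(3)[OF patch_frame_dom assms] frame_domD[OF assms]]
  by (simp add: tang_def frame_dir_def)

lemma dF_inv_frame: "q \<in> frame_dom \<Longrightarrow> dF_inv q (frame i q) = frame_dir i q"
  unfolding frame_def using patchD(1,3)[OF patch_frame_dom] frame_dir_in_tang by (intro dF_inv_dF)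

lemma frame_orthonormal:
  assumes q: "q \<in> frame_dom" and i: "i < CARD('n)" "j < CARD('n)"
  shows "frame i q \<bullet> frame j q = (if i = j then 1 else 0)"
proof -
  note D = patchD[OF patch_frame_dom q]
  have nz: "cmod (z (snd q)) \<noteq> 0" "cmod (z' (snd q)) \<noteq> 0"
    using z_nz[OF D(5)] z'_nz[OF D(5)] by auto
  have eq: "frame i q \<bullet> frame j q =
      (cmod (z (snd q)))\<^sup>2 * (fst (frame_dir i q) \<bullet> fst (frame_dir j q)) +
      (cmod (z' (snd q)))\<^sup>2 * (snd (frame_dir i q) * snd (frame_dir j q))"
    using inner_dF[OF D(1) frame_dir_in_tang[OF q], of "frame i q" j] dF_inv_frame[OF q]
    by (simp add: frame_def)
  have iso: "transport x\<^sub>0 (b i) (fst q) \<bullet> transport x\<^sub>0 (b j) (fst q) = (if i = j then 1 else 0)"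
    if "i < m" "j < m"
    using transport_isometry[OF D(3) x0 frame_domD[OF q]] b_orthogonal b_orthonormal that by simp
  consider "i < m" "j < m" | "i < m" "j = m" | "i = m" "j < m" | "i = m" "j = m"
    using i card by linarith
  then show ?thesis
    unfolding eq frame_dir_def
    by cases (use nz iso in \<open>auto simp: power2_eq_square field_simps\<close>)
qed

lemma tangent_field_frame: "tangent_field frame_dom F (frame i)"
  unfolding tangent_field_def
proof (intro conjI ballI)
  show "smooth_on frame_dom (frame i)"
    by (rule smooth_on_Cinf[OF frame_smooth]) (auto simp: frame_dom_def)
  show "frame i q \<in> image_tangent frame_dom F q" if "q \<in> frame_dom" for q
    using frame_dir_in_tang[OF that] image_tangent_patch[OF patch_frame_dom that]
    by (simp add: frame_def)
qed

lemma frame_basis: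
  assumes q: "q \<in> frame_dom"
  shows "orthonormal_basis_of (image_tangent frame_dom F q) CARD('n) (\<lambda>i. frame i q)"
proof (rule orthonormal_basis_ofI)
  note D = patchD[OF patch_frame_dom q]
  show "subspace (image_tangent frame_dom F q)"
    by (rule subspace_image_tangent[OF patch_frame_dom q])
  have "tang q = {v. (fst q, 0) \<bullet> v = 0}"
    by (auto simp: tang_def inner_prod_def)
  moreover have "(fst q, 0 :: real) \<noteq> 0"
    using D(3) by (auto simp: zero_prod_def)
  ultimately have "dim (tang q) = CARD('n)"
    using dim_hyperplane[of "(fst q, 0 :: real)"] by simp
  moreover have "inj_on (dF q) (span (tang q))"
    unfolding span_eq_iff[THEN iffD2, OF subspace_tang]
    by (rule inj_on_inverseI[where g = "dF_inv q"]) (rule dF_inv_dF[OF D(1,3)])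
  ultimately show "dim (image_tangent frame_dom F q) = CARD('n)"
    unfolding image_tangent_patch[OF patch_frame_dom q] by (simp add: dim_image_eq[OF linear_dF])
qed (use frame_orthonormal[OF q] tangent_field_in[OF tangent_field_frame q] in auto)

lemma frame_basis_slice:
  assumes x: "norm x = 1" "slice s\<^sub>0 x \<in> frame_dom"
  shows "orthonormal_basis_of (image_tangent (sphere 0 1) (F \<circ> slice s\<^sub>0) x) m
    (\<lambda>i. frame i (slice s\<^sub>0 x))"
proof -
  have slice: "(F \<circ> slice s\<^sub>0) x = cscale (z s\<^sub>0) x" if "norm x = 1" for x
    using F_eq[OF that s0] by (simp add: slice_def)
  note c = z_nz[OF s0(1)] slice
  show ?thesis
  proof (rule orthonormal_basis_ofI)
    show "frame i (slice s\<^sub>0 x) \<in> image_tangent (sphere 0 1) (F \<circ> slice s\<^sub>0) x" if "i < m" for i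
      using frame_dir_in_tang[OF x(2), of i] that
      by (auto simp: image_tangent_scaled_sphere[OF c x(1)] frame_def dF_def frame_dir_def slice_def
          tang_def)
    show "frame i (slice s\<^sub>0 x) \<bullet> frame j (slice s\<^sub>0 x) = (if i = j then 1 else 0)"
      if "i < m" "j < m" for i j
      using that card by (intro frame_orthonormal x(2)) auto
  qed (simp_all add: card subspace_image_tangent_scaled_sphere[OF c x(1)]
      dim_image_tangent_scaled_sphere[OF c x(1)])
qed

lemma field_deriv_frame:
  assumes "((\<lambda>t. frame i (q\<^sub>0 + t *\<^sub>R frame_dir i q\<^sub>0)) has_vector_derivative d) (at 0)"
  shows "field_deriv frame_dom F (frame i) (frame i) q\<^sub>0 = d"
proof -
  have "extends_near frame_dom q\<^sub>0 (frame i) (frame i) frame_ext"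
    using q0_in frame_smooth by (auto simp: extends_near_def frame_dom_def frame_ext_def)
  from field_deriv_extends_near[where X = "frame i", OF patch_frame_dom q0_in this
      tangent_field_in[OF tangent_field_frame q0_in]]
  show ?thesis
    using frechet_derivative_along_line[OF Cinf_on_differentiable[OF frame_smooth] assms] q0_in
    by (simp add: dF_inv_frame frame_dom_def)
qed

text \<open>Along a great circle the transported vector turns towards \<open>- x\<^sub>0\<close>, the normal of the sphere.\<close>

lemma field_deriv_frame_sphere:
  assumes i: "i < m"
  shows "field_deriv frame_dom F (frame i) (frame i) q\<^sub>0 =
    cscale (- (inverse ((cmod (z s\<^sub>0))\<^sup>2) *\<^sub>R z s\<^sub>0)) x\<^sub>0"
proof (rule field_deriv_frame)
  define r where "r = inverse (cmod (z s\<^sub>0))"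
  have x: "x\<^sub>0 \<bullet> b i = 0" "b i \<bullet> x\<^sub>0 = 0" "b i \<bullet> b i = 1" "x\<^sub>0 \<bullet> x\<^sub>0 = 1"
    using i b_orthogonal b_orthonormal x0 by (simp_all add: norm_eq_1 inner_commute)
  have "frame i (q\<^sub>0 + t *\<^sub>R frame_dir i q\<^sub>0) =
      cscale (r *\<^sub>R z s\<^sub>0) (b i - (t * r / 2) *\<^sub>R (2 *\<^sub>R x\<^sub>0 + (t * r) *\<^sub>R b i))" for t
    using i by (simp add: frame_def dF_def frame_dir_def transport_def inner_add_left x scaleR_2
        r_def[symmetric] cscale.scaleR_left cscale.scaleR_right add.assoc)
  moreover have "((\<lambda>t. b i - (t * r / 2) *\<^sub>R (2 *\<^sub>R x\<^sub>0 + (t * r) *\<^sub>R b i))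
      has_vector_derivative (- r) *\<^sub>R x\<^sub>0) (at 0)"
    by (auto intro!: derivative_eq_intros simp: has_vector_derivative_def)
  then have "((\<lambda>t. cscale (r *\<^sub>R z s\<^sub>0) (b i - (t * r / 2) *\<^sub>R (2 *\<^sub>R x\<^sub>0 + (t * r) *\<^sub>R b i)))
      has_vector_derivative cscale (r *\<^sub>R z s\<^sub>0) ((- r) *\<^sub>R x\<^sub>0)) (at 0)"
    by (rule bounded_linear.has_vector_derivative[OF cscale.bounded_linear_right])
  ultimately show "((\<lambda>t. frame i (q\<^sub>0 + t *\<^sub>R frame_dir i q\<^sub>0)) has_vector_derivative
      cscale (- (inverse ((cmod (z s\<^sub>0))\<^sup>2) *\<^sub>R z s\<^sub>0)) x\<^sub>0) (at 0)"
    by (simp add: cscale.scaleR_left cscale.scaleR_right cscale.minus_left cscale.minus_right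
        r_def power2_eq_square)
qed

text \<open>The term with \<open>\<rho>\<close> comes from differentiating the normalizing factor \<open>1 / \<bar>z'\<bar>\<close>. It is tangent to \<open>L\<close>.\<close>

lemma field_deriv_frame_curve:
  assumes z'': "(z' has_vector_derivative z'') (at s\<^sub>0)"
  shows "\<exists>\<rho>. field_deriv frame_dom F (frame m) (frame m) q\<^sub>0 =
    cscale (inverse ((cmod (z' s\<^sub>0))\<^sup>2) *\<^sub>R z'' + \<rho> *\<^sub>R z' s\<^sub>0) x\<^sub>0"
proof -
  define r where "r s = inverse (cmod (z' s))" for s
  have "Cinf_on J r"
    unfolding r_def[abs_def] using z'_nz by (intro Cinf_intros z'_smooth) auto
  then obtain r' where r': "(r has_real_derivative r') (at s\<^sub>0)"
    using Cinf_on_differentiable[OF _ s0(1)] real_differentiable_def by blast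
  have "((\<lambda>s. r s *\<^sub>R z' s) has_vector_derivative r s\<^sub>0 *\<^sub>R z'' + r' *\<^sub>R z' s\<^sub>0) (at s\<^sub>0)"
    by (intro has_vector_derivative_scaleR r' z'')
  then have "((\<lambda>s. r s *\<^sub>R z' s) has_vector_derivative r s\<^sub>0 *\<^sub>R z'' + r' *\<^sub>R z' s\<^sub>0)
      (at (s\<^sub>0 + 0 * r s\<^sub>0))" by simp
  moreover have "((\<lambda>t. s\<^sub>0 + t * r s\<^sub>0) has_vector_derivative r s\<^sub>0) (at 0)"
    by (auto intro!: derivative_eq_intros simp: has_vector_derivative_def)
  ultimately have "((\<lambda>t. r (s\<^sub>0 + t * r s\<^sub>0) *\<^sub>R z' (s\<^sub>0 + t * r s\<^sub>0)) has_vector_derivative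
      r s\<^sub>0 *\<^sub>R (r s\<^sub>0 *\<^sub>R z'' + r' *\<^sub>R z' s\<^sub>0)) (at 0)"
    using vector_diff_chain_at[of "\<lambda>t. s\<^sub>0 + t * r s\<^sub>0" "r s\<^sub>0" 0 "\<lambda>s. r s *\<^sub>R z' s"]
    by (simp add: o_def)
  from bounded_linear.has_vector_derivative[OF cscale.bounded_linear_left[of x\<^sub>0] this]
  have "((\<lambda>t. frame m (q\<^sub>0 + t *\<^sub>R frame_dir m q\<^sub>0)) has_vector_derivative
      cscale (r s\<^sub>0 *\<^sub>R (r s\<^sub>0 *\<^sub>R z'' + r' *\<^sub>R z' s\<^sub>0)) x\<^sub>0) (at 0)"
    by (simp add: frame_def dF_def frame_dir_def r_def cscale.scaleR_left cscale.zero_right)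
  from field_deriv_frame[OF this] show ?thesis
    by (intro exI[of _ "r s\<^sub>0 * r'"])
      (simp add: r_def power2_eq_square scaleR_add_right)
qed

lemma proj_cscale_x0: "proj q\<^sub>0 (cscale c x\<^sub>0) = Re (inverse (z' s\<^sub>0) * c) *\<^sub>R cscale (z' s\<^sub>0) x\<^sub>0"
proof -
  have "x\<^sub>0 \<bullet> x\<^sub>0 = 1" using x0 by (simp add: norm_eq_1)
  then show ?thesis
    unfolding proj_def dF_inv_def reproj_cscale by (simp add: dF_def cscale.zero_right)
qed

text \<open>The tangential part of \<open>- (z / \<bar>z\<bar>\<^sup>2) x\<^sub>0\<close> is a multiple of \<open>z' x\<^sub>0\<close>, which is already normal to the
  slice, and each of the \<open>m\<close> slice directions contributes the same.\<close>

lemma slice_mean_curvature: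
  "has_mean_curvature_in L_dom F (sphere 0 1) (slice s\<^sub>0) x\<^sub>0
    ((- (real m * Re (inverse (z' s\<^sub>0) * z s\<^sub>0) / (cmod (z s\<^sub>0))\<^sup>2)) *\<^sub>R cscale (z' s\<^sub>0) x\<^sub>0)"
    (is "has_mean_curvature_in _ _ _ _ _ ?H")
proof -
  let ?T = "image_tangent (sphere 0 1) (F \<circ> slice s\<^sub>0) x\<^sub>0"
  let ?h = "(- (Re (inverse (z' s\<^sub>0) * z s\<^sub>0) / (cmod (z s\<^sub>0))\<^sup>2)) *\<^sub>R cscale (z' s\<^sub>0) x\<^sub>0"
  have slice: "(F \<circ> slice s\<^sub>0) x = cscale (z s\<^sub>0) x" if "norm x = 1" for x
    using F_eq[OF that s0] by (simp add: slice_def)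
  have T: "?T = cscale (z s\<^sub>0) ` {w. x\<^sub>0 \<bullet> w = 0}"
    by (rule image_tangent_scaled_sphere[OF z_nz[OF s0(1)] slice x0])
  have subT: "subspace ?T"
    by (rule subspace_image_tangent_scaled_sphere[OF z_nz[OF s0(1)] slice x0])
  have "normal_part ?T (connection frame_dom (frame i) (frame i) q\<^sub>0) = ?h" if "i < m" for i
  proof -
    have "connection frame_dom (frame i) (frame i) q\<^sub>0 = ?h"
      unfolding connection_def field_deriv_frame_sphere[OF that] proj_cscale_x0
      by (simp add: divide_inverse algebra_simps)
    moreover have "normal_part ?T ?h = ?h"
      using subT by (intro normal_part_eqI) (auto simp: T inner_cscale_cscale subspace_0)
    ultimately show ?thesis by simp
  qed
  then have "?H = (\<Sum>i<m. normal_part ?T (connection frame_dom (frame i) (frame i) (slice s\<^sub>0 x\<^sub>0)))"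
    by (simp add: slice_def sum_constant_scaleR del: sum_constant)
  moreover have "openin (top_of_set L_dom) frame_dom"
    using patch_frame_dom by (simp add: patch_def)
  ultimately show ?thesis
    unfolding has_mean_curvature_in_def
    using q0_in immersion_patch[OF patch_frame_dom] levi_civita_connection[OF patch_frame_dom]
      tangent_field_frame frame_basis_slice
    by (intro exI[of _ frame_dom] exI[of _ "connection frame_dom"] exI[of _ m] exI[of _ frame])
      (auto simp: slice_def)
qed

text \<open>The \<open>n - 1\<close> sphere directions contribute \<open>- z / \<bar>z\<bar>\<^sup>2\<close> each and the curve direction
  contributes \<open>z'' / \<bar>z'\<bar>\<^sup>2\<close>, up to multiples of \<open>z'\<close>. Of a multiple \<open>c x\<^sub>0\<close> of \<open>x\<^sub>0\<close>
  the normal projection sees just the imaginary part of \<open>c / z'\<close>.\<close>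

lemma expander_mean_curvature:
  assumes z'': "(z' has_vector_derivative z'') (at s\<^sub>0)" and L: "patch L_dom"
    and eq: "Im (inverse (z' s\<^sub>0) * (inverse ((cmod (z' s\<^sub>0))\<^sup>2) *\<^sub>R z'' -
      (real m / (cmod (z s\<^sub>0))\<^sup>2 + \<alpha>) *\<^sub>R z s\<^sub>0)) = 0"
  shows "has_mean_curvature L_dom F q\<^sub>0 (\<alpha> *\<^sub>R normal_part (image_tangent L_dom F q\<^sub>0) (F q\<^sub>0))"
proof -
  let ?N = "\<lambda>V. V - proj q\<^sub>0 V"
  have N: "?N (cscale c x\<^sub>0) = 0" if "Im (inverse (z' s\<^sub>0) * c) = 0" for c
  proof -
    have "inverse (z' s\<^sub>0) * c = of_real (Re (inverse (z' s\<^sub>0) * c))"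
      using that by (simp only: complex_eq_iff Re_complex_of_real Im_complex_of_real)
    then have "c = Re (inverse (z' s\<^sub>0) * c) *\<^sub>R z' s\<^sub>0"
      using z'_nz[OF s0(1)] by (metis divide_inverse mult.commute nonzero_eq_divide_eq
          scaleR_conv_of_real)
    then show ?thesis
      unfolding proj_cscale_x0 cscale.scaleR_left[symmetric] by simp
  qed
  have Nlin: "linear ?N"
    by (intro linear_compose_sub linear_id[unfolded id_def] linear_proj)
  obtain \<rho> where \<rho>: "field_deriv frame_dom F (frame m) (frame m) q\<^sub>0 =
      cscale (inverse ((cmod (z' s\<^sub>0))\<^sup>2) *\<^sub>R z'' + \<rho> *\<^sub>R z' s\<^sub>0) x\<^sub>0"
    using field_deriv_frame_curve[OF z''] by blast
  let ?c = "inverse ((cmod (z' s\<^sub>0))\<^sup>2) *\<^sub>R z'' + \<rho> *\<^sub>R z' s\<^sub>0 -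
      (real m / (cmod (z s\<^sub>0))\<^sup>2) *\<^sub>R z s\<^sub>0"
  have "(\<Sum>i<CARD('n). normal_part (image_tangent frame_dom F q\<^sub>0)
      (field_deriv frame_dom F (frame i) (frame i) q\<^sub>0)) =
      (\<Sum>i<CARD('n). ?N (field_deriv frame_dom F (frame i) (frame i) q\<^sub>0))"
    by (simp add: normal_part_patch[OF patch_frame_dom q0_in])
  also have "\<dots> = ?N (\<Sum>i<CARD('n). field_deriv frame_dom F (frame i) (frame i) q\<^sub>0)"
    by (rule linear_sum[OF Nlin, symmetric])
  also have "(\<Sum>i<CARD('n). field_deriv frame_dom F (frame i) (frame i) q\<^sub>0) = cscale ?c x\<^sub>0"
    unfolding card by (simp add: field_deriv_frame_sphere \<rho> sum_constant_scaleR del: sum_constant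
        add: cscale.diff_left
        cscale.minus_left cscale.scaleR_left divide_inverse)
  also have "?N (cscale ?c x\<^sub>0) = ?N (\<alpha> *\<^sub>R cscale (z s\<^sub>0) x\<^sub>0)"
  proof -
    have "Im (inverse (z' s\<^sub>0) * (\<rho> *\<^sub>R z' s\<^sub>0)) = 0"
      using z'_nz[OF s0(1)] by simp
    then have "Im (inverse (z' s\<^sub>0) * (?c - \<alpha> *\<^sub>R z s\<^sub>0)) = 0"
    proof -
      have "?c - \<alpha> *\<^sub>R z s\<^sub>0 = (inverse ((cmod (z' s\<^sub>0))\<^sup>2) *\<^sub>R z'' -
          (real m / (cmod (z s\<^sub>0))\<^sup>2 + \<alpha>) *\<^sub>R z s\<^sub>0) + \<rho> *\<^sub>R z' s\<^sub>0"
        by (simp add: scaleR_left_distrib)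
      then show ?thesis
        using eq \<open>Im (inverse (z' s\<^sub>0) * (\<rho> *\<^sub>R z' s\<^sub>0)) = 0\<close>
        by (simp only: distrib_left plus_complex.sel)
    qed
    from N[OF this] have "?N (cscale ?c x\<^sub>0 - \<alpha> *\<^sub>R cscale (z s\<^sub>0) x\<^sub>0) = 0"
      by (simp only: cscale.diff_left cscale.scaleR_left)
    then show ?thesis
      unfolding linear_diff[OF Nlin] by simp
  qed
  also have "\<dots> = \<alpha> *\<^sub>R normal_part (image_tangent L_dom F q\<^sub>0) (F q\<^sub>0)"
    using q0_in unfolding linear_cmul[OF Nlin] F_eq[OF x0 s0]
    by (simp add: normal_part_patch[OF L] frame_dom_def)
  finally have "\<alpha> *\<^sub>R normal_part (image_tangent L_dom F q\<^sub>0) (F q\<^sub>0) =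
      (\<Sum>i<CARD('n). normal_part (image_tangent frame_dom F q\<^sub>0)
        (field_deriv frame_dom F (frame i) (frame i) q\<^sub>0))" by simp
  moreover have "openin (top_of_set L_dom) frame_dom"
    using patch_frame_dom by (simp add: patch_def)
  ultimately show ?thesis
    unfolding has_mean_curvature_def
    using q0_in immersion_patch[OF patch_frame_dom] tangent_field_frame frame_basis
    by (intro exI[of _ frame_dom] exI[of _ "CARD('n)"] exI[of _ frame]) auto
qed

end


section \<open>The profile curve\<close>

text \<open>On both sides of \<open>0\<close> the signed integral from \<open>0\<close> differs by a constant from an integral with a fixed
  lower limit far to the left.\<close>

lemma continuous_real_antiderivative:
  fixes f :: "real \<Rightarrow> real"
  assumes "continuous_on UNIV f"
  obtains \<Phi> where "\<Phi> 0 = 0" "\<And>t. (\<Phi> has_real_derivative f t) (at t)"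
proof -
  define \<Phi> where "\<Phi> t = integral {0..t} f - integral {t..0} f" for t
  have "(\<Phi> has_real_derivative f t) (at t)" for t :: real
  proof -
    define M where "M = \<bar>t\<bar> + 1"
    have cont: "continuous_on S f" for S
      using assms continuous_on_subset by blast
    have int: "f integrable_on {x..y}" for x y
      by (rule integrable_continuous_real[OF cont])
    have eq: "integral {-M..u} f - integral {-M..0} f = \<Phi> u" if "u \<in> {-M<..<M}" for u
    proof (cases "u \<ge> 0")
      case True
      then have "integral {-M..0} f + integral {0..u} f = integral {-M..u} f"
        using that by (intro Henstock_Kurzweil_Integration.integral_combine int) (auto simp: M_def)
      moreover have "integral {u..0} f = 0"
        using True by (cases "u = 0") auto
      ultimately show ?thesis by (simp add: \<Phi>_def)
    next
      case False
      then have "integral {-M..u} f + integral {u..0} f = integral {-M..0} f"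
        using that by (intro Henstock_Kurzweil_Integration.integral_combine int) (auto simp: M_def)
      then show ?thesis using False by (simp add: \<Phi>_def)
    qed
    have t: "t \<in> {-M<..<M}"
      by (auto simp: M_def)
    have "((\<lambda>u. integral {-M..u} f) has_real_derivative f t) (at t within {-M..M})"
      using t by (intro integral_has_real_derivative cont) auto
    then have "((\<lambda>u. integral {-M..u} f) has_real_derivative f t) (at t)"
      using t at_within_interior[of t "{-M..M}"] by (simp add: interior_atLeastAtMost_real)
    then have "((\<lambda>u. integral {-M..u} f - integral {-M..0} f) has_real_derivative f t) (at t)"
      by (auto intro!: derivative_eq_intros)
    then show ?thesis
      by (rule has_field_derivative_transform_within_open[OF _ open_greaterThanLessThan t])
        (rule eq)
  qed
  moreover have "\<Phi> 0 = 0" by (simp add: \<Phi>_def)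
  ultimately show ?thesis using that by blast
qed

text \<open>\<open>(exp x - 1) / x\<close> as a power series, which shows smoothness at \<open>0\<close>.\<close>

definition exp_quot :: "real \<Rightarrow> real" where
  "exp_quot x = (\<Sum>k. inverse (fact (Suc k)) * x ^ k)"

lemma summable_exp_quot: "summable (\<lambda>k. inverse (fact (Suc k)) * x ^ k :: real)"
proof (rule summable_comparison_test')
  show "summable (\<lambda>k. inverse (fact k) * norm x ^ k :: real)"
    by (rule summable_exp)
  show "norm (inverse (fact (Suc k)) * x ^ k) \<le> inverse (fact k) * norm x ^ k" for k
    using fact_mono[of k "Suc k", where 'a = real] fact_gt_zero[of k, where 'a = real]
    unfolding norm_mult norm_power norm_inverse
    by (intro mult_right_mono le_imp_inverse_le) auto
qed

lemma exp_quot: "x * exp_quot x = exp x - 1"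
proof -
  have "(\<lambda>k. x * (inverse (fact (Suc k)) * x ^ k)) sums (x * exp_quot x)"
    unfolding exp_quot_def by (intro sums_mult summable_sums summable_exp_quot)
  then have "(\<lambda>k. x ^ Suc k /\<^sub>R fact (Suc k)) sums (x * exp_quot x)"
    by (simp only: real_scaleR_def power_Suc mult.left_commute)
  then have "(\<lambda>k. x ^ k /\<^sub>R fact k) sums (x * exp_quot x + x ^ 0 /\<^sub>R fact 0)"
    by (rule sums_Suc)
  from sums_unique2[OF this exp_converges] show ?thesis by simp
qed

lemma exp_quot_0: "exp_quot 0 = 1"
  unfolding exp_quot_def by (simp add: powser_zero)

lemma exp_quot_nonneg: "x \<ge> 0 \<Longrightarrow> exp_quot x \<ge> 0"
  unfolding exp_quot_def by (intro suminf_nonneg summable_exp_quot) auto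

lemma Cinf_on_exp_quot: "Cinf_on W f \<Longrightarrow> Cinf_on W (\<lambda>q. exp_quot (f q))"
  using Cinf_on_compose[OF Cinf_on_powser[OF summable_exp_quot]]
  by (simp add: exp_quot_def[abs_def])

context
  fixes n :: nat and a E \<alpha> :: real
  assumes params: "n \<ge> 1" "a > 0" "E \<ge> 1" "\<alpha> \<ge> 0"
begin

definition growth :: "real \<Rightarrow> real" where
  "growth t = E * (1 + a * t\<^sup>2) ^ n * exp (\<alpha> * t\<^sup>2)"

text \<open>For \<open>E = 1\<close> this is \<open>(growth t - 1) / t\<^sup>2\<close>, continued smoothly to \<open>t = 0\<close>.\<close>

definition growth_quot :: "real \<Rightarrow> real" where
  "growth_quot t =
    a * (\<Sum>k<n. (1 + a * t\<^sup>2) ^ k) * exp (\<alpha> * t\<^sup>2) + \<alpha> * exp_quot (\<alpha> * t\<^sup>2)"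

text \<open>The integrand of the phase for \<open>t > 0\<close>. For \<open>E = 1\<close> this form cancels the factor \<open>t\<close> and is smooth and
  positive on the whole line.\<close>

definition phase_rate :: "real \<Rightarrow> real" where
  "phase_rate t = (if E = 1 then 1 / ((1 / a + t\<^sup>2) * sqrt (growth_quot t))
     else t / ((1 / a + t\<^sup>2) * sqrt (growth t - 1)))"

lemma unit_growth:
  assumes "E = 1"
  shows "growth t = (1 + a * t\<^sup>2) ^ n * exp (\<alpha> * t\<^sup>2)"
    "phase_rate t = 1 / ((1 / a + t\<^sup>2) * sqrt (growth_quot t))"
  unfolding growth_def phase_rate_def unfolding assms by simp_all

text \<open>With \<open>y = 1 + a t\<^sup>2\<close> and \<open>v = exp (\<alpha> t\<^sup>2)\<close>: \<open>y\<^sup>n v - 1 = (y\<^sup>n - 1) v + (v - 1)\<close>, where the first bracket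
  is a geometric sum times \<open>a t\<^sup>2\<close> and the second is \<open>\<alpha> t\<^sup>2\<close> times \<open>exp_quot\<close>.\<close>

lemma growth_quot: "t\<^sup>2 * growth_quot t = (1 + a * t\<^sup>2) ^ n * exp (\<alpha> * t\<^sup>2) - 1"
proof -
  let ?S = "\<Sum>k<n. (1 + a * t\<^sup>2) ^ k"
  have g: "(1 + a * t\<^sup>2) ^ n - 1 = a * t\<^sup>2 * ?S"
    using power_diff_1_eq[of "1 + a * t\<^sup>2" n] by simp
  have "t\<^sup>2 * growth_quot t = (a * t\<^sup>2 * ?S) * exp (\<alpha> * t\<^sup>2) + (\<alpha> * t\<^sup>2) * exp_quot (\<alpha> * t\<^sup>2)"
    unfolding growth_quot_def by (simp add: algebra_simps)
  also have "\<dots> = (1 + a * t\<^sup>2) ^ n * exp (\<alpha> * t\<^sup>2) - 1"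
    unfolding g[symmetric] exp_quot by (simp add: algebra_simps)
  finally show ?thesis .
qed

lemma growth_quot_pos: "growth_quot t > 0"
proof -
  have "(1 + a * t\<^sup>2) ^ 0 \<le> (\<Sum>k<n. (1 + a * t\<^sup>2) ^ k)"
    using params by (intro member_le_sum) auto
  then have "a * (\<Sum>k<n. (1 + a * t\<^sup>2) ^ k) * exp (\<alpha> * t\<^sup>2) > 0"
    using params by (intro mult_pos_pos) auto
  moreover have "\<alpha> * exp_quot (\<alpha> * t\<^sup>2) \<ge> 0"
    using params by (intro mult_nonneg_nonneg exp_quot_nonneg) auto
  ultimately show ?thesis
    unfolding growth_quot_def by linarith
qed

lemma growth_quot_0: "growth_quot 0 = real n * a + \<alpha>"
  by (simp add: growth_quot_def exp_quot_0)

lemma growth_ge: "growth t \<ge> E"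
proof -
  have "1 * 1 \<le> (1 + a * t\<^sup>2) ^ n * exp (\<alpha> * t\<^sup>2)"
    using params by (intro mult_mono one_le_power) auto
  then show ?thesis
    unfolding growth_def using params mult_left_mono[of 1 _ E] by (simp add: mult.assoc)
qed

lemma growth_gt_1: "t > 0 \<Longrightarrow> growth t > 1"
proof -
  assume t: "t > 0"
  have "t\<^sup>2 * growth_quot t > 0"
    using t growth_quot_pos by simp
  then have "1 < (1 + a * t\<^sup>2) ^ n * exp (\<alpha> * t\<^sup>2)"
    by (simp add: growth_quot)
  then have "E * 1 < growth t"
    unfolding growth_def mult.assoc using params by (intro mult_strict_left_mono) auto
  then show ?thesis
    using params by simp
qed

lemma radius_pos: "1 / a + t\<^sup>2 > 0"
  using params by (intro add_pos_nonneg) auto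

lemma phase_rate_eq:
  assumes "t > 0"
  shows "phase_rate t = t / ((1 / a + t\<^sup>2) * sqrt (growth t - 1))"
proof (cases "E = 1")
  case True
  have "growth t - 1 = t\<^sup>2 * growth_quot t"
    by (simp only: growth_quot unit_growth(1)[OF True])
  then have "sqrt (growth t - 1) = t * sqrt (growth_quot t)"
    using assms by (simp add: real_sqrt_mult)
  then show ?thesis
    unfolding unit_growth(2)[OF True] using assms by simp
qed (simp add: phase_rate_def)

lemma Cinf_on_growth: "Cinf_on UNIV growth" "Cinf_on UNIV growth_quot"
  unfolding growth_def[abs_def] growth_quot_def[abs_def]
  by (intro Cinf_intros Cinf_on_exp_quot open_UNIV)+

lemma Cinf_on_phase_rate: "Cinf_on UNIV phase_rate"
proof (cases "E = 1")
  case True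
  have "(1 / a + t\<^sup>2) * sqrt (growth_quot t) \<noteq> 0" for t
    using growth_quot_pos[of t] radius_pos[of t] by auto
  then show ?thesis
    unfolding phase_rate_def[abs_def] using True growth_quot_pos
    by (simp only: if_True simp_thms) (intro Cinf_intros Cinf_on_growth open_UNIV; simp)
next
  case False
  then have "growth t - 1 > 0" for t
    using growth_ge[of t] params by linarith
  moreover from this have "(1 / a + t\<^sup>2) * sqrt (growth t - 1) \<noteq> 0" for t
    using radius_pos[of t] by (metis less_irrefl mult_eq_0_iff real_sqrt_eq_zero_cancel_iff)
  ultimately show ?thesis
    unfolding phase_rate_def[abs_def] using False
    by (simp only: if_False simp_thms) (intro Cinf_intros Cinf_on_growth open_UNIV; simp)
qed

text \<open>The integral that defines \<open>phase\<close> is \<open>0\<close> for negative \<open>s\<close>, so \<open>phase\<close> itself has a corner at \<open>0\<close> when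
  \<open>E = 1\<close>. The antiderivative \<open>\<Phi>\<close> is its smooth continuation.\<close>

lemma phase_antiderivative:
  obtains \<Phi> where "\<And>t. (\<Phi> has_real_derivative phase_rate t) (at t)"
    "\<And>s. s \<ge> 0 \<Longrightarrow> \<Phi> s = phase n a E \<alpha> s"
proof -
  obtain \<Phi> where \<Phi>: "\<Phi> 0 = 0" "\<And>t. (\<Phi> has_real_derivative phase_rate t) (at t)"
    using continuous_real_antiderivative[OF Cinf_on_continuous_on[OF Cinf_on_phase_rate]] by blast
  have "\<Phi> s = phase n a E \<alpha> s" if "s \<ge> 0" for s
  proof -
    have "(phase_rate has_integral \<Phi> s - \<Phi> 0) {0..s}"
      using that \<Phi>(2) by (intro fundamental_theorem_of_calculus)
        (auto simp: has_real_derivative_iff_has_vector_derivative[symmetric]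
          intro: has_field_derivative_at_within)
    then have "\<Phi> s = integral {0..s} phase_rate"
      using \<Phi>(1) by (simp add: integral_unique)
    also have "\<dots> = phase n a E \<alpha> s"
      unfolding phase_def
      by (rule integral_spike[of "{0}"]) (auto simp: phase_rate_eq growth_def)
    finally show ?thesis .
  qed
  with \<Phi>(2) show ?thesis by (rule that)
qed

text \<open>\<open>z' = (r' + i r \<phi>') e\<^sup>i\<^sup>\<phi>\<close>, where \<open>r' = s / r\<close>.\<close>

definition profile_velocity :: "(real \<Rightarrow> real) \<Rightarrow> real \<Rightarrow> complex" where
  "profile_velocity \<Phi> s =
    Complex (s / radius a s) (radius a s * phase_rate s) * exp (\<i> * complex_of_real (\<Phi> s))"

lemma radius_gt_0: "radius a s > 0"
  unfolding radius_def using radius_pos by simp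

lemma radius_sq: "(radius a s)\<^sup>2 = 1 / a + s\<^sup>2"
  unfolding radius_def using radius_pos[of s] by simp

lemma radius_deriv: "(radius a has_real_derivative s / radius a s) (at s)"
proof -
  have "((\<lambda>s. sqrt (1 / a + s\<^sup>2)) has_real_derivative s / sqrt (1 / a + s\<^sup>2)) (at s)"
    using radius_pos[of s] by (auto intro!: derivative_eq_intros simp: field_simps)
  then show ?thesis
    by (simp add: radius_def[abs_def])
qed

lemma Cinf_on_radius: "Cinf_on UNIV (radius a)"
  unfolding radius_def[abs_def] using radius_pos by (intro Cinf_intros open_UNIV) auto

lemma phase_exp_deriv:
  assumes "(\<Phi> has_real_derivative d) (at s)"
  shows "((\<lambda>s. exp (\<i> * complex_of_real (\<Phi> s))) has_vector_derivative
    \<i> * d * exp (\<i> * complex_of_real (\<Phi> s))) (at s)"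
proof -
  have "((\<lambda>s. \<i> * complex_of_real (\<Phi> s)) has_vector_derivative \<i> * d) (at s)"
    using assms by (intro has_vector_derivative_mult_right has_vector_derivative_of_real)
      (simp add: has_real_derivative_iff_has_vector_derivative)
  from field_vector_diff_chain_at[OF this DERIV_exp] show ?thesis
    by (simp add: o_def mult.commute)
qed

lemma profile_deriv:
  assumes "\<And>t. (\<Phi> has_real_derivative phase_rate t) (at t)"
  shows "((\<lambda>s. complex_of_real (radius a s) * exp (\<i> * complex_of_real (\<Phi> s)))
    has_vector_derivative profile_velocity \<Phi> s) (at s)"
proof -
  have "((\<lambda>s. complex_of_real (radius a s)) has_vector_derivative complex_of_real (s / radius a s)) (at s)"
    using radius_deriv by (intro has_vector_derivative_of_real)
      (simp add: has_real_derivative_iff_has_vector_derivative)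
  from has_vector_derivative_mult[OF this phase_exp_deriv[OF assms]]
  show ?thesis
    by (rule has_vector_derivative_eq_rhs)
      (simp add: profile_velocity_def Complex_eq algebra_simps)
qed

lemma Cinf_on_profile:
  assumes "\<And>t. (\<Phi> has_real_derivative phase_rate t) (at t)"
  shows "Cinf_on UNIV (\<lambda>s. complex_of_real (radius a s) * exp (\<i> * complex_of_real (\<Phi> s)))"
proof -
  have "Cinf_on UNIV \<Phi>"
    using assms by (intro Cinf_on_antiderivative[OF Cinf_on_phase_rate])
      (simp add: has_real_derivative_iff_has_vector_derivative)
  then show ?thesis
    by (intro Cinf_intros Cinf_on_radius open_UNIV)
qed

lemma phase_rate_pos: "t > 0 \<or> E = 1 \<Longrightarrow> phase_rate t > 0"
proof (cases "E = 1")
  case True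
  then show ?thesis
    unfolding phase_rate_def using radius_pos[of t] growth_quot_pos[of t]
    by (simp del: zero_less_divide_iff)
next
  case False
  assume "t > 0 \<or> E = 1"
  with False have t: "t > 0" by simp
  then show ?thesis
    unfolding phase_rate_eq[OF t] using radius_pos[of t] growth_gt_1[OF t]
    by (intro divide_pos_pos mult_pos_pos) auto
qed

lemma profile_velocity_nz:
  assumes "s > 0 \<or> E = 1"
  shows "profile_velocity \<Phi> s \<noteq> 0"
proof -
  have "radius a s * phase_rate s > 0"
    using assms radius_gt_0 phase_rate_pos by simp
  then show ?thesis
    by (auto simp: profile_velocity_def Complex_eq_0)
qed

lemma profile_angle:
  "Re (inverse (profile_velocity \<Phi> s) *
      (complex_of_real (radius a s) * exp (\<i> * complex_of_real (\<Phi> s)))) =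
    s / ((s / radius a s)\<^sup>2 + (radius a s * phase_rate s)\<^sup>2)"
proof -
  let ?e = "exp (\<i> * complex_of_real (\<Phi> s))" and ?c = "Complex (s / radius a s) (radius a s * phase_rate s)"
  have eq: "inverse (profile_velocity \<Phi> s) * (complex_of_real (radius a s) * ?e) =
      inverse ?c * complex_of_real (radius a s)"
    by (simp add: profile_velocity_def)
  show ?thesis
    unfolding eq using radius_gt_0[of s] by simp
qed

text \<open>Since \<open>r \<phi>' = (s / r) / sqrt (G - 1)\<close> for \<open>G = growth s\<close>, one has \<open>\<bar>z'\<bar>\<^sup>2 = (s / r)\<^sup>2 G / (G - 1)\<close>.\<close>

lemma flow_speed:
  assumes "s > 0"
  shows "Re (inverse (profile_velocity \<Phi> s) *
      (complex_of_real (radius a s) * exp (\<i> * complex_of_real (\<Phi> s)))) / (radius a s)\<^sup>2 =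
    (E * (1 + a * s\<^sup>2) ^ n - exp (- \<alpha> * s\<^sup>2)) / (E * s * (1 + a * s\<^sup>2) ^ n)"
proof -
  define r where "r = radius a s"
  have r: "r > 0" "1 / a + s\<^sup>2 = r\<^sup>2"
    using radius_gt_0 radius_sq by (simp_all add: r_def)
  define G where "G = growth s"
  have G: "G > 1"
    using growth_gt_1[OF assms] by (simp add: G_def)
  have "(r * phase_rate s)\<^sup>2 = (s / r)\<^sup>2 / (G - 1)"
    unfolding phase_rate_eq[OF assms] r(2) G_def[symmetric] using r(1) G
    by (simp add: power_divide power_mult_distrib real_sqrt_pow2 field_simps power2_eq_square)
  moreover have "k + k / (G - 1) = k * (G / (G - 1))" for k
    using G by (simp add: field_simps)
  ultimately have eq: "(s / r)\<^sup>2 + (r * phase_rate s)\<^sup>2 = (s / r)\<^sup>2 * (G / (G - 1))"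
    by (simp only:)
  have "s / ((s / r)\<^sup>2 + (r * phase_rate s)\<^sup>2) / r\<^sup>2 = (G - 1) / (s * G)"
    unfolding eq using assms r(1) G by (simp add: field_simps power2_eq_square)
  also have "\<dots> = (E * (1 + a * s\<^sup>2) ^ n - exp (- \<alpha> * s\<^sup>2)) / (E * s * (1 + a * s\<^sup>2) ^ n)"
  proof -
    define A where "A = E * (1 + a * s\<^sup>2) ^ n"
    have "A > 0"
      unfolding A_def using params by (intro mult_pos_pos zero_less_power) (auto intro: add_pos_nonneg)
    have eq: "G = A * exp (\<alpha> * s\<^sup>2)" "exp (- \<alpha> * s\<^sup>2) = 1 / exp (\<alpha> * s\<^sup>2)"
      "E * s * (1 + a * s\<^sup>2) ^ n = s * A"
      by (simp_all add: G_def growth_def A_def exp_minus inverse_eq_divide)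
    have "(A * B - 1) / (s * (A * B)) = (A - 1 / B) / (s * A)" if "B > 0" for B
      using that \<open>A > 0\<close> assms by (simp add: field_simps)
    then show ?thesis
      unfolding eq A_def[symmetric] by simp
  qed
  finally show ?thesis
    unfolding r_def profile_angle .
qed

text \<open>The angle from the position \<open>z\<close> to the velocity \<open>z'\<close> has cotangent \<open>u = s sqrt (growth_quot s)\<close>,
  and \<open>1 + u\<^sup>2\<close> is \<open>growth\<close>. Differentiating this identity and dividing by \<open>2 u\<close> gives \<open>u'\<close>, except at
  \<open>s = 0\<close>, where \<open>u' = sqrt (growth_quot 0)\<close> is immediate.\<close>

lemma cotangent_deriv:
  assumes E: "E = 1"
  shows "((\<lambda>s. s * sqrt (growth_quot s)) has_real_derivative
    (1 + (s * sqrt (growth_quot s))\<^sup>2) * phase_rate s * (real n + \<alpha> * (radius a s)\<^sup>2)) (at s)"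
proof -
  define Q where "Q t = sqrt (growth_quot t)" for t
  have Q: "Q t > 0" for t
    using growth_quot_pos by (simp add: Q_def)
  have "Cinf_on UNIV Q"
    unfolding Q_def[abs_def] using growth_quot_pos by (intro Cinf_intros Cinf_on_growth)
  then have "Q differentiable (at s)"
    by (intro Cinf_on_differentiable) auto
  then obtain Q' where Q': "(Q has_real_derivative Q') (at s)"
    using real_differentiable_def by blast
  have d: "((\<lambda>s. s * Q s) has_real_derivative Q s + s * Q') (at s)"
    by (rule DERIV_cong[OF DERIV_mult[OF DERIV_ident Q']]) simp
  have sq: "(t * Q t)\<^sup>2 = (1 + a * t\<^sup>2) ^ n * exp (\<alpha> * t\<^sup>2) - 1" for t
    unfolding power_mult_distrib growth_quot[symmetric] using growth_quot_pos[of t]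
    by (simp add: Q_def)
  have rate: "phase_rate s = 1 / ((1 / a + s\<^sup>2) * Q s)"
    by (simp only: unit_growth(2)[OF E] Q_def)
  have "Q s + s * Q' = (1 + (s * Q s)\<^sup>2) * phase_rate s * (real n + \<alpha> * (radius a s)\<^sup>2)"
  proof (cases "s = 0")
    case True
    have "Q 0 * Q 0 = real n * a + \<alpha>"
      using growth_quot_pos[of 0] by (simp add: Q_def growth_quot_0)
    then show ?thesis
      unfolding rate radius_sq unfolding True using Q[of 0] params by (simp add: field_simps)
  next
    case False
    let ?P = "(1 + a * s\<^sup>2) ^ n * exp (\<alpha> * s\<^sup>2)"
    have "((\<lambda>s. (s * Q s)\<^sup>2) has_real_derivative 2 * (s * Q s) * (Q s + s * Q')) (at s)"
      by (rule DERIV_cong[OF DERIV_power[OF d]]) simp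
    moreover have "((\<lambda>s. (1 + a * s\<^sup>2) ^ n * exp (\<alpha> * s\<^sup>2) - 1) has_real_derivative
        (real n * (1 + a * s\<^sup>2) ^ (n - 1) * (2 * a * s)) * exp (\<alpha> * s\<^sup>2) +
        (1 + a * s\<^sup>2) ^ n * (exp (\<alpha> * s\<^sup>2) * (2 * \<alpha> * s))) (at s)"
      by (auto intro!: derivative_eq_intros)
    ultimately have "2 * (s * Q s) * (Q s + s * Q') =
        (real n * (1 + a * s\<^sup>2) ^ (n - 1) * (2 * a * s)) * exp (\<alpha> * s\<^sup>2) +
        (1 + a * s\<^sup>2) ^ n * (exp (\<alpha> * s\<^sup>2) * (2 * \<alpha> * s))"
      unfolding sq by (rule DERIV_unique)
    also have "(1 + a * s\<^sup>2) ^ (n - 1) = (1 + a * s\<^sup>2) ^ n / (1 + a * s\<^sup>2)"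
    proof -
      have "1 + a * s\<^sup>2 \<noteq> 0"
        using params by (smt (verit) zero_le_power2 mult_nonneg_nonneg)
      then show ?thesis
        using params(1) power_minus_mult[of n "1 + a * s\<^sup>2"] by (simp add: field_simps)
    qed
    also have "real n * ((1 + a * s\<^sup>2) ^ n / (1 + a * s\<^sup>2)) * (2 * a * s) * exp (\<alpha> * s\<^sup>2) +
        (1 + a * s\<^sup>2) ^ n * (exp (\<alpha> * s\<^sup>2) * (2 * \<alpha> * s)) =
        2 * s * (?P * (real n / (1 / a + s\<^sup>2) + \<alpha>))"
    proof -
      have "real n * ((1 + a * s\<^sup>2) ^ n / (1 + a * s\<^sup>2)) * (2 * a * s) =
          2 * s * (1 + a * s\<^sup>2) ^ n * real n * (a / (1 + a * s\<^sup>2))"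
        by simp
      also have "a / (1 + a * s\<^sup>2) = 1 / (1 / a + s\<^sup>2)"
        using params radius_pos[of s] by (simp add: field_simps)
      finally show ?thesis
        by (simp add: algebra_simps)
    qed
    finally have "Q s * (Q s + s * Q') = ?P * (real n / (1 / a + s\<^sup>2) + \<alpha>)"
      using False by simp
    moreover have "p * (real n / R + \<alpha>) = Q s * (p * (1 / (R * Q s)) * (real n + \<alpha> * R))"
      if "R > 0" for p R
      using that Q[of s] by (simp add: field_simps)
    from this[OF radius_pos] have "?P * (real n / (1 / a + s\<^sup>2) + \<alpha>) =
        Q s * ((1 + (s * Q s)\<^sup>2) * phase_rate s * (real n + \<alpha> * (radius a s)\<^sup>2))"
      unfolding sq rate radius_sq by simp
    ultimately have "Q s * (Q s + s * Q') =
        Q s * ((1 + (s * Q s)\<^sup>2) * phase_rate s * (real n + \<alpha> * (radius a s)\<^sup>2))" by (simp only:)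
    then show ?thesis
      using Q[of s] by simp
  qed
  then show ?thesis
    using d by (simp add: Q_def)
qed

text \<open>In the form \<open>z' = w (u + i) e\<^sup>i\<^sup>\<phi>\<close> with \<open>w = r \<phi>'\<close> one reads off
  \<open>z'' / z' = w' / w + u' / (u + i) + i \<phi>'\<close>, whose imaginary part is \<open>\<phi>' - u' / (1 + u\<^sup>2)\<close>. By
  \<open>cotangent_deriv\<close> this equals \<open>- \<phi>' (m + \<alpha> r\<^sup>2)\<close>.\<close>

lemma expander_equation:
  assumes E: "E = 1" and \<Phi>: "\<And>t. (\<Phi> has_real_derivative phase_rate t) (at t)" and n: "n = Suc m"
  obtains z'' where "(profile_velocity \<Phi> has_vector_derivative z'') (at s)"
    "Im (inverse (profile_velocity \<Phi> s) * (inverse ((cmod (profile_velocity \<Phi> s))\<^sup>2) *\<^sub>R z'' -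
      (real m / (cmod (complex_of_real (radius a s) * exp (\<i> * complex_of_real (\<Phi> s))))\<^sup>2 + \<alpha>) *\<^sub>R
      (complex_of_real (radius a s) * exp (\<i> * complex_of_real (\<Phi> s))))) = 0"
proof -
  define w where "w t = radius a t * phase_rate t" for t
  define u where "u t = t * sqrt (growth_quot t)" for t
  define e where "e = exp (\<i> * complex_of_real (\<Phi> s))"
  define r where "r = radius a s"
  define \<rho> where "\<rho> = phase_rate s"
  define u' where "u' = (1 + (u s)\<^sup>2) * \<rho> * (real n + \<alpha> * r\<^sup>2)"
  have r: "r > 0" and \<rho>: "\<rho> > 0" and ws: "w s = r * \<rho>"
    using radius_gt_0 phase_rate_pos E by (simp_all add: r_def \<rho>_def w_def)
  have "t / radius a t = u t * w t" for t
  proof -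
    have "phase_rate t = 1 / ((radius a t)\<^sup>2 * sqrt (growth_quot t))"
      by (simp only: unit_growth(2)[OF E] radius_sq)
    then show ?thesis
      using radius_gt_0[of t] growth_quot_pos[of t]
      by (simp add: u_def w_def field_simps power2_eq_square)
  qed
  then have vel: "profile_velocity \<Phi> =
      (\<lambda>t. complex_of_real (w t) * (complex_of_real (u t) + \<i>) * exp (\<i> * complex_of_real (\<Phi> t)))"
    by (auto simp: profile_velocity_def w_def Complex_eq fun_eq_iff algebra_simps)
  have "Cinf_on UNIV w"
    unfolding w_def[abs_def] by (intro Cinf_intros Cinf_on_radius Cinf_on_phase_rate)
  then obtain w' where w': "(w has_real_derivative w') (at s)"
    using Cinf_on_differentiable real_differentiable_def by blast
  have du: "(u has_real_derivative u') (at s)"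
    using cotangent_deriv[OF E, of s] by (simp add: u_def[abs_def] u'_def \<rho>_def r_def)
  have of_real_deriv: "((\<lambda>t. complex_of_real (g t)) has_vector_derivative complex_of_real g') (at s)"
    if "(g has_real_derivative g') (at s)" for g g'
    using that by (intro has_vector_derivative_of_real)
      (simp add: has_real_derivative_iff_has_vector_derivative)
  let ?z'' = "((w' * (u s + \<i>) + w s * u') + \<i> * \<rho> * w s * (u s + \<i>)) * e"
  have "(profile_velocity \<Phi> has_vector_derivative ?z'') (at s)"
    unfolding vel
    by (rule has_vector_derivative_eq_rhs,
        rule has_vector_derivative_mult[OF has_vector_derivative_mult[OF of_real_deriv[OF w']
          has_vector_derivative_add[OF of_real_deriv[OF du] has_vector_derivative_const]]
          phase_exp_deriv[OF \<Phi>]])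
      (simp add: e_def \<rho>_def algebra_simps)
  moreover have "Im (inverse (profile_velocity \<Phi> s) * (inverse ((cmod (profile_velocity \<Phi> s))\<^sup>2) *\<^sub>R ?z'' -
      (real m / (cmod (complex_of_real r * e))\<^sup>2 + \<alpha>) *\<^sub>R (complex_of_real r * e))) = 0"
  proof -
    define v where "v = complex_of_real (u s) + \<i>"
    have v: "v \<noteq> 0" "Im (inverse v) = - inverse (1 + (u s)\<^sup>2)"
      by (simp_all add: v_def complex_eq_iff divide_inverse add.commute)
    have e: "e \<noteq> 0" "cmod e = 1"
      by (simp_all add: e_def)
    have vs: "profile_velocity \<Phi> s = w s * v * e"
      by (simp add: vel v_def e_def)
    have cv: "(cmod (profile_velocity \<Phi> s))\<^sup>2 = (w s)\<^sup>2 * (1 + (u s)\<^sup>2)"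
      unfolding vs norm_mult e power_mult_distrib by (simp add: v_def cmod_power2)
    have wnz: "w s \<noteq> 0" using ws r \<rho> by simp
    have 1: "inverse (profile_velocity \<Phi> s) * ?z'' = w' / w s + u' * inverse v + \<i> * \<rho>"
      unfolding vs v_def[symmetric] using v(1) e(1) wnz by (simp add: field_simps)
    have 2: "inverse (profile_velocity \<Phi> s) * (complex_of_real r * e) = (r / w s) * inverse v"
      unfolding vs using v(1) e(1) wnz by (simp add: field_simps)
    have 3: "cmod (complex_of_real r * e) = r"
      using r by (simp add: norm_mult e)
    have "Im (inverse (profile_velocity \<Phi> s) * (inverse ((cmod (profile_velocity \<Phi> s))\<^sup>2) *\<^sub>R ?z'' -
        (real m / (cmod (complex_of_real r * e))\<^sup>2 + \<alpha>) *\<^sub>R (complex_of_real r * e))) =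
        inverse ((w s)\<^sup>2 * (1 + (u s)\<^sup>2)) * Im (w' / w s + u' * inverse v + \<i> * \<rho>) -
        (real m / r\<^sup>2 + \<alpha>) * Im ((r / w s) * inverse v)"
      unfolding right_diff_distrib mult_scaleR_right 1 2 3 cv by simp
    also have "\<dots> = 0"
    proof -
      define k where "k = 1 + (u s)\<^sup>2"
      have k: "k > 0"
        by (simp add: k_def add_pos_nonneg)
      have "Im (w' / w s + u' * y + \<i> * \<rho>) = u' * Im y + \<rho>" "Im ((r / w s) * y) = r / w s * Im y"
        for y :: complex
        by simp_all
      note Im = this[of "inverse v", unfolded v(2)]
      have eq1: "Im (w' / w s + u' * inverse v + \<i> * \<rho>) = - (\<rho> * (real m + \<alpha> * r\<^sup>2))"
      proof -
        have "u' * - inverse (1 + (u s)\<^sup>2) = - (\<rho> * (real n + \<alpha> * r\<^sup>2))"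
          using k by (simp add: u'_def k_def[symmetric])
        then show ?thesis
          unfolding Im by (simp add: n algebra_simps)
      qed
      have eq2: "Im ((r / w s) * inverse v) = - (inverse k / \<rho>)"
        unfolding Im using r by (simp add: ws k_def divide_inverse)
      show ?thesis
        unfolding eq1 eq2 unfolding k_def[symmetric] ws using r \<rho> k by (simp add: field_simps power2_eq_square)
    qed
    finally show ?thesis .
  qed
  ultimately show ?thesis
    unfolding e_def r_def by (rule that)
qed

end


section \<open>The curvature statements for the spun curve\<close>

lemma symplectic_form_add_left: "symplectic_form (u + v) w = symplectic_form u w + symplectic_form v w"
  by (simp add: symplectic_form_def algebra_simps flip: sum.distrib)

lemma symplectic_form_add_right: "symplectic_form u (v + w) = symplectic_form u v + symplectic_form u w"
  by (simp add: symplectic_form_def algebra_simps flip: sum.distrib)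

context spun_curve
begin

lemma exists_frame:
  assumes "norm x = 1" "s \<in> J" "s \<ge> 0"
  obtains m b where "CARD('n) = Suc m" "spun_curve_frame J z z' F x s m b"
proof -
  obtain m where m: "CARD('n) = Suc m"
    using zero_less_card_finite[where 'a = 'n] gr0_conv_Suc by blast
  have "dim {w. x \<bullet> w = 0} = m"
    using assms(1) m by (subst dim_hyperplane) auto
  then obtain b where "orthonormal_basis_of {w. x \<bullet> w = 0} m b"
    using obtain_orthonormal_basis[OF subspace_hyperplane[of x]] by metis
  then show ?thesis
    using assms m by (intro that[OF m] spun_curve_frame.intro spun_curve_axioms
        spun_curve_frame_axioms.intro)
qed

lemma F_slice: "norm x = 1 \<Longrightarrow> s \<in> J \<Longrightarrow> s \<ge> 0 \<Longrightarrow> (F \<circ> slice s) x = cscale (z s) x"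
  by (simp add: slice_def F_eq)

lemma immersed_in_slice:
  assumes s: "s \<in> J" "s \<ge> 0"
  shows "immersed_in L_dom F (sphere 0 1) (slice s)"
  unfolding immersed_in_def
proof (intro conjI)
  show "slice s ` sphere 0 1 \<subseteq> (L_dom :: ((real ^ 'n) \<times> real) set)"
    using s by (auto simp: slice_def L_dom_def)
  have "Cinf_on UNIV (\<lambda>x :: real ^ 'n. (x, s))"
    by (intro Cinf_intros open_UNIV)
  then show "smooth_on (sphere 0 1) (slice s :: real ^ 'n \<Rightarrow> _)"
    by (rule smooth_on_Cinf) (auto simp: slice_def)
  show "immersion (sphere 0 1) (F \<circ> slice s)"
    by (rule immersion_scaled_sphere[OF z_nz[OF s(1)] F_slice[OF _ s]])
qed

lemma slice_mean_curvature_at: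
  assumes "norm x = 1" "s \<in> J" "s \<ge> 0"
  shows "has_mean_curvature_in L_dom F (sphere 0 1) (slice s) x
    ((- ((real CARD('n) - 1) * (Re (inverse (z' s) * z s) / (cmod (z s))\<^sup>2))) *\<^sub>R cscale (z' s) x)"
proof -
  obtain m b where m: "CARD('n) = Suc m" and "spun_curve_frame J z z' F x s m b"
    using exists_frame[OF assms] by blast
  then interpret spun_curve_frame J z z' F x s m b by blast
  show ?thesis
    using slice_mean_curvature by (simp add: m)
qed

lemma lagrangian_L:
  assumes L: "patch L_dom"
  shows "lagrangian L_dom F"
  unfolding lagrangian_def
proof (intro conjI ballI)
  show "immersion L_dom F"
    by (rule immersion_patch[OF L])
  fix q :: "(real ^ 'n) \<times> real" assume q: "q \<in> L_dom"
  note D = patchD[OF L q]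
  obtain m b where "spun_curve_frame J z z' F (fst q) (snd q) m b"
    using exists_frame[OF D(3,5,6)] by blast
  then interpret spun_curve_frame J z z' F "fst q" "snd q" m b .
  have "dim (image_tangent frame_dom F q) = CARD('n)"
    using orthonormal_basis_of_dim[OF frame_basis[OF q0_in]] by simp
  then show "dim (image_tangent L_dom F q) = CARD('n)"
    using q0_in image_tangent_patch[OF L q] image_tangent_patch[OF patch_frame_dom] by simp
  fix v w assume "v \<in> image_tangent L_dom F q" "w \<in> image_tangent L_dom F q"
  then obtain v' w' where v: "v = dF q v'" "v' \<in> tang q" and w: "w = dF q w'" "w' \<in> tang q"
    unfolding image_tangent_patch[OF L q] by blast
  show "symplectic_form v w = 0"
    using v(2) w(2) unfolding v(1) w(1) dF_def tang_def cscale.scaleR_left[symmetric]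
    by (simp add: symplectic_form_add_left symplectic_form_add_right symplectic_form_cscale
        inner_commute)
qed

lemma expander_L:
  assumes L: "patch L_dom" and n: "CARD('n) = Suc m"
    and z'': "\<And>s. s \<ge> 0 \<Longrightarrow> \<exists>z''. (z' has_vector_derivative z'') (at s) \<and>
      Im (inverse (z' s) * (inverse ((cmod (z' s))\<^sup>2) *\<^sub>R z'' -
        (real m / (cmod (z s))\<^sup>2 + \<alpha>) *\<^sub>R z s)) = 0"
  shows "lagrangian_self_expander \<alpha> L_dom F"
  unfolding lagrangian_self_expander_def
proof (intro conjI ballI lagrangian_L[OF L])
  fix q :: "(real ^ 'n) \<times> real" assume q: "q \<in> L_dom"
  note D = patchD[OF L q]
  obtain m' b where m': "CARD('n) = Suc m'" and "spun_curve_frame J z z' F (fst q) (snd q) m' b"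
    using exists_frame[OF D(3,5,6)] by blast
  then interpret spun_curve_frame J z z' F "fst q" "snd q" m b
    using n by simp
  obtain z'' where z'': "(z' has_vector_derivative z'') (at (snd q))"
    "Im (inverse (z' (snd q)) * (inverse ((cmod (z' (snd q)))\<^sup>2) *\<^sub>R z'' -
        (real m / (cmod (z (snd q)))\<^sup>2 + \<alpha>) *\<^sub>R z (snd q))) = 0"
    using z'' D(6) by blast
  show "has_mean_curvature L_dom F q (\<alpha> *\<^sub>R normal_part (image_tangent L_dom F q) (F q))"
    using expander_mean_curvature[OF z''(1) L z''(2)] by simp
qed

lemma minimal_slice:
  assumes L: "patch L_dom" and s: "s \<ge> 0" "Re (inverse (z' s) * z s) = 0"
  shows "minimal_hypersurface_in L_dom F (sphere 0 1) (slice s)"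
  unfolding minimal_hypersurface_in_def
proof (intro conjI ballI)
  have sJ: "s \<in> J"
  proof -
    obtain x :: "real ^ 'n" where "norm x = 1"
      using vector_choose_size[of 1] by auto
    then show ?thesis
      using s patchD(5)[OF L, of "(x, s)"] by (simp add: L_dom_def)
  qed
  show "immersed_in L_dom F (sphere 0 1) (slice s)"
    by (rule immersed_in_slice[OF sJ s(1)])
  fix x :: "real ^ 'n" assume "x \<in> sphere 0 1"
  then have x: "norm x = 1" and q: "slice s x \<in> L_dom"
    using s(1) by (simp_all add: slice_def L_dom_def)
  have "dim (image_tangent L_dom F (slice s x)) = CARD('n)"
    using lagrangian_L[OF L] q by (simp add: lagrangian_def)
  moreover have "dim (image_tangent (sphere 0 1) (F \<circ> slice s) x) = CARD('n) - 1"
    by (rule dim_image_tangent_scaled_sphere[OF z_nz[OF sJ] F_slice[OF _ sJ s(1)] x])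
  ultimately show "dim (image_tangent L_dom F (slice s x)) =
      dim (image_tangent (sphere 0 1) (F \<circ> slice s) x) + 1"
    by simp
  show "has_mean_curvature_in L_dom F (sphere 0 1) (slice s) x 0"
    using slice_mean_curvature_at[OF x sJ s(1)] s(2) by simp
qed

end

text \<open>For \<open>E > 1\<close> the velocity of the curve vanishes at \<open>s = 0\<close>; hence the condition on \<open>J\<close>.\<close>

lemma spun_curve_L_map:
  fixes F :: "(real ^ 'n) \<times> real \<Rightarrow> complex ^ 'n"
  defines "n \<equiv> CARD('n)"
  assumes params: "a > 0" "E \<ge> 1" "\<alpha> \<ge> 0" and F: "F = L_map a E \<alpha>"
    and \<Phi>: "\<And>t. (\<Phi> has_real_derivative phase_rate n a E \<alpha> t) (at t)"
      "\<And>s. s \<ge> 0 \<Longrightarrow> \<Phi> s = phase n a E \<alpha> s"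
    and J: "open J" "\<And>s. s \<in> J \<Longrightarrow> s > 0 \<or> E = 1"
  shows "spun_curve J (\<lambda>s. complex_of_real (radius a s) * exp (\<i> * complex_of_real (\<Phi> s)))
    (profile_velocity n a E \<alpha> \<Phi>) F"
proof
  have n: "1 \<le> n"
    by (simp add: n_def Suc_le_eq)
  note p = n params
  let ?z = "\<lambda>s. complex_of_real (radius a s) * exp (\<i> * complex_of_real (\<Phi> s))"
  show "Cinf_on J ?z"
    by (rule Cinf_on_subset[OF Cinf_on_profile[OF p \<Phi>(1)] J(1)]) auto
  show "(?z has_vector_derivative profile_velocity n a E \<alpha> \<Phi> s) (at s)" for s
    by (rule profile_deriv[OF p \<Phi>(1)])
  show "?z s \<noteq> 0" for s
    using radius_gt_0[OF p, of s] by simp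
  show "profile_velocity n a E \<alpha> \<Phi> s \<noteq> 0" if "s \<in> J" for s
    by (rule profile_velocity_nz[OF p J(2)[OF that]])
  show "F (x, s) = cscale (?z s) x" if "0 \<le> s" for x s
    using \<Phi>(2)[OF that] by (simp add: F L_map_def cscale_def n_def vec_eq_iff)
qed


section \<open>The initial-value problem\<close>

text \<open>In the coordinate \<open>w = ln f\<close> the equation separates: \<open>T (ln f) = T (ln s\<^sub>0) - t\<close>, where
  \<open>T' = \<kappa>\<close>. The lower bound on \<open>\<kappa>\<close> makes \<open>T\<close> a bijection of the line, so that the solution
  exists for all times and \<open>ln f\<close> tends to \<open>- \<infinity>\<close>.\<close>

lemma decaying_flow:
  fixes \<kappa> :: "real \<Rightarrow> real"
  assumes \<kappa>: "continuous_on UNIV \<kappa>" and c: "c > 0" "\<And>w. \<kappa> w \<ge> c" and s0: "s\<^sub>0 > 0"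
  obtains g where "g 0 = s\<^sub>0" "\<And>t. g t > 0"
    "\<And>t. (g has_real_derivative - (g t / \<kappa> (ln (g t)))) (at t)" "(g \<longlongrightarrow> 0) at_top"
    "\<And>I f t. is_interval I \<Longrightarrow> 0 \<in> I \<Longrightarrow> f 0 = s\<^sub>0 \<Longrightarrow>
      (\<And>t. t \<in> I \<Longrightarrow> 0 < f t \<and> (f has_real_derivative - (f t / \<kappa> (ln (f t)))) (at t within I)) \<Longrightarrow>
      t \<in> I \<Longrightarrow> f t = g t"
proof -
  obtain T where T: "\<And>w. (T has_real_derivative \<kappa> w) (at w)"
    using continuous_real_antiderivative[OF \<kappa>] by blast
  have \<kappa>_pos: "\<kappa> w > 0" for w
    using c(1) c(2)[of w] by linarith
  have contT: "isCont T w" for w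
    by (rule DERIV_isCont[OF T])
  have mono: "T v < T w" if "v < w" for v w
  proof (rule DERIV_pos_imp_increasing[OF that])
    show "\<exists>y. (T has_real_derivative y) (at x) \<and> 0 < y" for x
      using T \<kappa>_pos by (intro exI[of _ "\<kappa> x"]) simp
  qed
  have growth: "T v + c * (w - v) \<le> T w" if "v \<le> w" for v w
  proof -
    have "T v - c * v \<le> T w - c * w"
    proof (rule DERIV_nonneg_imp_nondecreasing[OF that])
      fix x
      have "((\<lambda>x. T x - c * x) has_real_derivative \<kappa> x - c) (at x)"
        by (auto intro!: derivative_eq_intros T)
      then show "\<exists>y. ((\<lambda>x. T x - c * x) has_real_derivative y) (at x) \<and> 0 \<le> y"
        using c(2)[of x] by (intro exI[of _ "\<kappa> x - c"]) simp
    qed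
    then show ?thesis by (simp add: algebra_simps)
  qed
  have "\<exists>w. T w = \<tau>" for \<tau>
  proof -
    define d where "d = \<bar>\<tau> - T 0\<bar> / c"
    have d: "d \<ge> 0" "c * d = \<bar>\<tau> - T 0\<bar>"
      using c(1) by (simp_all add: d_def)
    have "T (- d) + c * d \<le> T 0" "T 0 + c * d \<le> T d"
      using growth[of "- d" 0] growth[of 0 d] d(1) by simp_all
    then have "T (- d) \<le> \<tau>" "\<tau> \<le> T d"
      unfolding d(2) by (simp_all add: abs_if split: if_splits)
    then show ?thesis
      using IVT[of T "- d" \<tau> d] d(1) contT by auto
  qed
  then obtain S where S: "\<And>\<tau>. T (S \<tau>) = \<tau>"
    by metis
  have ST: "S (T w) = w" for w
    using mono[of "S (T w)" w] mono[of w "S (T w)"] S[of "T w"] by (cases "S (T w)" w rule: linorder_cases) auto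
  have dS: "(S has_real_derivative inverse (\<kappa> (S \<tau>))) (at \<tau>)" for \<tau>
  proof (rule DERIV_inverse_function[where f = T and a = "\<tau> - 1" and b = "\<tau> + 1"])
    have "isCont S (T (S \<tau>))"
      by (rule isCont_inverse_function[where d = 1]) (auto simp: ST contT)
    then show "isCont S \<tau>" by (simp add: S)
    show "\<kappa> (S \<tau>) \<noteq> 0" using \<kappa>_pos[of "S \<tau>"] by simp
  qed (auto simp: S T)
  define g where "g t = exp (S (T (ln s\<^sub>0) - t))" for t
  have "(g has_real_derivative - (g t / \<kappa> (ln (g t)))) (at t)" for t
  proof -
    have "((\<lambda>t. T (ln s\<^sub>0) - t) has_real_derivative - 1) (at t)"
      by (auto intro!: derivative_eq_intros)
    from DERIV_chain2[OF DERIV_exp DERIV_chain2[OF dS this]]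
    show ?thesis
      unfolding g_def[abs_def] by (simp add: divide_inverse)
  qed
  moreover have "(g \<longlongrightarrow> 0) at_top"
  proof (rule tendstoI)
    fix e :: real assume e: "e > 0"
    have "g t < e" if "t > T (ln s\<^sub>0) - T (ln e)" for t
    proof -
      have "T (S (T (ln s\<^sub>0) - t)) < T (ln e)"
        using that by (simp add: S)
      then have "S (T (ln s\<^sub>0) - t) < ln e"
        using mono[of "ln e" "S (T (ln s\<^sub>0) - t)"]
        by (cases "ln e" "S (T (ln s\<^sub>0) - t)" rule: linorder_cases) auto
      then have "g t < exp (ln e)"
        unfolding g_def by (simp only: exp_less_mono)
      then show ?thesis
        using e by simp
    qed
    then show "\<forall>\<^sub>F t in at_top. dist (g t) 0 < e"
      unfolding eventually_at_top_dense by (auto simp: g_def)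
  qed
  moreover have "f t = g t"
    if I: "is_interval I" "0 \<in> I" "f 0 = s\<^sub>0" "t \<in> I"
      and f: "\<And>t. t \<in> I \<Longrightarrow> 0 < f t \<and> (f has_real_derivative - (f t / \<kappa> (ln (f t)))) (at t within I)"
    for I f t
  proof -
    have "\<exists>k. \<forall>t\<in>I. T (ln (f t)) + t = k"
    proof (rule has_field_derivative_zero_constant)
      show "convex I" using I(1) by (simp add: is_interval_convex)
      fix t assume t: "t \<in> I"
      have "((\<lambda>t. ln (f t)) has_real_derivative 1 / f t * - (f t / \<kappa> (ln (f t)))) (at t within I)"
        using f[OF t] by (intro DERIV_chain2[of ln] DERIV_ln_divide) auto
      from DERIV_add[OF DERIV_chain2[OF T this] DERIV_ident]
      show "((\<lambda>t. T (ln (f t)) + t) has_real_derivative 0) (at t within I)"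
        using f[OF t] \<kappa>_pos[of "ln (f t)"] by simp
    qed
    then obtain k where "\<And>t. t \<in> I \<Longrightarrow> T (ln (f t)) + t = k"
      by blast
    from this[OF I(2)] this[OF I(4)] have "T (ln s\<^sub>0) - t = T (ln (f t))"
      using I(3) by simp
    then have "S (T (ln s\<^sub>0) - t) = ln (f t)"
      by (simp add: ST)
    then show ?thesis
      using f[OF I(4)] by (simp add: g_def)
  qed
  moreover have "g 0 = s\<^sub>0" "\<And>t. g t > 0"
    using s0 by (simp_all add: g_def ST)
  ultimately show ?thesis
    by (intro that[of g]) blast+
qed

text \<open>For \<open>P = growth y\<close> one has \<open>1 - 1 / P \<le> ln P \<le> (n a + \<alpha>) y\<^sup>2\<close>. This bounds the speed of \<open>ln f\<close>,
  in particular as \<open>f\<close> tends to \<open>0\<close>.\<close>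

lemma growth_quot_le:
  assumes "1 \<le> n" "a > 0" "1 \<le> E" "\<alpha> \<ge> 0" and E: "E = 1" and y: "y > 0"
  shows "growth_quot n a \<alpha> y \<le> (real n * a + \<alpha>) * growth n a E \<alpha> y"
proof -
  note p = assms(1-4)
  let ?P = "growth n a E \<alpha> y"
  have P: "?P = (1 + a * y\<^sup>2) ^ n * exp (\<alpha> * y\<^sup>2)"
    by (rule unit_growth[OF p E])
  have pos: "1 + a * y\<^sup>2 > 0"
    using assms(2) by (simp add: add_pos_nonneg)
  have P_pos: "?P > 0"
    using growth_gt_1[OF p y] by simp
  have "ln (1 / ?P) \<le> 1 / ?P - 1"
    using P_pos by (intro ln_le_minus_one) simp
  then have "1 - 1 / ?P \<le> ln ?P"
    using P_pos by (simp add: ln_div)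
  also have "ln ?P = real n * ln (1 + a * y\<^sup>2) + \<alpha> * y\<^sup>2"
    unfolding P using pos by (simp add: ln_mult ln_realpow)
  also have "\<dots> \<le> real n * (a * y\<^sup>2) + \<alpha> * y\<^sup>2"
    using assms(2) by (intro add_right_mono mult_left_mono ln_add_one_self_le_self) auto
  finally have "(1 - 1 / ?P) * ?P \<le> ((real n * a + \<alpha>) * y\<^sup>2) * ?P"
    using P_pos by (intro mult_right_mono) (auto simp: algebra_simps)
  then have "y\<^sup>2 * growth_quot n a \<alpha> y \<le> y\<^sup>2 * ((real n * a + \<alpha>) * ?P)"
    unfolding growth_quot[OF p] P[symmetric] using P_pos by (simp add: algebra_simps)
  then show ?thesis
    using y by simp
qed

text \<open>Numerator and denominator of the right-hand side are multiplied by \<open>exp (\<alpha> f\<^sup>2)\<close> to bring the equation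
  into the form of \<open>decaying_flow\<close>, with \<open>\<kappa> = P / ((n - 1) q)\<close> where \<open>P - 1 = f\<^sup>2 q\<close>.\<close>

lemma ivp_global_solution:
  assumes n: "n \<ge> 2" and params: "a > 0" "\<alpha> \<ge> 0" and s0: "s\<^sub>0 > 0"
    and f: "ivp_solution n a 1 \<alpha> s\<^sub>0 I f"
  shows "\<exists>g. ivp_solution n a 1 \<alpha> s\<^sub>0 (I \<union> {0..}) g \<and> (\<forall>t\<in>I. g t = f t) \<and> (g \<longlongrightarrow> 0) at_top"
proof -
  have "1 \<le> n" "(1::real) \<le> 1"
    using n by simp_all
  note p = this(1) params(1) this(2) params(2)
  define m where "m = real n - 1"
  have m: "m > 0" using n by (simp add: m_def)
  define P where "P = growth n a 1 \<alpha>"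
  define q where "q = growth_quot n a \<alpha>"
  define \<kappa> where "\<kappa> w = P (exp w) / (m * q (exp w))" for w
  have q: "q y > 0" for y
    unfolding q_def by (rule growth_quot_pos[OF p])
  have cont: "continuous_on UNIV \<kappa>"
  proof -
    have "continuous_on UNIV (\<lambda>w. h (exp w))" if "Cinf_on UNIV h" for h :: "real \<Rightarrow> real"
      by (rule continuous_on_compose2[OF Cinf_on_continuous_on[OF that]]) (auto intro: continuous_intros)
    then have "continuous_on UNIV (\<lambda>w. P (exp w))" "continuous_on UNIV (\<lambda>w. q (exp w))"
      unfolding P_def q_def using Cinf_on_growth[OF p] by blast+
    moreover have "m * q (exp w) \<noteq> 0" for w
      using m q[of "exp w"] by simp
    ultimately show ?thesis
      unfolding \<kappa>_def[abs_def] by (intro continuous_intros) auto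
  qed
  define c where "c = 1 / (m * (real n * a + \<alpha>))"
  have k: "real n * a + \<alpha> > 0"
    using n params by (intro add_pos_nonneg) auto
  have c: "c > 0"
    using m k by (simp add: c_def)
  have lower: "c \<le> \<kappa> w" for w
  proof -
    have "q (exp w) \<le> (real n * a + \<alpha>) * P (exp w)"
      unfolding P_def q_def by (rule growth_quot_le[OF p]) auto
    moreover have "1 / (m * K) \<le> p / (m * y)" if "y \<le> K * p" "K > 0" "y > 0" for K p y
      using that m by (simp add: field_simps)
    ultimately show ?thesis
      unfolding c_def \<kappa>_def using k q by blast
  qed
  have speed: "- (real n - 1) * ((1 * (1 + a * y\<^sup>2) ^ n - exp (- \<alpha> * y\<^sup>2)) / (1 * y * (1 + a * y\<^sup>2) ^ n)) =
      - (y / \<kappa> (ln y))" if y: "y > 0" for y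
  proof -
    define A where "A = (1 + a * y\<^sup>2) ^ n"
    define B where "B = exp (\<alpha> * y\<^sup>2)"
    have pos: "A > 0" "B > 0"
      using params by (auto simp: A_def B_def add_pos_nonneg)
    have P: "P y = A * B"
      using unit_growth(1)[OF p refl, of y] by (simp add: P_def A_def B_def)
    have "q y = (A * B - 1) / y\<^sup>2"
      using growth_quot[OF p, of y] y by (simp add: q_def A_def B_def field_simps)
    then have "y / \<kappa> (ln y) = y * m * ((A * B - 1) / y\<^sup>2) / (A * B)"
      using y by (simp add: \<kappa>_def P ac_simps)
    also have "\<dots> = m * ((A - 1 / B) / (y * A))"
      using pos y by (simp add: field_simps power2_eq_square)
    also have "1 / B = exp (- \<alpha> * y\<^sup>2)"
      by (simp add: B_def exp_minus inverse_eq_divide)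
    finally show ?thesis
      by (simp only: A_def m_def mult_1 minus_mult_left)
  qed
  obtain g where g: "g 0 = s\<^sub>0" "\<And>t. g t > 0"
    "\<And>t. (g has_real_derivative - (g t / \<kappa> (ln (g t)))) (at t)" "(g \<longlongrightarrow> 0) at_top"
    and unique: "\<And>I f t. is_interval I \<Longrightarrow> 0 \<in> I \<Longrightarrow> f 0 = s\<^sub>0 \<Longrightarrow>
      (\<And>t. t \<in> I \<Longrightarrow> 0 < f t \<and> (f has_real_derivative - (f t / \<kappa> (ln (f t)))) (at t within I)) \<Longrightarrow>
      t \<in> I \<Longrightarrow> f t = g t"
    using decaying_flow[OF cont c lower s0] by blast
  have I: "is_interval I" "0 \<in> I" "f 0 = s\<^sub>0"
    using f by (simp_all add: ivp_solution_def)
  have "is_interval (I \<union> {0..})"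
    using I(1,2) unfolding is_interval_1 by (metis Un_iff atLeast_iff linear order_trans)
  then have "ivp_solution n a 1 \<alpha> s\<^sub>0 (I \<union> {0..}) g"
    unfolding ivp_solution_def using g(1-3) speed
    by (auto intro: has_field_derivative_at_within)
  moreover have "g t = f t" if "t \<in> I" for t
  proof (rule unique[where f = f, OF I _ that, symmetric])
    fix t assume "t \<in> I"
    then have "0 < f t" "(f has_real_derivative - (real n - 1) *
        ((1 * (1 + a * (f t)\<^sup>2) ^ n - exp (- \<alpha> * (f t)\<^sup>2)) / (1 * f t * (1 + a * (f t)\<^sup>2) ^ n)))
        (at t within I)"
      using f unfolding ivp_solution_def by blast+
    then show "0 < f t \<and> (f has_real_derivative - (f t / \<kappa> (ln (f t)))) (at t within I)"
      unfolding speed[OF \<open>0 < f t\<close>] by simp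
  qed
  ultimately show ?thesis
    using g(4) by blast
qed


section \<open>The theorem\<close>

theorem theorem1p1:
  fixes a E \<alpha> s\<^sub>0 :: real and I :: "real set" and f :: "real \<Rightarrow> real"
    and F :: "(real ^ 'n) \<times> real \<Rightarrow> complex ^ 'n"
  assumes n: "CARD('n) \<ge> 2"
    and params: "a > 0" "E \<ge> 1" "\<alpha> \<ge> 0"
    and F: "F = L_map a E \<alpha>"
    and s0: "s\<^sub>0 > 0"
    and f: "ivp_solution CARD('n) a E \<alpha> s\<^sub>0 I f"
  shows "mean_curvature_flow_in L_dom F (sphere 0 1) I (\<lambda>t. slice (f t)) \<and>
         (E = 1 \<longrightarrow>
            lagrangian_self_expander \<alpha> L_dom F \<and>
            (\<exists>g. ivp_solution CARD('n) a E \<alpha> s\<^sub>0 (I \<union> {0..}) g \<and> (\<forall>t\<in>I. g t = f t) \<and>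
                 (g \<longlongrightarrow> 0) at_top) \<and>
            minimal_hypersurface_in L_dom F (sphere 0 1) (slice 0))"
proof -
  have "1 \<le> CARD('n)"
    using n by simp
  note p = this params
  obtain \<Phi> where \<Phi>: "\<And>t. (\<Phi> has_real_derivative phase_rate CARD('n) a E \<alpha> t) (at t)"
    "\<And>s. s \<ge> 0 \<Longrightarrow> \<Phi> s = phase CARD('n) a E \<alpha> s"
    using phase_antiderivative[OF p] by blast
  define z where "z s = complex_of_real (radius a s) * exp (\<i> * complex_of_real (\<Phi> s))" for s
  let ?z' = "profile_velocity CARD('n) a E \<alpha> \<Phi>"
  have spun: "spun_curve J z ?z' F" if "open J" "\<And>s. s \<in> J \<Longrightarrow> s > 0 \<or> E = 1" for J
    unfolding z_def[abs_def] by (rule spun_curve_L_map[OF params F \<Phi> that])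
  have cmod_z: "cmod (z s) = radius a s" for s
    using radius_gt_0[OF p, of s] by (simp add: z_def norm_mult)
  have flow: "mean_curvature_flow_in L_dom F (sphere 0 1) I (\<lambda>t. slice (f t))"
    unfolding mean_curvature_flow_in_def
  proof (intro ballI conjI)
    (* The flow stays at positive s, where the parametrization is immersed for every E. *)
    interpret spun_curve "{0<..}" z ?z' F
      by (rule spun) auto
    fix t assume t: "t \<in> I"
    let ?v = "- (real CARD('n) - 1) * ((E * (1 + a * (f t)\<^sup>2) ^ CARD('n) - exp (- \<alpha> * (f t)\<^sup>2)) /
                             (E * f t * (1 + a * (f t)\<^sup>2) ^ CARD('n)))"
    have ft: "f t > 0" and df: "(f has_real_derivative ?v) (at t within I)"
      using f t unfolding ivp_solution_def by blast+
    show "immersed_in L_dom F (sphere 0 1) (slice (f t))"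
      using ft by (intro immersed_in_slice) auto
    fix x :: "real ^ 'n" assume "x \<in> sphere 0 1"
    then have x: "norm x = 1" by simp
    have "?v = - ((real CARD('n) - 1) * (Re (inverse (?z' (f t)) * z (f t)) / (cmod (z (f t)))\<^sup>2))"
      unfolding z_def cmod_z[unfolded z_def] flow_speed[OF p ft]
      by (rule minus_mult_left[symmetric])
    then have H: "has_mean_curvature_in L_dom F (sphere 0 1) (slice (f t)) x (?v *\<^sub>R cscale (?z' (f t)) x)"
      using slice_mean_curvature_at[OF x, of "f t"] ft by simp
    have "(z has_vector_derivative ?z' (f t)) (at (f t))"
      using ft by (intro z_deriv) auto
    then have "((\<lambda>t. z (f t)) has_vector_derivative ?v *\<^sub>R ?z' (f t)) (at t within I)"
      using vector_diff_chain_within[of f ?v t I z "?z' (f t)"] df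
      by (simp add: o_def has_real_derivative_iff_has_vector_derivative
          has_vector_derivative_at_within)
    from bounded_linear.has_vector_derivative[OF cscale.bounded_linear_left[of x] this]
    have "((\<lambda>t. cscale (z (f t)) x) has_vector_derivative ?v *\<^sub>R cscale (?z' (f t)) x) (at t within I)"
      by (simp add: cscale.scaleR_left)
    then have "((\<lambda>t. F (slice (f t) x)) has_vector_derivative ?v *\<^sub>R cscale (?z' (f t)) x) (at t within I)"
    proof (rule has_vector_derivative_transform[OF t, rotated])
      fix u assume "u \<in> I"
      then have "f u > 0"
        using f unfolding ivp_solution_def by blast
      then show "F (slice (f u) x) = cscale (z (f u)) x"
        using F_eq[OF x] by (simp add: slice_def)
    qed
    with H show "\<exists>H. has_mean_curvature_in L_dom F (sphere 0 1) (slice (f t)) x H \<and>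
        ((\<lambda>t. F (slice (f t) x)) has_vector_derivative H) (at t within I)" by blast
  qed
  have "lagrangian_self_expander \<alpha> L_dom F \<and>
      (\<exists>g. ivp_solution CARD('n) a E \<alpha> s\<^sub>0 (I \<union> {0..}) g \<and> (\<forall>t\<in>I. g t = f t) \<and>
        (g \<longlongrightarrow> 0) at_top) \<and>
      minimal_hypersurface_in L_dom F (sphere 0 1) (slice 0)" if E: "E = 1"
  proof (intro conjI)
    interpret spun_curve UNIV z ?z' F
      by (rule spun) (use E in auto)
    have L: "patch L_dom"
      by (auto simp: patch_def dom_ext_def)
    obtain m where m: "CARD('n) = Suc m"
      using \<open>1 \<le> CARD('n)\<close> by (cases "CARD('n)") auto
    show "lagrangian_self_expander \<alpha> L_dom F"
    proof (rule expander_L[OF L m])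
      fix s :: real
      show "\<exists>z''. (?z' has_vector_derivative z'') (at s) \<and>
          Im (inverse (?z' s) * (inverse ((cmod (?z' s))\<^sup>2) *\<^sub>R z'' -
            (real m / (cmod (z s))\<^sup>2 + \<alpha>) *\<^sub>R z s)) = 0"
        using expander_equation[OF p E \<Phi>(1) m] unfolding z_def by metis
    qed
    show "\<exists>g. ivp_solution CARD('n) a E \<alpha> s\<^sub>0 (I \<union> {0..}) g \<and> (\<forall>t\<in>I. g t = f t) \<and>
        (g \<longlongrightarrow> 0) at_top"
      using ivp_global_solution[OF n params(1,3) s0] f unfolding E by blast
    show "minimal_hypersurface_in L_dom F (sphere 0 1) (slice 0)"
      using profile_angle[OF p, of \<Phi> 0] by (intro minimal_slice[OF L]) (simp_all only: z_def order_refl div_0)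
  qed
  with flow show ?thesis by blast
qed

end
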